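(* The following seven statements are equivalent: (1) there exists a partial surjective poly-one one-way function; (2) there exists a total surjective poly-one one-way function; (3) there exists a total poly-one one-way function $f$ with $\mathrm{range}(f)\in\mathrm{P}$; (4) there exists a partial poly-one one-way function $f$ with $\mathrm{range}(f)\in\mathrm{P}$; (5) $\mathrm{Easy}_{\forall}^{\forall}(\mathrm{FewP})\neq\mathrm{P}$; (6) $\Sigma^\ast\notin\mathrm{Easy}_{\forall}^{\forall}(\mathrm{FewP})$; (7) $\mathrm{Easy}_{\forall}^{\forall}(\mathrm{FewP})$ is not closed under complementation (with respect to $\Sigma^\ast$).
   Context: All languages are subsets of $\Sigma^\ast$ with $\Sigma=\{0,1\}$. An NPM is a nondeterministic polynomial-time Turing machine; for an NPM $M$, $L(M)$ is its accepted language and $\mathrm{acc}_M(x)$ the set of (encodings of) accepting paths on input $x$. A FewP machine is an NPM for which there is a polynomial $q$ such that on every input $x$ it has at most $q(|x|)$ accepting paths; FewP is the class of languages accepted by FewP machines. FP is the class of total functions computable in deterministic polynomial time. $\mathrm{Easy}_{\forall}^{\forall}(\mathrm{FewP})$ is the class of all languages $L$ that either are finite, or satisfy (a) $L\in\mathrm{FewP}$ and (b) for every FewP machine $N$ with $L(N)=L$ there is $f_N\in\mathrm{FP}$ with $f_N(x)\in\mathrm{acc}_N(x)$ for all $x\in L$. Functions are partial (unless called total) maps $\Sigma^\ast\to\Sigma^\ast$ with domain $\mathrm{dom}(f)$ and range $\mathrm{range}(f)$; surjective means $\mathrm{range}(f)=\Sigma^\ast$. $f$ is honest if there is a polynomial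 $p$ such that for every $y\in\mathrm{range}(f)$ and every $x\in\mathrm{dom}(f)$ with $f(x)=y$, $|x|\le p(|y|)$. $f$ is poly-one if there is a polynomial $p$ with $\|f^{-1}(y)\|\le p(|y|)$ for every $y\in\mathrm{range}(f)$. $f$ is FP-invertible if there is $g\in\mathrm{FP}$ such that for every $y\in\mathrm{range}(f)$, $g(y)$ is some element of $f^{-1}(y)$. A poly-one one-way function is a function that is honest, poly-one, computable in polynomial time (for partial functions, including recognizing where it is undefined), and not FP-invertible. *)

theory Defs
  imports "HOL-Computational_Algebra.Polynomial"
begin

type_synonym bstring = "bool list"

subsection \<open>Multitape nondeterministic Turing machines\<close>

text \<open>
  States and tape symbols are natural numbers. A machine has states
  \<open>0, \<dots>, num_states - 1\<close> with start state \<open>0\<close>, symbols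
  \<open>0, \<dots>, num_syms - 1\<close>, and \<open>num_tapes\<close> two-way infinite tapes. Symbol \<open>0\<close> is the
  blank, \<open>1\<close> and \<open>2\<close> are the two input letters; the rest are work symbols.
  \<open>delta q rs\<close> lists, without repetition, the moves available in state \<open>q\<close> when the heads
  scan the symbols \<open>rs\<close>. It is a list rather than a set only in order to number the
  nondeterministic choices. The machine halts when the list is empty.
\<close>

datatype dir = Left_Move | No_Move | Right_Move

type_synonym action = "nat \<times> (nat \<times> dir) list"

record tm =
  num_tapes :: nat
  num_states :: nat
  num_syms :: nat
  delta :: "nat \<Rightarrow> nat list \<Rightarrow> action list"
  accepting :: "nat set"

definition wf_tm :: "tm \<Rightarrow> bool" where
  "wf_tm M \<longleftrightarrow>
     num_tapes M \<ge> 1 \<and> num_states M \<ge> 1 \<and> num_syms M \<ge> 3 \<and>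
     (\<forall>q < num_states M. \<forall>rs. length rs = num_tapes M \<and> set rs \<subseteq> {..<num_syms M} \<longrightarrow>
        distinct (delta M q rs) \<and>
        (\<forall>(q', ws) \<in> set (delta M q rs).
           q' < num_states M \<and> length ws = num_tapes M \<and> fst ` set ws \<subseteq> {..<num_syms M}))"

definition deterministic :: "tm \<Rightarrow> bool" where
  "deterministic M \<longleftrightarrow>
     (\<forall>q < num_states M. \<forall>rs. length rs = num_tapes M \<and> set rs \<subseteq> {..<num_syms M} \<longrightarrow>
        length (delta M q rs) \<le> 1)"

text \<open>A tape consists of its contents and the head position.\<close>

type_synonym tape = "(int \<Rightarrow> nat) \<times> int"

type_synonym config = "nat \<times> tape list"

definition scanned :: "tape \<Rightarrow> nat" where
  "scanned t = fst t (snd t)"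

fun move :: "dir \<Rightarrow> int \<Rightarrow> int" where
  "move Left_Move h = h - 1"
| "move No_Move h = h"
| "move Right_Move h = h + 1"

fun write_move :: "nat \<times> dir \<Rightarrow> tape \<Rightarrow> tape" where
  "write_move (s, d) (c, h) = (c(h := s), move d h)"

fun apply_action :: "action \<Rightarrow> config \<Rightarrow> config" where
  "apply_action (q', ws) (q, ts) = (q', map2 write_move ws ts)"

definition moves :: "tm \<Rightarrow> config \<Rightarrow> action list" where
  "moves M c = delta M (fst c) (map scanned (snd c))"

definition halted :: "tm \<Rightarrow> config \<Rightarrow> bool" where
  "halted M c \<longleftrightarrow> moves M c = []"

text \<open>
  A computation path is given by the sequence of choices made along it, one per step.
  Since the moves available at a configuration are pairwise distinct and distinct moves yield
  distinct configurations, choice sequences correspond bijectively to sequences of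
  configurations. In particular a deterministic step does not multiply the number of paths.
\<close>

fun run :: "tm \<Rightarrow> config \<Rightarrow> nat list \<Rightarrow> config option" where
  "run M c [] = Some c"
| "run M c (i # is) =
     (if i < length (moves M c) then run M (apply_action (moves M c ! i) c) is else None)"

definition bit_sym :: "bool \<Rightarrow> nat" where
  "bit_sym b = (if b then 2 else 1)"

definition string_tape :: "bstring \<Rightarrow> tape" where
  "string_tape w =
     ((\<lambda>i. if 0 \<le> i \<and> i < int (length w) then bit_sym (w ! nat i) else 0), 0)"

definition init_config :: "tm \<Rightarrow> bstring \<Rightarrow> config" where
  "init_config M x = (0, string_tape x # replicate (num_tapes M - 1) (string_tape []))"

definition acc_choices :: "tm \<Rightarrow> bstring \<Rightarrow> nat list set" where
  "acc_choices M x =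
     {cs. \<exists>c. run M (init_config M x) cs = Some c \<and> halted M c \<and> fst c \<in> accepting M}"

definition encode_choices :: "nat list \<Rightarrow> bstring" where
  "encode_choices cs = concat (map (\<lambda>i. replicate i True @ [False]) cs)"

lemma encode_choices_inject: "encode_choices cs = encode_choices ds \<longleftrightarrow> cs = ds"
proof
  have cell: "i = j \<and> u = v"
    if "replicate i True @ False # u = replicate j True @ False # v" for i j u v
    using that
  proof (induction i arbitrary: j)
    case 0
    then show ?case by (cases j) auto
  next
    case (Suc i)
    then show ?case by (cases j) auto
  qed
  show "cs = ds" if "encode_choices cs = encode_choices ds"
    using that
  proof (induction cs arbitrary: ds)
    case Nil
    then show ?case by (cases ds) (auto simp: encode_choices_def)
  next
    case (Cons i cs)
    then show ?case
      by (cases ds) (auto simp: encode_choices_def dest!: cell)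
  qed
qed simp

definition acc :: "tm \<Rightarrow> bstring \<Rightarrow> bstring set" where
  "acc M x = encode_choices ` acc_choices M x"

definition lang :: "tm \<Rightarrow> bstring set" where
  "lang M = {x. acc M x \<noteq> {}}"

subsection \<open>Complexity classes\<close>

definition NPM :: "tm \<Rightarrow> bool" where
  "NPM M \<longleftrightarrow> wf_tm M \<and>
     (\<exists>p :: nat poly. \<forall>x cs. run M (init_config M x) cs \<noteq> None \<longrightarrow>
        length cs \<le> poly p (length x))"

definition FewP_machine :: "tm \<Rightarrow> bool" where
  "FewP_machine M \<longleftrightarrow> NPM M \<and>
     (\<exists>q :: nat poly. \<forall>x. finite (acc M x) \<and> card (acc M x) \<le> poly q (length x))"

definition FewP :: "bstring set set" where
  "FewP = {lang M | M. FewP_machine M}"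

definition PTIME :: "bstring set set" where
  "PTIME = {lang M | M. NPM M \<and> deterministic M}"

text \<open>
  A partial function is computed by a deterministic machine that accepts exactly the strings in
  its domain and, on these, halts with the first tape containing just the value and its head on
  the first letter. The contents of the other tapes are ignored.
\<close>

definition ptime_computable :: "(bstring \<rightharpoonup> bstring) \<Rightarrow> bool" where
  "ptime_computable f \<longleftrightarrow>
     (\<exists>M. NPM M \<and> deterministic M \<and> lang M = dom f \<and>
        (\<forall>x y. f x = Some y \<longrightarrow>
           (\<exists>cs c. run M (init_config M x) cs = Some c \<and> halted M c \<and>
              hd (snd c) = string_tape y)))"

definition FP :: "(bstring \<Rightarrow> bstring) set" where
  "FP = {f. ptime_computable (\<lambda>x. Some (f x))}"

definition Easy_FewP :: "bstring set set" where
  "Easy_FewP =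
     {L. finite L \<or>
         (L \<in> FewP \<and>
          (\<forall>N. FewP_machine N \<and> lang N = L \<longrightarrow> (\<exists>f\<in>FP. \<forall>x\<in>L. f x \<in> acc N x)))}"

subsection \<open>One-way functions\<close>

definition is_surjective :: "(bstring \<rightharpoonup> bstring) \<Rightarrow> bool" where
  "is_surjective f \<longleftrightarrow> ran f = UNIV"

definition is_total :: "(bstring \<rightharpoonup> bstring) \<Rightarrow> bool" where
  "is_total f \<longleftrightarrow> dom f = UNIV"

definition honest :: "(bstring \<rightharpoonup> bstring) \<Rightarrow> bool" where
  "honest f \<longleftrightarrow>
     (\<exists>p :: nat poly. \<forall>x y. f x = Some y \<longrightarrow> length x \<le> poly p (length y))"

definition poly_one :: "(bstring \<rightharpoonup> bstring) \<Rightarrow> bool" where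
  "poly_one f \<longleftrightarrow>
     (\<exists>p :: nat poly. \<forall>y \<in> ran f.
        finite {x. f x = Some y} \<and> card {x. f x = Some y} \<le> poly p (length y))"

definition FP_invertible :: "(bstring \<rightharpoonup> bstring) \<Rightarrow> bool" where
  "FP_invertible f \<longleftrightarrow> (\<exists>g\<in>FP. \<forall>y \<in> ran f. f (g y) = Some y)"

definition poly_one_one_way :: "(bstring \<rightharpoonup> bstring) \<Rightarrow> bool" where
  "poly_one_one_way f \<longleftrightarrow> honest f \<and> poly_one f \<and> ptime_computable f \<and> \<not> FP_invertible f"

definition all_equivalent :: "bool list \<Rightarrow> bool" where
  "all_equivalent Ss \<longleftrightarrow> (\<forall>S \<in> set Ss. \<forall>T \<in> set Ss. S \<longleftrightarrow> T)"

end

theory Submission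
  imports Defs
begin

text \<open>
  If a function \<open>f\<close> as in the fourth statement exists, let \<open>N\<close> guess a preimage of its input \<open>y\<close>,
  and accept on a single path if \<open>y\<close> is not in the range. Then \<open>N\<close> is a FewP machine for
  \<open>\<Sigma>\<^sup>*\<close>, and a function producing accepting paths of \<open>N\<close> would invert \<open>f\<close>. Conversely, a FewP
  machine \<open>N\<close> for \<open>\<Sigma>\<^sup>*\<close> without easy accepting paths gives the one-way function sending
  \<open>0\<langle>x, p\<rangle>\<close> to \<open>0x\<close> if \<open>p\<close> is an accepting path on \<open>x\<close>, and every other \<open>bw\<close> to \<open>1w\<close>: the junk fills
  up the range without helping to invert the values \<open>0x\<close>. The remaining equivalences hold since
  \<open>Easy\<close> is always contained in P, and equals P once it contains \<open>\<Sigma>\<^sup>*\<close>: given a FewP machine for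
  \<open>L \<in> P\<close>, accept the complement of \<open>L\<close> on one additional path.

  All machines are obtained from a few concrete ones by sequential composition and by placing a
  machine on selected tapes of a larger one. Each intermediate result gets a fresh tape, so
  that neither loops nor branching are needed at the level of composition: polynomially long
  iteration occurs only in the concrete machines, and both alternatives of a case distinction are
  computed.
\<close>

subsection \<open>Composing machines\<close>

text \<open>Selectors return encoded paths and FewP counts paths, so knowing which inputs a machine
  accepts is not enough: the exact set of its halting choice sequences has to be followed through
  every construction. A step with only one available move is always choice \<open>0\<close>, so a
  deterministic stage adds nothing but zeros to a path. The only nondeterministic stage writes a
  guessed string, with choices \<open>1\<close> and \<open>2\<close> for its bits and
  \<open>0\<close> for its end. Hence each witness has exactly one accepting path, and a
  finite-state scan that keeps only \<open>1\<close> and \<open>2\<close> recovers it. Deciding the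
  range of \<open>f\<close> is what permits the extra path: it has to be accepted exactly on inputs
  without a preimage, so that the machine accepts every string while each accepting path on an
  element of the range still encodes a preimage. Unary codes of choices keep paths polynomially long
  because the branching of a machine is bounded by a constant. Checking a given path takes no longer
  than reading it, since the path dictates every step of the simulation.\<close>

definition okc :: "tm \<Rightarrow> config \<Rightarrow> bool" where
  "okc M c \<longleftrightarrow> fst c < num_states M \<and> length (snd c) = num_tapes M \<and>
     (\<forall>t \<in> set (snd c). \<forall>i. fst t i < num_syms M)"

text \<open>All halting paths are kept together with their end, accepting or not, because acceptance
  is often decided by a machine that runs later.\<close>

definition outcomes :: "tm \<Rightarrow> tape list \<Rightarrow> (nat list \<times> nat \<times> tape list) set" where
  "outcomes M ts = {(cs, q, ts'). run M (0, ts) cs = Some (q, ts') \<and> halted M (q, ts')}"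

definition time_le :: "tm \<Rightarrow> tape list \<Rightarrow> nat \<Rightarrow> bool" where
  "time_le M ts t \<longleftrightarrow> (\<forall>cs. run M (0, ts) cs \<noteq> None \<longrightarrow> length cs \<le> t)"

text \<open>The only outcome is reached by choices \<open>0\<close>, which is how determinism shows
  in the encoding of paths. The time bound is a separate requirement: \<open>outcomes\<close> sees
  halting paths only, whereas \<open>NPM\<close> limits every partial run.\<close>

definition yields :: "tm \<Rightarrow> tape list \<Rightarrow> nat \<Rightarrow> nat \<Rightarrow> tape list \<Rightarrow> bool" where
  "yields M ts t q ts' \<longleftrightarrow>
     time_le M ts t \<and> (\<exists>k. outcomes M ts = {(replicate k 0, q, ts')})"

lemma yields_mono: "yields M ts t q ts' \<Longrightarrow> t \<le> t' \<Longrightarrow> yields M ts t' q ts'"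
  unfolding yields_def time_le_def by (meson le_trans)

lemma apply_action_def': "apply_action a c = (fst a, map2 write_move (snd a) (snd c))"
  by (cases a; cases c) simp

lemma scanned_less:
  "okc M c \<Longrightarrow> length (map scanned (snd c)) = num_tapes M \<and> set (map scanned (snd c)) \<subseteq> {..<num_syms M}"
  unfolding okc_def scanned_def by auto

lemma write_move_less:
  "fst w < S \<Longrightarrow> \<forall>i. fst t i < S \<Longrightarrow> fst (write_move w t) i < S"
  by (cases w; cases t) auto

lemma wf_tm_moves:
  assumes "wf_tm M" "okc M c" "a \<in> set (moves M c)"
  shows "fst a < num_states M" "length (snd a) = num_tapes M" "fst ` set (snd a) \<subseteq> {..<num_syms M}"
proof -
  have "\<forall>(q', ws) \<in> set (delta M (fst c) (map scanned (snd c))).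
           q' < num_states M \<and> length ws = num_tapes M \<and> fst ` set ws \<subseteq> {..<num_syms M}"
    using assms(1) scanned_less[OF assms(2)] assms(2) unfolding wf_tm_def okc_def by blast
  then show "fst a < num_states M" "length (snd a) = num_tapes M" "fst ` set (snd a) \<subseteq> {..<num_syms M}"
    using assms(3) unfolding moves_def by (auto simp: case_prod_beta)
qed

lemma okc_apply_action:
  assumes "wf_tm M" "okc M c" "a \<in> set (moves M c)"
  shows "okc M (apply_action a c)"
proof -
  note a = wf_tm_moves[OF assms]
  have "fst (write_move w t) i < num_syms M" if "(w, t) \<in> set (zip (snd a) (snd c))" for w t i
  proof -
    have "w \<in> set (snd a)" "t \<in> set (snd c)"
      using that by (auto dest: set_zip_leftD set_zip_rightD)
    then show ?thesis
      using a(3) assms(2) by (intro write_move_less) (auto simp: okc_def)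
  qed
  then show ?thesis
    using a assms(2) unfolding okc_def apply_action_def' by auto
qed

lemma okc_run:
  assumes "wf_tm M" "okc M c" "run M c cs = Some c'"
  shows "okc M c'"
  using assms(2,3)
proof (induction cs arbitrary: c)
  case (Cons i cs)
  then show ?case
    using okc_apply_action[OF assms(1) Cons.prems(1), of "moves M c ! i"]
    by (auto split: if_splits)
qed simp

lemma run_accepting_update: "run (M\<lparr>accepting := A\<rparr>) c cs = run M c cs"
  by (induction cs arbitrary: c) (auto simp: moves_def)

lemma yields_accepting_update: "yields (M\<lparr>accepting := A\<rparr>) ts t q ts' = yields M ts t q ts'"
  unfolding yields_def outcomes_def time_le_def run_accepting_update halted_def moves_def by simp

text \<open>Determinism is asked for only along the run itself, so concrete machines can be followed
  configuration by configuration.\<close>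

fun dsteps :: "tm \<Rightarrow> config \<Rightarrow> nat \<Rightarrow> config \<Rightarrow> bool" where
  "dsteps M c 0 c' \<longleftrightarrow> c = c'"
| "dsteps M c (Suc t) c' \<longleftrightarrow> (\<exists>a. moves M c = [a] \<and> dsteps M (apply_action a c) t c')"

lemma dsteps_add: "dsteps M c s c' \<Longrightarrow> dsteps M c' t c'' \<Longrightarrow> dsteps M c (s + t) c''"
  by (induction s arbitrary: c) auto

lemma dsteps_1: "moves M c = [a] \<Longrightarrow> apply_action a c = c' \<Longrightarrow> dsteps M c 1 c'"
  by auto

lemma dsteps_first:
  "moves M c = [a] \<Longrightarrow> apply_action a c = c' \<Longrightarrow> dsteps M c' t c'' \<Longrightarrow> dsteps M c (Suc t) c''"
  by auto

text \<open>Every configuration before \<open>c'\<close> offers exactly one move and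
  \<open>c'\<close> offers none, so a halting run can neither deviate, nor stop early, nor go
  on.\<close>

lemma dsteps_run_iff:
  assumes "dsteps M c t c'" "halted M c'"
  shows "run M c cs = Some d \<and> halted M d \<longleftrightarrow> cs = replicate t 0 \<and> d = c'"
  using assms(1)
proof (induction t arbitrary: c cs)
  case 0
  then show ?case using assms(2) by (cases cs) (auto simp: halted_def)
next
  case (Suc t)
  then obtain a where a: "moves M c = [a]" "dsteps M (apply_action a c) t c'" by auto
  show ?case
  proof (cases cs)
    case Nil
    then show ?thesis using a by (auto simp: halted_def)
  next
    case (Cons i ds)
    then show ?thesis using a(1) Suc.IH[OF a(2), of ds] by auto
  qed
qed

lemma dsteps_time:
  assumes "dsteps M c t c'" "halted M c'" "run M c cs \<noteq> None"
  shows "length cs \<le> t"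
  using assms(1,3)
proof (induction t arbitrary: c cs)
  case 0
  then show ?case using assms(2) by (cases cs) (auto simp: halted_def)
next
  case (Suc t)
  then show ?case by (cases cs) (auto split: if_splits)
qed

lemma yields_dsteps:
  assumes "dsteps M (0, ts) t (q, ts')" "halted M (q, ts')"
  shows "yields M ts t q ts'"
  unfolding yields_def time_le_def outcomes_def
  using dsteps_run_iff[OF assms] dsteps_time[OF assms] by auto

text \<open>A deterministic machine can only run forever or reach a unique outcome; the time bound
  excludes the former.\<close>

lemma yields_deterministic:
  assumes "wf_tm M" "deterministic M" "okc M (0, ts)" "time_le M ts t"
  shows "\<exists>q ts'. yields M ts t q ts'"
proof -
  have "\<exists>k c'. dsteps M c k c' \<and> halted M c'"
    if "okc M c" "\<forall>cs. run M c cs \<noteq> None \<longrightarrow> length cs \<le> t" for c t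
    using that
  proof (induction t arbitrary: c)
    case 0
    have "halted M c"
    proof (rule ccontr)
      assume "\<not> halted M c"
      then have "run M c [0] \<noteq> None" by (auto simp: halted_def)
      then have "length [0::nat] \<le> 0" using 0(2) by blast
      then show False by simp
    qed
    then show ?case by (metis dsteps.simps(1))
  next
    case (Suc t)
    show ?case
    proof (cases "halted M c")
      case True
      then show ?thesis by (metis dsteps.simps(1))
    next
      case False
      have "length (moves M c) \<le> 1"
        using assms(2) Suc.prems(1) scanned_less[OF Suc.prems(1)]
        unfolding deterministic_def moves_def okc_def by blast
      with False obtain a where a: "moves M c = [a]"
        unfolding halted_def by (cases "moves M c") auto
      have "okc M (apply_action a c)"
        using okc_apply_action[OF assms(1) Suc.prems(1)] a by simp
      moreover have "\<forall>cs. run M (apply_action a c) cs \<noteq> None \<longrightarrow> length cs \<le> t"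
      proof (intro allI impI)
        fix cs assume "run M (apply_action a c) cs \<noteq> None"
        then have "run M c (0 # cs) \<noteq> None" using a by simp
        then have "length (0 # cs) \<le> Suc t" using Suc.prems(2) by blast
        then show "length cs \<le> t" by simp
      qed
      ultimately obtain k c' where "dsteps M (apply_action a c) k c'" "halted M c'"
        using Suc.IH by blast
      then have "dsteps M c (Suc k) c'" using a by simp
      then show ?thesis using \<open>halted M c'\<close> by blast
    qed
  qed
  from this[OF assms(3), of t] assms(4) obtain k q ts' where
    "dsteps M (0, ts) k (q, ts')" "halted M (q, ts')"
    unfolding time_le_def by auto
  then show ?thesis
    using yields_dsteps assms(4) unfolding yields_def by blast
qed

text \<open>The linking step between the two machines may write, so that it can record whether \<open>M1\<close>
  accepted.\<close>

definition seq :: "(nat \<Rightarrow> nat list \<Rightarrow> (nat \<times> dir) list) \<Rightarrow> tm \<Rightarrow> tm \<Rightarrow> tm" where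
  "seq h M1 M2 = \<lparr>num_tapes = num_tapes M1, num_states = num_states M1 + num_states M2,
     num_syms = num_syms M1,
     delta = (\<lambda>q rs. if q < num_states M1
        then if delta M1 q rs = [] then [(num_states M1, h q rs)] else delta M1 q rs
        else map (\<lambda>(q', ws). (num_states M1 + q', ws)) (delta M2 (q - num_states M1) rs)),
     accepting = (+) (num_states M1) ` accepting M2\<rparr>"

definition good_link :: "nat \<Rightarrow> nat \<Rightarrow> (nat \<Rightarrow> nat list \<Rightarrow> (nat \<times> dir) list) \<Rightarrow> bool" where
  "good_link K S h \<longleftrightarrow> (\<forall>q rs. length rs = K \<and> set rs \<subseteq> {..<S} \<longrightarrow>
     length (h q rs) = K \<and> fst ` set (h q rs) \<subseteq> {..<S})"

definition seq_ok :: "tm \<Rightarrow> tm \<Rightarrow> bool" where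
  "seq_ok M1 M2 \<longleftrightarrow> wf_tm M1 \<and> wf_tm M2 \<and> num_tapes M1 = num_tapes M2 \<and> num_syms M1 = num_syms M2"

lemma seq_simps [simp]:
  "num_tapes (seq h M1 M2) = num_tapes M1"
  "num_syms (seq h M1 M2) = num_syms M1"
  "num_states (seq h M1 M2) = num_states M1 + num_states M2"
  "accepting (seq h M1 M2) = (+) (num_states M1) ` accepting M2"
  by (simp_all add: seq_def)

lemma wf_tm_seq:
  assumes "seq_ok M1 M2" "good_link (num_tapes M1) (num_syms M1) h"
  shows "wf_tm (seq h M1 M2)"
proof -
  have 1: "wf_tm M1" "wf_tm M2" "num_tapes M2 = num_tapes M1" "num_syms M2 = num_syms M1"
    using assms(1) by (auto simp: seq_ok_def)
  have "distinct (delta (seq h M1 M2) q rs) \<and> (\<forall>(q', ws) \<in> set (delta (seq h M1 M2) q rs).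
          q' < num_states (seq h M1 M2) \<and> length ws = num_tapes M1 \<and> fst ` set ws \<subseteq> {..<num_syms M1})"
    if q: "q < num_states M1 + num_states M2" and rs: "length rs = num_tapes M1" "set rs \<subseteq> {..<num_syms M1}" for q rs
  proof (cases "q < num_states M1")
    case True
    have "distinct (delta M1 q rs) \<and> (\<forall>(q', ws) \<in> set (delta M1 q rs).
          q' < num_states M1 \<and> length ws = num_tapes M1 \<and> fst ` set ws \<subseteq> {..<num_syms M1})"
      using 1(1) True rs unfolding wf_tm_def by blast
    moreover have "num_states M2 \<ge> 1" using 1(2) by (simp add: wf_tm_def)
    moreover have "length (h q rs) = num_tapes M1 \<and> fst ` set (h q rs) \<subseteq> {..<num_syms M1}"
      using assms(2) rs unfolding good_link_def by blast
    moreover have "delta (seq h M1 M2) q rs = (if delta M1 q rs = [] then [(num_states M1, h q rs)] else delta M1 q rs)"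
      using True by (simp add: seq_def)
    ultimately show ?thesis
      by (simp add: case_prod_beta trans_less_add1)
  next
    case False
    have "distinct (delta M2 (q - num_states M1) rs) \<and> (\<forall>(q', ws) \<in> set (delta M2 (q - num_states M1) rs).
          q' < num_states M2 \<and> length ws = num_tapes M1 \<and> fst ` set ws \<subseteq> {..<num_syms M1})"
    proof -
      have "q - num_states M1 < num_states M2" using False q by simp
      then show ?thesis using 1(2-4) rs unfolding wf_tm_def by auto
    qed
    then show ?thesis
      using False by (simp add: seq_def distinct_map inj_on_def case_prod_beta prod_eq_iff)
  qed
  moreover have "num_tapes M1 \<ge> 1" "num_states M1 \<ge> 1" "num_syms M1 \<ge> 3"
    using 1 unfolding wf_tm_def by auto
  ultimately show ?thesis
    unfolding wf_tm_def seq_simps by (simp only: trans_le_add1) blast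
qed

lemma deterministic_seq:
  assumes "seq_ok M1 M2" "deterministic M1" "deterministic M2"
  shows "deterministic (seq h M1 M2)"
  unfolding deterministic_def
proof (intro allI impI)
  fix q rs
  assume q: "q < num_states (seq h M1 M2)"
    and rs: "length rs = num_tapes (seq h M1 M2) \<and> set rs \<subseteq> {..<num_syms (seq h M1 M2)}"
  show "length (delta (seq h M1 M2) q rs) \<le> 1"
  proof (cases "q < num_states M1")
    case True
    then have "length (delta M1 q rs) \<le> 1" using rs assms(2) by (simp add: deterministic_def)
    then show ?thesis using True by (simp add: seq_def)
  next
    case False
    then have "q - num_states M1 < num_states M2" using q by simp
    then have "length (delta M2 (q - num_states M1) rs) \<le> 1"
      using rs assms(1,3) by (simp add: deterministic_def seq_ok_def)
    then show ?thesis using False by (simp add: seq_def)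
  qed
qed

lemma moves_seq_2:
  "moves (seq h M1 M2) (num_states M1 + q, ts) =
     map (\<lambda>(q', ws). (num_states M1 + q', ws)) (moves M2 (q, ts))"
  by (simp add: moves_def seq_def)

lemma run_seq_2:
  "run (seq h M1 M2) (num_states M1 + q, ts) cs =
     map_option (\<lambda>(q', ts'). (num_states M1 + q', ts')) (run M2 (q, ts) cs)"
proof (induction cs arbitrary: q ts)
  case (Cons i cs)
  show ?case
  proof (cases "i < length (moves M2 (q, ts))")
    case True
    obtain q' ws where a: "moves M2 (q, ts) ! i = (q', ws)" by fastforce
    then show ?thesis using True Cons[of q' "map2 write_move ws ts"] by (simp add: moves_seq_2)
  next
    case False
    then show ?thesis by (simp add: moves_seq_2)
  qed
qed simp

lemmas run_seq_2_0 = run_seq_2[where q = 0, simplified]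

lemma halted_seq_2: "halted (seq h M1 M2) (num_states M1 + q, ts) = halted M2 (q, ts)"
  by (simp add: halted_def moves_seq_2)

abbreviation link :: "(nat \<Rightarrow> nat list \<Rightarrow> (nat \<times> dir) list) \<Rightarrow> nat \<Rightarrow> tape list \<Rightarrow> tape list" where
  "link h q ts \<equiv> map2 write_move (h q (map scanned ts)) ts"

lemma moves_seq_1:
  assumes "fst c < num_states M1"
  shows "moves (seq h M1 M2) c =
    (if halted M1 c then [(num_states M1, h (fst c) (map scanned (snd c)))] else moves M1 c)"
  using assms by (auto simp: moves_def seq_def halted_def)

text \<open>The \<open>0\<close> between the two paths is the linking step, which becomes available
  exactly where \<open>M1\<close> halts. It keeps the composite from halting during the first phase,
  so a halting run passes through it.\<close>

lemma run_seq:
  assumes "wf_tm M1" "okc M1 c"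
  shows "run (seq h M1 M2) c cs = Some d \<and> halted (seq h M1 M2) d \<longleftrightarrow>
    (\<exists>cs1 q1 ts1 cs2 q2 ts2. cs = cs1 @ 0 # cs2 \<and> run M1 c cs1 = Some (q1, ts1) \<and> halted M1 (q1, ts1) \<and>
       run M2 (0, link h q1 ts1) cs2 = Some (q2, ts2) \<and> halted M2 (q2, ts2) \<and>
       d = (num_states M1 + q2, ts2))"
  using assms(2)
proof (induction cs arbitrary: c)
  case Nil
  then have "fst c < num_states M1" by (simp add: okc_def)
  then have "moves (seq h M1 M2) c \<noteq> []" by (auto simp: moves_seq_1 halted_def)
  then show ?case by (auto simp: halted_def)
next
  case (Cons i cs)
  then have c: "fst c < num_states M1" by (simp add: okc_def)
  show ?case
  proof (cases "halted M1 c")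
    case True
    have r1: "run M1 c cs1 = Some (q1, ts1) \<longleftrightarrow> cs1 = [] \<and> c = (q1, ts1)" for cs1 q1 ts1
      using True by (cases cs1) (auto simp: halted_def)
    have s: "apply_action (num_states M1, h (fst c) (map scanned (snd c))) c =
      (num_states M1, link h (fst c) (snd c))"
      by (simp add: apply_action_def')
    have e: "run (seq h M1 M2) c (i # cs) = (if i = 0 then
       map_option (\<lambda>(q', ts'). (num_states M1 + q', ts')) (run M2 (0, link h (fst c) (snd c)) cs) else None)"
      using c True by (simp add: moves_seq_1 s run_seq_2_0)
    have "(run (seq h M1 M2) c (i # cs) = Some d \<and> halted (seq h M1 M2) d) =
      (i = 0 \<and> (\<exists>q2 ts2. run M2 (0, link h (fst c) (snd c)) cs = Some (q2, ts2) \<and> halted M2 (q2, ts2) \<and>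
        d = (num_states M1 + q2, ts2)))"
      unfolding e by (auto simp: halted_seq_2)
    also have "\<dots> = (\<exists>cs1 q1 ts1 cs2 q2 ts2. i # cs = cs1 @ 0 # cs2 \<and> run M1 c cs1 = Some (q1, ts1) \<and>
        halted M1 (q1, ts1) \<and> run M2 (0, link h q1 ts1) cs2 = Some (q2, ts2) \<and> halted M2 (q2, ts2) \<and>
       d = (num_states M1 + q2, ts2))"
      unfolding r1 using True by (cases c) auto
    finally show ?thesis .
  next
    case False
    show ?thesis
    proof (cases "i < length (moves M1 c)")
      case True
      have ok: "okc M1 (apply_action (moves M1 c ! i) c)"
        using okc_apply_action[OF assms(1) Cons.prems] True by simp
      \<comment> \<open>As \<open>M1\<close> has not halted in \<open>c\<close>, its part of the
        path is nonempty and begins with \<open>i\<close>; \<open>P\<close> abstracts from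
        everything that follows.\<close>
      have *: "(\<exists>cs1 q1 ts1 cs2 q2 ts2. i # cs = cs1 @ 0 # cs2 \<and> run M1 c cs1 = Some (q1, ts1) \<and> halted M1 (q1, ts1) \<and>
          P cs2 q1 ts1 q2 ts2) \<longleftrightarrow>
        (\<exists>cs1 q1 ts1 cs2 q2 ts2. cs = cs1 @ 0 # cs2 \<and> run M1 (apply_action (moves M1 c ! i) c) cs1 = Some (q1, ts1) \<and>
           halted M1 (q1, ts1) \<and> P cs2 q1 ts1 q2 ts2)" (is "?L \<longleftrightarrow> ?R") for P
      proof
        assume ?L
        then obtain cs1 q1 ts1 cs2 q2 ts2 where
          1: "i # cs = cs1 @ 0 # cs2" "run M1 c cs1 = Some (q1, ts1)" "halted M1 (q1, ts1)" "P cs2 q1 ts1 q2 ts2"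
          by blast
        obtain ds1 where ds1: "cs1 = i # ds1"
        proof (cases cs1)
          case Nil
          then have "halted M1 c" using 1(2,3) by simp
          then show ?thesis using False by simp
        qed (use 1(1) that in auto)
        show ?R
          by (rule exI[of _ ds1], rule exI[of _ q1], rule exI[of _ ts1], rule exI[of _ cs2])
            (use 1 True ds1 in auto)
      next
        assume ?R
        then obtain cs1 q1 ts1 cs2 q2 ts2 where
          1: "cs = cs1 @ 0 # cs2" "run M1 (apply_action (moves M1 c ! i) c) cs1 = Some (q1, ts1)"
            "halted M1 (q1, ts1)" "P cs2 q1 ts1 q2 ts2"
          by blast
        show ?L
          by (rule exI[of _ "i # cs1"], rule exI[of _ q1], rule exI[of _ ts1], rule exI[of _ cs2])
            (use 1 True in auto)
      qed
      have step: "run (seq h M1 M2) c (i # cs) = run (seq h M1 M2) (apply_action (moves M1 c ! i) c) cs"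
        using c False True by (simp add: moves_seq_1)
      show ?thesis
        unfolding step Cons.IH[OF ok]
        by (rule *[symmetric, where P = "\<lambda>cs2 q1 ts1 q2 ts2. run M2 (0, link h q1 ts1) cs2 = Some (q2, ts2) \<and>
            halted M2 (q2, ts2) \<and> d = (num_states M1 + q2, ts2)"])
    next
      case i: False
      have "run (seq h M1 M2) c (i # cs) = None"
        using c False i by (simp add: moves_seq_1)
      moreover have "run M1 c cs1 = Some (q1, ts1) \<Longrightarrow> halted M1 (q1, ts1) \<Longrightarrow> i # cs = cs1 @ 0 # cs2 \<Longrightarrow> False"
        for cs1 q1 ts1 cs2
        using False i by (cases cs1) (auto split: if_splits)
      ultimately show ?thesis by auto
    qed
  qed
qed

text \<open>The induction generalises \<open>t1\<close>, since each step of \<open>M1\<close> uses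
  up one unit of its budget. The \<open>1\<close> in the bound pays for the linking step.\<close>

lemma time_seq:
  assumes "wf_tm M1" "okc M1 c"
    and "\<forall>cs. run M1 c cs \<noteq> None \<longrightarrow> length cs \<le> t1"
    and "\<forall>cs1 q1 ts1. run M1 c cs1 = Some (q1, ts1) \<and> halted M1 (q1, ts1) \<longrightarrow> time_le M2 (link h q1 ts1) t2"
    and "run (seq h M1 M2) c cs \<noteq> None"
  shows "length cs \<le> t1 + t2 + 1"
  using assms(2-)
proof (induction cs arbitrary: c t1)
  case (Cons i cs)
  then have c: "fst c < num_states M1" by (simp add: okc_def)
  show ?case
  proof (cases "halted M1 c")
    case True
    have s: "apply_action (num_states M1, h (fst c) (map scanned (snd c))) c =
      (num_states M1, link h (fst c) (snd c))"
      by (simp add: apply_action_def')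
    have "run M2 (0, link h (fst c) (snd c)) cs \<noteq> None"
      using Cons.prems(4) c True by (auto simp: moves_seq_1 s run_seq_2_0 split: if_splits)
    moreover have "time_le M2 (link h (fst c) (snd c)) t2"
      using Cons.prems(3)[rule_format, of "[]" "fst c" "snd c"] True by simp
    ultimately have "length cs \<le> t2" unfolding time_le_def by blast
    then show ?thesis by simp
  next
    case False
    have i: "i < length (moves M1 c)" and r: "run (seq h M1 M2) (apply_action (moves M1 c ! i) c) cs \<noteq> None"
      using Cons.prems(4) c False by (auto simp: moves_seq_1 split: if_splits)
    have ok: "okc M1 (apply_action (moves M1 c ! i) c)"
      using okc_apply_action[OF assms(1) Cons.prems(1)] i by simp
    have step: "run M1 c (i # ds) = run M1 (apply_action (moves M1 c ! i) c) ds" for ds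
      using i by simp
    have "run M1 c [i] \<noteq> None" by (simp only: step) simp
    then have "length [i] \<le> t1" using Cons.prems(2) by blast
    then have "t1 \<ge> 1" by simp
    moreover have "\<forall>ds. run M1 (apply_action (moves M1 c ! i) c) ds \<noteq> None \<longrightarrow> length ds \<le> t1 - 1"
    proof (intro allI impI)
      fix ds assume "run M1 (apply_action (moves M1 c ! i) c) ds \<noteq> None"
      then have "run M1 c (i # ds) \<noteq> None" by (simp only: step not_False_eq_True)
      then have "length (i # ds) \<le> t1" using Cons.prems(2) by blast
      then show "length ds \<le> t1 - 1" by simp
    qed
    moreover have "\<forall>cs1 q1 ts1. run M1 (apply_action (moves M1 c ! i) c) cs1 = Some (q1, ts1) \<and> halted M1 (q1, ts1) \<longrightarrow>
        time_le M2 (link h q1 ts1) t2"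
      unfolding step[symmetric] using Cons.prems(3) by blast
    ultimately have "length cs \<le> t1 - 1 + t2 + 1" using Cons.IH[OF ok _ _ r] by blast
    then show ?thesis using \<open>t1 \<ge> 1\<close> by simp
  qed
qed simp

text \<open>An equation rather than an inclusion: counting accepting paths of a composite, and
  decoding them, both rest on knowing all of them.\<close>

lemma outcomes_seq:
  assumes "wf_tm M1" "okc M1 (0, ts)"
  shows "outcomes (seq h M1 M2) ts = {(cs1 @ 0 # cs2, num_states M1 + q2, ts2) | cs1 cs2 q1 q2 ts1 ts2.
     (cs1, q1, ts1) \<in> outcomes M1 ts \<and> (cs2, q2, ts2) \<in> outcomes M2 (link h q1 ts1)}"
proof (rule set_eqI)
  fix z :: "nat list \<times> nat \<times> tape list"
  obtain cs q ts' where z: "z = (cs, q, ts')" by (cases z)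
  show "z \<in> outcomes (seq h M1 M2) ts \<longleftrightarrow> z \<in> {(cs1 @ 0 # cs2, num_states M1 + q2, ts2) | cs1 cs2 q1 q2 ts1 ts2.
     (cs1, q1, ts1) \<in> outcomes M1 ts \<and> (cs2, q2, ts2) \<in> outcomes M2 (link h q1 ts1)}"
    unfolding z outcomes_def mem_Collect_eq case_prod_conv run_seq[OF assms] by blast
qed

lemma time_le_seq:
  assumes "wf_tm M1" "okc M1 (0, ts)" "time_le M1 ts t1"
    and "\<And>cs1 q1 ts1. (cs1, q1, ts1) \<in> outcomes M1 ts \<Longrightarrow> time_le M2 (link h q1 ts1) t2"
  shows "time_le (seq h M1 M2) ts (t1 + t2 + 1)"
  using time_seq[OF assms(1,2), of t1 M2 h t2] assms(3,4)
  unfolding time_le_def outcomes_def by blast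

lemma yields_seq:
  assumes "wf_tm M1" "okc M1 (0, ts)" "yields M1 ts t1 q1 ts1" "yields M2 (link h q1 ts1) t2 q2 ts2"
  shows "yields (seq h M1 M2) ts (t1 + t2 + 1) (num_states M1 + q2) ts2"
proof -
  obtain k1 where k1: "outcomes M1 ts = {(replicate k1 0, q1, ts1)}"
    using assms(3) unfolding yields_def by blast
  obtain k2 where k2: "outcomes M2 (link h q1 ts1) = {(replicate k2 0, q2, ts2)}"
    using assms(4) unfolding yields_def by blast
  have "outcomes (seq h M1 M2) ts = {(replicate k1 0 @ 0 # replicate k2 0, num_states M1 + q2, ts2)}"
    unfolding outcomes_seq[OF assms(1,2)] k1 using k2 by auto
  moreover have "replicate k1 0 @ 0 # replicate k2 (0::nat) = replicate (k1 + Suc k2) 0"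
    by (simp add: replicate_add replicate_app_Cons_same)
  moreover have "time_le (seq h M1 M2) ts (t1 + t2 + 1)"
    by (rule time_le_seq[OF assms(1,2)]) (use assms(3,4) k1 in \<open>auto simp: yields_def\<close>)
  ultimately show ?thesis unfolding yields_def by metis
qed

text \<open>A move must say what it writes on every tape, so leaving a tape alone means writing back
  the scanned symbol.\<close>

definition idle :: "nat \<Rightarrow> nat list \<Rightarrow> (nat \<times> dir) list" where
  "idle q rs = map (\<lambda>r. (r, No_Move)) rs"

lemma write_move_idle [simp]: "write_move (scanned t, No_Move) t = t"
  by (cases t) (simp add: scanned_def)

lemma link_idle [simp]: "link idle q ts = ts"
  by (rule nth_equalityI) (auto simp: idle_def)

lemma good_link_idle [simp]: "good_link K S idle"
  by (auto simp: good_link_def idle_def)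

section \<open>Access to selected tapes of a larger machine\<close>

definition sel :: "nat list \<Rightarrow> 'a list \<Rightarrow> 'a list" where
  "sel pos xs = map ((!) xs) pos"

text \<open>With \<open>sel\<close> as the getter this is the setter of a lens:
  \<open>sel_upd\<close>, \<open>upd_sel\<close> and \<open>upd_upd\<close> are its laws, valid for
  a placement \<open>pos\<close>.\<close>

definition upd :: "nat list \<Rightarrow> 'a list \<Rightarrow> 'a list \<Rightarrow> 'a list" where
  "upd pos xs us = map (\<lambda>j. case map_of (zip pos us) j of None \<Rightarrow> xs ! j | Some u \<Rightarrow> u) [0..<length xs]"

lemma length_upd [simp]: "length (upd pos xs us) = length xs"
  by (simp add: upd_def)

lemma length_sel [simp]: "length (sel pos xs) = length pos"
  by (simp add: sel_def)

lemma nth_upd_out: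
  assumes "j < length xs" "j \<notin> set pos"
  shows "upd pos xs us ! j = xs ! j"
proof -
  have "map_of (zip pos us) j = None"
    using assms(2) by (auto simp: map_of_eq_None_iff dest: set_zip_leftD)
  then show ?thesis using assms(1) by (simp add: upd_def)
qed

lemma nth_upd_in:
  assumes "distinct pos" "length us = length pos" "i < length pos" "pos ! i < length xs"
  shows "upd pos xs us ! (pos ! i) = us ! i"
proof -
  have "map_of (zip pos us) (pos ! i) = Some (us ! i)"
    using assms by (intro map_of_is_SomeI) (auto simp: set_zip)
  then show ?thesis using assms(4) by (simp add: upd_def)
qed

definition placement :: "nat list \<Rightarrow> nat \<Rightarrow> nat \<Rightarrow> bool" where
  "placement pos k K \<longleftrightarrow> distinct pos \<and> length pos = k \<and> set pos \<subseteq> {..<K}"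

lemma placement_nth: "placement pos k K \<Longrightarrow> i < k \<Longrightarrow> pos ! i < K"
  unfolding placement_def by (metis lessThan_iff nth_mem subsetD)

lemma sel_upd:
  assumes "placement pos k (length xs)" "length us = k"
  shows "sel pos (upd pos xs us) = us"
  by (rule nth_equalityI)
    (use assms in \<open>auto simp: sel_def placement_def intro!: nth_upd_in intro: placement_nth[OF assms(1)]\<close>)

lemma upd_eqI:
  assumes "placement pos k (length xs)" "length us = k" "length ys = length xs"
    and "\<And>i. i < k \<Longrightarrow> ys ! (pos ! i) = us ! i"
    and "\<And>j. j < length xs \<Longrightarrow> j \<notin> set pos \<Longrightarrow> ys ! j = xs ! j"
  shows "upd pos xs us = ys"
proof (rule nth_equalityI)
  show "length (upd pos xs us) = length ys" using assms by simp
  fix j assume j: "j < length (upd pos xs us)"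
  show "upd pos xs us ! j = ys ! j"
  proof (cases "j \<in> set pos")
    case True
    then obtain i where i: "i < k" "j = pos ! i" using assms(1) by (auto simp: placement_def in_set_conv_nth)
    then show ?thesis using nth_upd_in[of pos us i xs] assms j by (simp add: placement_def)
  next
    case False
    then show ?thesis using j assms(5) nth_upd_out[of j xs pos us] by simp
  qed
qed

lemma upd_sel: "placement pos k (length xs) \<Longrightarrow> upd pos xs (sel pos xs) = xs"
  by (rule upd_eqI) (auto simp: sel_def placement_def)

lemma upd_upd:
  assumes "placement pos k (length xs)" "length us = k" "length vs = k"
  shows "upd pos (upd pos xs us) vs = upd pos xs vs"
proof (rule upd_eqI)
  fix i assume "i < k"
  then show "upd pos xs vs ! (pos ! i) = vs ! i"
    using assms placement_nth[OF assms(1)] by (intro nth_upd_in) (auto simp: placement_def)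
qed (use assms in \<open>auto simp: nth_upd_out\<close>)

lemma set_upd_subset: "set (upd pos xs us) \<subseteq> set xs \<union> set us"
proof
  fix z assume "z \<in> set (upd pos xs us)"
  then obtain j where j: "j < length xs" and z: "z = (case map_of (zip pos us) j of None \<Rightarrow> xs ! j | Some u \<Rightarrow> u)"
    by (auto simp: upd_def)
  show "z \<in> set xs \<union> set us"
  proof (cases "map_of (zip pos us) j")
    case None
    then show ?thesis using z j by simp
  next
    case (Some u)
    then show ?thesis using z by (auto dest!: map_of_SomeD set_zip_rightD)
  qed
qed

text \<open>The guard keeps the machine well-formed over the larger alphabet, about which \<open>M\<close> promises
  nothing.\<close>

definition lift :: "tm \<Rightarrow> nat \<Rightarrow> nat \<Rightarrow> nat list \<Rightarrow> tm" where
  "lift M K S pos = \<lparr>num_tapes = K, num_states = num_states M, num_syms = S,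
     delta = (\<lambda>q rs. if set (sel pos rs) \<subseteq> {..<num_syms M}
        then map (\<lambda>(q', ws). (q', upd pos (idle q rs) ws)) (delta M q (sel pos rs)) else []),
     accepting = accepting M\<rparr>"

lemma lift_simps [simp]:
  "num_tapes (lift M K S pos) = K"
  "num_syms (lift M K S pos) = S"
  "num_states (lift M K S pos) = num_states M"
  "accepting (lift M K S pos) = accepting M"
  by (simp_all add: lift_def)

lemma wf_tm_lift:
  assumes M: "wf_tm M" and pos: "placement pos (num_tapes M) K" and S: "num_syms M \<le> S"
  shows "wf_tm (lift M K S pos)"
proof -
  have "distinct (delta (lift M K S pos) q rs) \<and> (\<forall>(q', ws) \<in> set (delta (lift M K S pos) q rs).
          q' < num_states M \<and> length ws = K \<and> fst ` set ws \<subseteq> {..<S})"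
    if q: "q < num_states M" and rs: "length rs = K" "set rs \<subseteq> {..<S}" for q rs
  proof (cases "set (sel pos rs) \<subseteq> {..<num_syms M}")
    case True
    have len: "length (sel pos rs) = num_tapes M" using pos by (simp add: placement_def)
    have d: "distinct (delta M q (sel pos rs))"
      and a: "\<And>q' ws. (q', ws) \<in> set (delta M q (sel pos rs)) \<Longrightarrow>
           q' < num_states M \<and> length ws = num_tapes M \<and> fst ` set ws \<subseteq> {..<num_syms M}"
      using M q True len unfolding wf_tm_def by blast+
    have li: "length (idle q rs) = K" using rs by (simp add: idle_def)
    \<comment> \<open>Distinct moves must stay distinct after lifting; they do, because
      \<open>sel pos\<close> recovers \<open>ws\<close> from the updated list.\<close>
    have "inj_on (\<lambda>(q', ws). (q', upd pos (idle q rs) ws)) (set (delta M q (sel pos rs)))"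
    proof (rule inj_onI, clarsimp)
      fix q1 ws1 ws2
      assume "(q1, ws1) \<in> set (delta M q (sel pos rs))" "(q1, ws2) \<in> set (delta M q (sel pos rs))"
        and e: "upd pos (idle q rs) ws1 = upd pos (idle q rs) ws2"
      then have "length ws1 = num_tapes M" "length ws2 = num_tapes M" using a by auto
      then show "ws1 = ws2" using e sel_upd[of pos "num_tapes M" "idle q rs"] pos li by metis
    qed
    then have "distinct (delta (lift M K S pos) q rs)"
      using d True by (simp add: lift_def distinct_map)
    moreover have "q' < num_states M \<and> length (upd pos (idle q rs) ws) = K \<and> fst ` set (upd pos (idle q rs) ws) \<subseteq> {..<S}"
      if "(q', ws) \<in> set (delta M q (sel pos rs))" for q' ws
    proof -
      have "fst ` set (upd pos (idle q rs) ws) \<subseteq> fst ` set (idle q rs) \<union> fst ` set ws"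
        using set_upd_subset by (metis image_Un image_mono)
      also have "\<dots> \<subseteq> {..<S}"
      proof -
        have "fst ` set ws \<subseteq> {..<S}" using a[OF that] S by auto
        then show ?thesis using rs(2) by (auto simp: idle_def)
      qed
      finally show ?thesis using a[OF that] li by simp
    qed
    ultimately show ?thesis using True by (simp add: lift_def case_prod_beta) (metis prod.collapse)
  next
    case False
    then show ?thesis by (simp add: lift_def)
  qed
  moreover have "K \<ge> 1"
  proof -
    have "length pos \<ge> 1" "set pos \<subseteq> {..<K}" using M pos by (auto simp: wf_tm_def placement_def)
    then show ?thesis by (cases pos) auto
  qed
  moreover have "num_states M \<ge> 1" "S \<ge> 3" using M S unfolding wf_tm_def by auto
  ultimately show ?thesis
    unfolding wf_tm_def lift_simps by blast
qed

lemma deterministic_lift: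
  assumes "deterministic M" "placement pos (num_tapes M) K"
  shows "deterministic (lift M K S pos)"
proof -
  have "length (delta M q (sel pos rs)) \<le> 1" if "q < num_states M" "set (sel pos rs) \<subseteq> {..<num_syms M}" for q rs
    using that assms unfolding deterministic_def placement_def by auto
  then show ?thesis
    unfolding deterministic_def by (simp add: lift_def)
qed

lemma map_scanned_sel:
  "placement pos k (length ts) \<Longrightarrow> sel pos (map scanned ts) = map scanned (sel pos ts)"
  by (auto simp: sel_def placement_def)

lemma moves_lift:
  assumes "okc M (q, sel pos ts)" "placement pos (num_tapes M) (length ts)"
  shows "moves (lift M K S pos) (q, ts) =
    map (\<lambda>(q', ws). (q', upd pos (idle q (map scanned ts)) ws)) (moves M (q, sel pos ts))"
proof -
  have "set (map scanned (sel pos ts)) \<subseteq> {..<num_syms M}"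
    using scanned_less[OF assms(1)] by simp
  then show ?thesis
    using map_scanned_sel[OF assms(2)] by (simp add: moves_def lift_def)
qed

lemma apply_action_lift:
  assumes "placement pos k (length ts)" "length ws = k"
  shows "map2 write_move (upd pos (idle q (map scanned ts)) ws) ts = upd pos ts (map2 write_move ws (sel pos ts))"
proof (rule sym, rule upd_eqI[OF assms(1)])
  have l: "length (idle q (map scanned ts)) = length ts" by (simp add: idle_def)
  show "length (map2 write_move ws (sel pos ts)) = k" using assms by (simp add: placement_def)
  show "length (map2 write_move (upd pos (idle q (map scanned ts)) ws) ts) = length ts"
    using l by simp
  fix i assume i: "i < k"
  then have p: "pos ! i < length ts" using assms(1) by (rule placement_nth[rotated])
  have "upd pos (idle q (map scanned ts)) ws ! (pos ! i) = ws ! i"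
    using nth_upd_in[of pos ws i] assms i p l by (simp add: placement_def)
  then show "map2 write_move (upd pos (idle q (map scanned ts)) ws) ts ! (pos ! i) =
      map2 write_move ws (sel pos ts) ! i"
    using i p assms l by (simp add: placement_def sel_def)
next
  have l: "length (idle q (map scanned ts)) = length ts" by (simp add: idle_def)
  fix j assume j: "j < length ts" "j \<notin> set pos"
  then have "upd pos (idle q (map scanned ts)) ws ! j = (scanned (ts ! j), No_Move)"
    by (simp add: nth_upd_out l) (simp add: idle_def)
  then show "map2 write_move (upd pos (idle q (map scanned ts)) ws) ts ! j = ts ! j"
    using j l by simp
qed

text \<open>Lifting keeps the number and the order of the moves, so the same choice sequence drives
  both machines and sets of paths carry over unchanged. \<open>upd_upd\<close> collapses the updates
  of successive steps into one update of the original tapes.\<close>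

lemma run_lift:
  assumes M: "wf_tm M" and "okc M (q, sel pos ts)" "placement pos (num_tapes M) (length ts)"
  shows "run (lift M K S pos) (q, ts) cs = map_option (\<lambda>(q', us). (q', upd pos ts us)) (run M (q, sel pos ts) cs)"
  using assms(2,3)
proof (induction cs arbitrary: q ts)
  case Nil
  then show ?case using upd_sel[of pos "num_tapes M" ts] by simp
next
  case (Cons i cs)
  let ?c = "(q, sel pos ts)"
  show ?case
  proof (cases "i < length (moves M ?c)")
    case True
    obtain q' ws where a: "moves M ?c ! i = (q', ws)" by fastforce
    have mem: "(q', ws) \<in> set (moves M ?c)" using True a by (metis nth_mem)
    have ws: "length ws = num_tapes M" using wf_tm_moves(2)[OF M Cons.prems(1) mem] by simp
    let ?us = "map2 write_move ws (sel pos ts)"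
    have lus: "length ?us = num_tapes M" using ws Cons.prems(2) by (simp add: placement_def)
    have su: "sel pos (upd pos ts ?us) = ?us"
      using Cons.prems(2) lus by (rule sel_upd)
    have ok: "okc M (q', sel pos (upd pos ts ?us))"
      using okc_apply_action[OF M Cons.prems(1) mem] su by simp
    have u: "upd pos (upd pos ts ?us) (snd d) = upd pos ts (snd d)"
      if "run M (q', ?us) cs = Some d" for d
    proof (rule upd_upd[OF Cons.prems(2) lus])
      have "okc M d" using okc_run[OF M _ that] ok su by simp
      then show "length (snd d) = num_tapes M" by (simp add: okc_def)
    qed
    have "run (lift M K S pos) (q, ts) (i # cs) = run (lift M K S pos) (q', upd pos ts ?us) cs"
      using True a moves_lift[OF Cons.prems, of K S] apply_action_lift[OF Cons.prems(2) ws] by simp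
    also have "\<dots> = map_option (\<lambda>(q'', us). (q'', upd pos (upd pos ts ?us) us)) (run M (q', ?us) cs)"
      using Cons.IH[OF ok] Cons.prems(2) su by simp
    also have "\<dots> = map_option (\<lambda>(q'', us). (q'', upd pos ts us)) (run M (q', ?us) cs)"
      using u by (cases "run M (q', ?us) cs") auto
    also have "\<dots> = map_option (\<lambda>(q'', us). (q'', upd pos ts us)) (run M ?c (i # cs))"
      using True a by simp
    finally show ?thesis .
  next
    case False
    then show ?thesis using moves_lift[OF Cons.prems, of K S] by simp
  qed
qed

lemma halted_lift:
  assumes "okc M (q, us)" "placement pos (num_tapes M) (length ts)"
  shows "halted (lift M K S pos) (q, upd pos ts us) \<longleftrightarrow> halted M (q, us)"
proof -
  have "length us = num_tapes M" using assms(1) by (simp add: okc_def)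
  then have "sel pos (upd pos ts us) = us" using assms(2) by (intro sel_upd)
  then show ?thesis using moves_lift[of M q pos "upd pos ts us" K S] assms by (simp add: halted_def)
qed

lemma outcomes_lift:
  assumes "wf_tm M" "okc M (0, sel pos ts)" "placement pos (num_tapes M) (length ts)"
  shows "outcomes (lift M K S pos) ts = (\<lambda>(cs, q, us). (cs, q, upd pos ts us)) ` outcomes M (sel pos ts)"
proof -
  have "run (lift M K S pos) (0, ts) cs = Some (q, ts') \<and> halted (lift M K S pos) (q, ts') \<longleftrightarrow>
     (\<exists>us. run M (0, sel pos ts) cs = Some (q, us) \<and> halted M (q, us) \<and> ts' = upd pos ts us)" for cs q ts'
    unfolding run_lift[OF assms]
    using halted_lift[OF _ assms(3)] okc_run[OF assms(1,2)] by auto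
  then show ?thesis unfolding outcomes_def by (auto simp: image_iff)
qed

lemma time_le_lift:
  assumes "wf_tm M" "okc M (0, sel pos ts)" "placement pos (num_tapes M) (length ts)" "time_le M (sel pos ts) t"
  shows "time_le (lift M K S pos) ts t"
  using assms(4) unfolding time_le_def run_lift[OF assms(1-3)] by simp

lemma yields_lift:
  assumes "wf_tm M" "okc M (0, sel pos ts)" "placement pos (num_tapes M) (length ts)" "yields M (sel pos ts) t q us"
  shows "yields (lift M K S pos) ts t q (upd pos ts us)"
  using assms(4) time_le_lift[OF assms(1-3)] outcomes_lift[OF assms(1-3)] unfolding yields_def by auto

text \<open>The word \<open>u @ v\<close> as a zipper: the head stands on the first letter of
  \<open>v\<close>, or on the blank behind the word if \<open>v\<close> is empty.\<close>

definition tape_of :: "bstring \<Rightarrow> bstring \<Rightarrow> tape" where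
  "tape_of u v = (fst (string_tape (u @ v)), int (length u))"

lemma string_tape_tape_of: "string_tape w = tape_of [] w"
  by (simp add: tape_of_def string_tape_def)

lemma bit_sym_bounds [simp]: "bit_sym b \<noteq> 0" "bit_sym b < 3" "0 < bit_sym b" "bit_sym b = 2 \<longleftrightarrow> b" "bit_sym b = Suc 0 \<longleftrightarrow> \<not> b"
  by (auto simp: bit_sym_def)

lemma tape_of_less [simp]: "fst (tape_of u v) i < 3"
  by (simp add: tape_of_def string_tape_def)

lemma string_tape_less [simp]: "fst (string_tape w) i < 3"
  by (simp add: string_tape_tape_of)

lemma scanned_tape_of [simp]:
  "scanned (tape_of u []) = 0"
  "scanned (tape_of u (a # v)) = bit_sym a"
  by (auto simp: tape_of_def string_tape_def scanned_def nth_append)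

lemma write_same: "fst t (snd t) = s \<Longrightarrow> write_move (s, d) t = (fst t, move d (snd t))"
  by (cases t) auto

lemma write_move_tape_of [simp]:
  "write_move (0, No_Move) (tape_of u []) = tape_of u []"
  "write_move (bit_sym a, No_Move) (tape_of u (a # v)) = tape_of u (a # v)"
  "write_move (bit_sym a, Right_Move) (tape_of u (a # v)) = tape_of (u @ [a]) v"
  by (subst write_same; auto simp: tape_of_def string_tape_def nth_append)+

lemma write_move_append [simp]:
  "write_move (bit_sym a, Right_Move) (tape_of u []) = tape_of (u @ [a]) []"
  by (auto simp: tape_of_def string_tape_def nth_append fun_eq_iff)

definition tapes_of :: "nat \<Rightarrow> bstring list \<Rightarrow> tape list" where
  "tapes_of K xs = map string_tape xs @ replicate (K - length xs) (string_tape [])"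

lemma length_tapes_of [simp]: "length xs \<le> K \<Longrightarrow> length (tapes_of K xs) = K"
  by (simp add: tapes_of_def)

lemma nth_tapes_of: "i < K \<Longrightarrow> tapes_of K xs ! i = string_tape (if i < length xs then xs ! i else [])"
  by (auto simp: tapes_of_def nth_append)

lemma tapes_of_less [simp]: "t \<in> set (tapes_of K xs) \<Longrightarrow> fst t i < 3"
  by (auto simp: tapes_of_def)

lemma okc_tapes_of:
  "wf_tm M \<Longrightarrow> length xs \<le> num_tapes M \<Longrightarrow> okc M (0, tapes_of (num_tapes M) xs)"
  unfolding okc_def wf_tm_def by (auto intro: less_le_trans[OF tapes_of_less])

lemma init_config_tapes_of: "init_config M x = (0, tapes_of (num_tapes M) [x])"
  by (simp add: init_config_def tapes_of_def)

definition prog :: "nat \<Rightarrow> nat \<Rightarrow> tm \<Rightarrow> bool" where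
  "prog K S M \<longleftrightarrow> wf_tm M \<and> deterministic M \<and> num_tapes M = K \<and> num_syms M = S"

lemma prog_seq: "prog K S M1 \<Longrightarrow> prog K S M2 \<Longrightarrow> good_link K S h \<Longrightarrow> prog K S (seq h M1 M2)"
  unfolding prog_def using wf_tm_seq[of M1 M2 h] deterministic_seq[of M1 M2 h] by (auto simp: seq_ok_def)

lemma prog_lift: "prog k S' M \<Longrightarrow> placement pos k K \<Longrightarrow> S' \<le> S \<Longrightarrow> prog K S (lift M K S pos)"
  unfolding prog_def using wf_tm_lift[of M pos K S] deterministic_lift[of M pos K S] by auto

lemma prog_yields_seq:
  assumes "prog K S M1" "length ts = K" "\<And>t i. t \<in> set ts \<Longrightarrow> fst t i < S"
    "yields M1 ts t1 q1 ts1" "yields M2 (link h q1 ts1) t2 q2 ts2"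
  shows "yields (seq h M1 M2) ts (t1 + t2 + 1) (num_states M1 + q2) ts2"
proof -
  have wf: "wf_tm M1" using assms(1) by (simp add: prog_def)
  then have "okc M1 (0, ts)"
    using assms(1-3) by (auto simp: prog_def okc_def wf_tm_def)
  with wf show ?thesis using assms(4,5) by (rule yields_seq)
qed

lemmas prog_yields_seq_idle = prog_yields_seq[where h = idle, unfolded link_idle]

lemma prog_yields_lift:
  assumes "prog k S' M" "placement pos k K" "length ts = K" "\<And>t i. t \<in> set (sel pos ts) \<Longrightarrow> fst t i < S'"
    "yields M (sel pos ts) t q us"
  shows "yields (lift M K S pos) ts t q (upd pos ts us)"
proof -
  have "okc M (0, sel pos ts)" using assms by (auto simp: prog_def okc_def wf_tm_def placement_def)
  then show ?thesis using assms yields_lift[of M pos ts t q us K S] by (auto simp: prog_def)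
qed

subsection \<open>Rewinding\<close>

text \<open>Meant for a head on the blank behind the word. State \<open>0\<close> steps left once;
  state \<open>1\<close> walks left to the blank in front of the word and steps back onto its first
  cell.\<close>

fun rewind_delta :: "bool \<Rightarrow> nat \<Rightarrow> nat list \<Rightarrow> action list" where
  "rewind_delta wipe q [r] =
     (if q = 0 then [(1, [(r, Left_Move)])]
      else if q = 1 then
        if r = 0 then [(2, [(0, Right_Move)])] else [(1, [(if wipe then 0 else r, Left_Move)])]
      else [])"
| "rewind_delta wipe q _ = []"

definition rewind :: "bool \<Rightarrow> tm" where
  "rewind wipe = \<lparr>num_tapes = 1, num_states = 3, num_syms = 3, delta = rewind_delta wipe, accepting = {}\<rparr>"

lemma prog_rewind: "prog 1 3 (rewind wipe)"
proof -
  have "length rs = 1 \<Longrightarrow> \<exists>r. rs = [r]" for rs :: "nat list" by (cases rs) auto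
  then show ?thesis
    unfolding prog_def wf_tm_def deterministic_def rewind_def by (fastforce split: if_splits)
qed

text \<open>The cells to the right of the head are final already: unchanged when rewinding, erased
  when wiping. The latter is why the invariant has \<open>v = []\<close> in that case.\<close>

lemma rewind_loop:
  assumes "wipe \<longrightarrow> v = []"
  shows "dsteps (rewind wipe) (1, [(fst (string_tape (u @ v)), int (length u) - 1)]) (Suc (length u))
    (2, [string_tape (if wipe then [] else u @ v)])"
  using assms
proof (induction u arbitrary: v rule: rev_induct)
  case Nil
  show ?case
  proof (rule dsteps_first)
    show "moves (rewind wipe) (1, [(fst (string_tape ([] @ v)), int (length []) - 1)]) = [(2, [(0, Right_Move)])]"
      by (simp add: moves_def rewind_def scanned_def string_tape_def)
    show "dsteps (rewind wipe) (apply_action (2, [(0, Right_Move)]) (1, [(fst (string_tape ([] @ v)), int (length []) - 1)]))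
       (length []) (2, [string_tape (if wipe then [] else [] @ v)])"
      using Nil by (auto simp: string_tape_def fun_eq_iff)
  qed simp
next
  case (snoc a u)
  let ?c = "(1, [(fst (string_tape ((u @ [a]) @ v)), int (length (u @ [a])) - 1)])"
  let ?a = "(1, [(if wipe then 0 else bit_sym a, Left_Move)])"
  show ?case
  proof (rule dsteps_first)
    show "moves (rewind wipe) ?c = [?a]"
      by (simp add: moves_def rewind_def scanned_def string_tape_def nth_append)
    show "apply_action ?a ?c = (1, [(fst (string_tape (u @ (if wipe then [] else a # v))), int (length u) - 1)])"
      using snoc.prems by (auto simp: string_tape_def fun_eq_iff nth_append)
    show "dsteps (rewind wipe) (1, [(fst (string_tape (u @ (if wipe then [] else a # v))), int (length u) - 1)]) (length (u @ [a]))
      (2, [string_tape (if wipe then [] else (u @ [a]) @ v)])"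
      using snoc.IH[of "if wipe then [] else a # v"] by (auto split: if_splits)
  qed
qed

lemma yields_rewind:
  "yields (rewind wipe) [tape_of w []] (length w + 2) 2 [string_tape (if wipe then [] else w)]"
proof (rule yields_dsteps)
  have "dsteps (rewind wipe) (0, [tape_of w []]) (Suc (Suc (length w))) (2, [string_tape (if wipe then [] else w)])"
  proof (rule dsteps_first)
    show "moves (rewind wipe) (0, [tape_of w []]) = [(1, [(0, Left_Move)])]"
      by (simp add: moves_def rewind_def)
    show "apply_action (1, [(0, Left_Move)]) (0, [tape_of w []]) = (1, [(fst (string_tape (w @ [])), int (length w) - 1)])"
      by (auto simp: tape_of_def string_tape_def fun_eq_iff)
    show "dsteps (rewind wipe) (1, [(fst (string_tape (w @ [])), int (length w) - 1)]) (Suc (length w))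
      (2, [string_tape (if wipe then [] else w)])"
      using rewind_loop[of wipe "[]" w] by (cases wipe) (simp_all del: dsteps.simps)
  qed
  then show "dsteps (rewind wipe) (0, [tape_of w []]) (length w + 2) (2, [string_tape (if wipe then [] else w)])"
    by simp
  show "halted (rewind wipe) (2, [string_tape (if wipe then [] else w)])"
    by (simp add: halted_def moves_def rewind_def)
qed

subsection \<open>Transducers\<close>

text \<open>The arguments are the state and the letters read on both inputs. \<open>None\<close> as
  a letter means that this input has ended, \<open>None\<close> as an output that nothing is
  written.\<close>

type_synonym transitions = "nat \<Rightarrow> bool option \<Rightarrow> bool option \<Rightarrow> nat \<times> bool option"

abbreviation opt_list :: "'a option \<Rightarrow> 'a list" where
  "opt_list z \<equiv> (case z of None \<Rightarrow> [] | Some b \<Rightarrow> [b])"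

fun transduce :: "transitions \<Rightarrow> (nat \<Rightarrow> bool option) \<Rightarrow> nat \<Rightarrow> bstring \<Rightarrow> bstring \<Rightarrow> bstring" where
  "transduce st fin s [] [] = opt_list (fin s)"
| "transduce st fin s (a # x) [] =
     opt_list (snd (st s (Some a) None)) @ transduce st fin (fst (st s (Some a) None)) x []"
| "transduce st fin s [] (b # y) =
     opt_list (snd (st s None (Some b))) @ transduce st fin (fst (st s None (Some b))) [] y"
| "transduce st fin s (a # x) (b # y) =
     opt_list (snd (st s (Some a) (Some b))) @ transduce st fin (fst (st s (Some a) (Some b))) x y"

lemma length_transduce: "length (transduce st fin s x y) \<le> length x + length y + 1"
  by (induction st fin s x y rule: transduce.induct) (auto split: option.split)

definition head :: "bstring \<Rightarrow> bool option" where
  "head x = (if x = [] then None else Some (hd x))"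

definition unsym :: "nat \<Rightarrow> bool option" where
  "unsym r = (if r = 0 then None else Some (r = 2))"

definition emit :: "bool option \<Rightarrow> nat \<Rightarrow> nat \<times> dir" where
  "emit z r = (case z of None \<Rightarrow> (r, No_Move) | Some b \<Rightarrow> (bit_sym b, Right_Move))"

definition advance :: "nat \<Rightarrow> nat \<times> dir" where
  "advance r = (r, if r = 0 then No_Move else Right_Move)"

text \<open>State \<open>n\<close> is a halting state added behind the \<open>n\<close> states of
  \<open>st\<close>; the step into it emits the letter chosen by \<open>fin\<close>.\<close>

fun lockstep_delta :: "nat \<Rightarrow> transitions \<Rightarrow> (nat \<Rightarrow> bool option) \<Rightarrow> nat \<Rightarrow> nat list \<Rightarrow> action list" where
  "lockstep_delta n st fin s [a, b, c] =
     (if s \<ge> n then []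
      else if a = 0 \<and> b = 0 then [(n, [advance a, advance b, emit (fin s) c])]
      else [(fst (st s (unsym a) (unsym b)), [advance a, advance b, emit (snd (st s (unsym a) (unsym b))) c])])"
| "lockstep_delta n st fin s _ = []"

definition lockstep :: "nat \<Rightarrow> transitions \<Rightarrow> (nat \<Rightarrow> bool option) \<Rightarrow> tm" where
  "lockstep n st fin = \<lparr>num_tapes = 3, num_states = n + 1, num_syms = 3, delta = lockstep_delta n st fin, accepting = {}\<rparr>"

lemma length_3: "length rs = 3 \<longleftrightarrow> (\<exists>a b c. rs = [a, b, c])"
  by (auto simp: numeral_3_eq_3 length_Suc_conv)

lemma unsym_simps [simp]: "unsym 0 = None" "unsym (bit_sym b) = Some b"
  by (simp_all add: unsym_def)

lemma emit_less: "r < 3 \<Longrightarrow> fst (emit z r) < 3"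
  by (auto simp: emit_def split: option.split)

lemma fst_advance [simp]: "fst (advance r) = r"
  by (simp add: advance_def)

lemma prog_lockstep:
  assumes "\<And>s a b. s < n \<Longrightarrow> fst (st s a b) < n"
  shows "prog 3 3 (lockstep n st fin)"
  unfolding prog_def wf_tm_def deterministic_def
proof (intro conjI allI impI, goal_cases)
  case (4 q rs)
  then obtain a b c where rs: "rs = [a, b, c]" by (auto simp: lockstep_def length_3)
  then show ?case using 4 assms[of q "unsym a" "unsym b"] by (auto simp: lockstep_def)
next
  case (5 q rs)
  then obtain a b c where rs: "rs = [a, b, c]" by (auto simp: lockstep_def length_3)
  then show ?case using 5 assms[of q "unsym a" "unsym b"] by (auto simp: lockstep_def emit_less)
next
  case (6 q rs)
  then obtain a b c where rs: "rs = [a, b, c]" by (auto simp: lockstep_def length_3)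
  then show ?case by (auto simp: lockstep_def)
qed (auto simp: lockstep_def)

lemma write_move_emit [simp]: "write_move (emit z 0) (tape_of u []) = tape_of (u @ opt_list z) []"
  by (simp add: emit_def split: option.split)

lemma moves_lockstep:
  "moves (lockstep n st fin) (s, [ta, tb, tc]) = lockstep_delta n st fin s [scanned ta, scanned tb, scanned tc]"
  by (simp add: moves_def lockstep_def)

text \<open>Presenting an exhausted input as \<open>None\<close> merges the three nonempty cases
  into one, which matches a single step of \<open>lockstep\<close>.\<close>

lemma transduce_step:
  "x \<noteq> [] \<or> y \<noteq> [] \<Longrightarrow> transduce st fin s x y =
     opt_list (snd (st s (head x) (head y))) @ transduce st fin (fst (st s (head x) (head y))) (tl x) (tl y)"
  by (cases x; cases y) (auto simp: head_def)

lemma scanned_tape_of_head: "unsym (scanned (tape_of u x)) = head x" "scanned (tape_of u x) = 0 \<longleftrightarrow> x = []"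
  by (cases x; simp add: head_def)+

lemma write_move_advance_head:
  "write_move (advance (scanned (tape_of u x))) (tape_of u x) = tape_of (u @ take 1 x) (tl x)"
  by (cases x) (auto simp: advance_def)

lemma dsteps_lockstep:
  assumes "\<forall>s a b. s < n \<longrightarrow> fst (st s a b) < n"
  shows "s < n \<Longrightarrow>
   dsteps (lockstep n st fin) (s, [tape_of u x, tape_of v y, tape_of w []]) (Suc (max (length x) (length y)))
    (n, [tape_of (u @ x) [], tape_of (v @ y) [], tape_of (w @ transduce st fin s x y) []])"
proof (induction "max (length x) (length y)" arbitrary: s u x v y w)
  case 0
  then show ?case by (simp add: moves_lockstep advance_def)
next
  case (Suc k)
  let ?z = "st s (head x) (head y)"
  have xy: "x \<noteq> [] \<or> y \<noteq> []" using Suc.hyps(2) by auto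
  have k: "k = max (length (tl x)) (length (tl y))" and "fst ?z < n" using Suc.hyps(2) assms Suc.prems by auto
  note IH = Suc.hyps(1)[OF this, of "u @ take 1 x" "v @ take 1 y" "w @ opt_list (snd ?z)"]
  have x: "take 1 x @ tl x = x" for x :: bstring by (cases x) auto
  have "dsteps (lockstep n st fin) (s, [tape_of u x, tape_of v y, tape_of w []]) (Suc (Suc k))
    (n, [tape_of (u @ x) [], tape_of (v @ y) [], tape_of (w @ transduce st fin s x y) []])"
  proof (rule dsteps_first)
    show "moves (lockstep n st fin) (s, [tape_of u x, tape_of v y, tape_of w []]) =
        [(fst ?z, [advance (scanned (tape_of u x)), advance (scanned (tape_of v y)), emit (snd ?z) 0])]"
      using xy Suc.prems by (auto simp: moves_lockstep scanned_tape_of_head)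
    show "dsteps (lockstep n st fin) (fst ?z, [tape_of (u @ take 1 x) (tl x), tape_of (v @ take 1 y) (tl y),
        tape_of (w @ opt_list (snd ?z)) []]) (Suc k)
      (n, [tape_of (u @ x) [], tape_of (v @ y) [], tape_of (w @ transduce st fin s x y) []])"
      using IH unfolding x transduce_step[OF xy] append_assoc k[symmetric] .
  qed (simp add: write_move_advance_head)
  then show ?case using Suc.hyps(2) by simp
qed

lemma yields_lockstep:
  assumes "\<forall>s a b. s < n \<longrightarrow> fst (st s a b) < n" "0 < n"
  shows "yields (lockstep n st fin) [tape_of [] x, tape_of [] y, tape_of [] []] (Suc (max (length x) (length y))) n
    [tape_of x [], tape_of y [], tape_of (transduce st fin 0 x y) []]"
  using dsteps_lockstep[OF assms, of fin "[]" x "[]" y "[]"]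
  by (intro yields_dsteps) (auto simp: halted_def moves_lockstep simp del: dsteps.simps)

lemma placement_single: "i < K \<Longrightarrow> placement [i] 1 K"
  by (simp add: placement_def)

lemma yields_rewind_at:
  assumes "i < length ts" "ts ! i = tape_of w []" "length ts = K"
  shows "yields (lift (rewind wipe) K S [i]) ts (length w + 2) 2
    (ts[i := string_tape (if wipe then [] else w)])"
proof -
  have s: "sel [i] ts = [tape_of w []]" using assms by (simp add: sel_def)
  have u: "upd [i] ts [t] = ts[i := t]" for t
    by (rule upd_eqI) (use assms in \<open>auto simp: placement_def\<close>)
  have "yields (lift (rewind wipe) K S [i]) ts (length w + 2) 2
    (upd [i] ts [string_tape (if wipe then [] else w)])"
    by (rule prog_yields_lift[OF prog_rewind])
      (use s assms placement_single[of i] yields_rewind[of wipe w] in auto)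
  then show ?thesis unfolding u .
qed

text \<open>Rewinding leaves tapes that can serve as arguments of a further machine. Wiping the
  first tape is for functions in \<open>FP\<close>, whose value must finally stand there, so that
  the input has to be moved away.\<close>

definition transducer :: "bool \<Rightarrow> nat \<Rightarrow> transitions \<Rightarrow> (nat \<Rightarrow> bool option) \<Rightarrow> tm" where
  "transducer wipe n st fin = seq idle (lockstep n st fin) (seq idle (lift (rewind wipe) 3 3 [0])
     (seq idle (lift (rewind False) 3 3 [1]) (lift (rewind False) 3 3 [2])))"

lemma prog_transducer:
  assumes "\<forall>s a b. s < n \<longrightarrow> fst (st s a b) < n"
  shows "prog 3 3 (transducer wipe n st fin)"
  unfolding transducer_def
  by (intro prog_seq prog_lockstep prog_lift[OF prog_rewind] placement_single good_link_idle) (use assms in auto)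

lemma yields_transducer:
  assumes "\<forall>s a b. s < n \<longrightarrow> fst (st s a b) < n" "0 < n"
  shows "\<exists>q. yields (transducer wipe n st fin) [string_tape x, string_tape y, string_tape []]
    (4 * (length x + length y) + 12) q
    [string_tape (if wipe then [] else x), string_tape y, string_tape (transduce st fin 0 x y)]"
proof -
  let ?o = "transduce st fin 0 x y" and ?x = "if wipe then [] else x"
  let ?R0 = "lift (rewind wipe) 3 3 [0]" and ?R1 = "lift (rewind False) 3 3 [1]" and ?R2 = "lift (rewind False) 3 3 [2]"
  have 4: "yields ?R2 [string_tape ?x, string_tape y, tape_of ?o []] (length ?o + 2) 2 [string_tape ?x, string_tape y, string_tape ?o]"
    using yields_rewind_at[of 2 "[string_tape ?x, string_tape y, tape_of ?o []]" ?o 3 False] by simp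
  have 3: "yields ?R1 [string_tape ?x, tape_of y [], tape_of ?o []] (length y + 2) 2 [string_tape ?x, string_tape y, tape_of ?o []]"
    using yields_rewind_at[of 1 "[string_tape ?x, tape_of y [], tape_of ?o []]" y 3 False] by simp
  have 2: "yields ?R0 [tape_of x [], tape_of y [], tape_of ?o []] (length x + 2) 2 [string_tape ?x, tape_of y [], tape_of ?o []]"
    using yields_rewind_at[of 0 "[tape_of x [], tape_of y [], tape_of ?o []]" x 3 wipe] by simp
  note 1 = yields_lockstep[OF assms, of fin x y]
  have p: "prog 3 3 (lockstep n st fin)" using assms by (intro prog_lockstep) auto
  have p1: "prog 3 3 (lift (rewind b) 3 3 [i])" if "i < 3" for i b
    using that by (intro prog_lift[OF prog_rewind] placement_single) auto
  have 34: "yields (seq idle ?R1 ?R2) [string_tape ?x, tape_of y [], tape_of ?o []]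
      (length y + 2 + (length ?o + 2) + 1) (num_states ?R1 + 2) [string_tape ?x, string_tape y, string_tape ?o]"
    by (rule prog_yields_seq_idle[OF p1[of 1] _ _ 3 4]) auto
  have 234: "yields (seq idle ?R0 (seq idle ?R1 ?R2)) [tape_of x [], tape_of y [], tape_of ?o []]
      (length x + 2 + (length y + 2 + (length ?o + 2) + 1) + 1) (num_states ?R0 + (num_states ?R1 + 2))
      [string_tape ?x, string_tape y, string_tape ?o]"
    by (rule prog_yields_seq_idle[OF p1[of 0] _ _ 2 34]) auto
  have "yields (transducer wipe n st fin) [tape_of [] x, tape_of [] y, tape_of [] []]
      (Suc (max (length x) (length y)) + (length x + 2 + (length y + 2 + (length ?o + 2) + 1) + 1) + 1)
      (num_states (lockstep n st fin) + (num_states ?R0 + (num_states ?R1 + 2)))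
      [string_tape ?x, string_tape y, string_tape ?o]"
    unfolding transducer_def by (rule prog_yields_seq_idle[OF p _ _ 1 234]) auto
  \<comment> \<open>The output is at most one letter longer than both inputs together, so rewinding
    it is linear as well.\<close>
  then show ?thesis
    unfolding string_tape_tape_of[symmetric]
    using length_transduce[of st fin 0 x y] by (intro exI) (erule yields_mono, simp)
qed

subsection \<open>Unary multiplication\<close>

text \<open>For every cell of the first tape the second one is traversed forth and back, with one
  letter appended to the third per cell. Unary products are the means of building clocks of
  polynomial length.\<close>

fun mult_delta :: "nat \<Rightarrow> nat list \<Rightarrow> action list" where
  "mult_delta q [a, b, c] =
     (if q = 0 then
        if a = 0 then [(3, [(a, No_Move), (b, No_Move), (c, No_Move)])]
        else [(1, [(a, Right_Move), (b, No_Move), (c, No_Move)])]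
      else if q = 1 then
        if b = 0 then [(2, [(a, No_Move), (b, Left_Move), (c, No_Move)])]
        else [(1, [(a, No_Move), (b, Right_Move), (2, Right_Move)])]
      else if q = 2 then
        if b = 0 then [(0, [(a, No_Move), (b, Right_Move), (c, No_Move)])]
        else [(2, [(a, No_Move), (b, Left_Move), (c, No_Move)])]
      else [])"
| "mult_delta q _ = []"

definition mult_core :: tm where
  "mult_core = \<lparr>num_tapes = 3, num_states = 4, num_syms = 3, delta = mult_delta, accepting = {}\<rparr>"

lemma prog_mult: "prog 3 3 mult_core"
  unfolding prog_def wf_tm_def deterministic_def mult_core_def
  by (auto simp: length_3 split: if_splits)

lemma moves_mult:
  "moves mult_core (s, [ta, tb, tc]) = mult_delta s [scanned ta, scanned tb, scanned tc]"
  by (simp add: moves_def mult_core_def)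

lemma mult_forward:
  "dsteps mult_core (1, [ta, tape_of u v, tape_of w []]) (length v)
     (1, [ta, tape_of (u @ v) [], tape_of (w @ replicate (length v) True) []])"
proof (induction v arbitrary: u w)
  case (Cons b v)
  have w: "write_move (2, Right_Move) (tape_of w []) = tape_of (w @ [True]) []"
    using write_move_append[of True w] by (simp add: bit_sym_def)
  have "dsteps mult_core (1, [ta, tape_of u (b # v), tape_of w []]) (Suc (length v))
     (1, [ta, tape_of ((u @ [b]) @ v) [], tape_of ((w @ [True]) @ replicate (length v) True) []])"
    by (rule dsteps_first[OF _ _ Cons.IH]) (auto simp: moves_mult w)
  then show ?case by (simp del: dsteps.simps)
qed simp

lemma mult_backward:
  "dsteps mult_core (2, [ta, (fst (string_tape (u @ v)), int (length u) - 1), tape_of w []]) (Suc (length u))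
     (0, [ta, string_tape (u @ v), tape_of w []])"
proof (induction u arbitrary: v rule: rev_induct)
  case Nil
  have "scanned (fst (string_tape v), -1) = 0" "write_move (0, Right_Move) (fst (string_tape v), -1) = string_tape v"
    by (auto simp: scanned_def string_tape_def fun_eq_iff)
  then show ?case by (simp add: moves_mult)
next
  case (snoc a u)
  let ?t = "(fst (string_tape ((u @ [a]) @ v)), int (length (u @ [a])) - 1)"
  have t: "scanned ?t = bit_sym a" "write_move (bit_sym a, Left_Move) ?t = (fst (string_tape (u @ a # v)), int (length u) - 1)"
    by (auto simp: scanned_def string_tape_def fun_eq_iff nth_append)
  have "dsteps mult_core (2, [ta, ?t, tape_of w []]) (Suc (Suc (length u))) (0, [ta, string_tape (u @ a # v), tape_of w []])"
    by (rule dsteps_first[OF _ _ snoc.IH]) (use t in \<open>auto simp: moves_mult simp del: write_move.simps\<close>)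
  then show ?case by (simp del: dsteps.simps)
qed

text \<open>A round costs \<open>1\<close> step to enter, \<open>length y\<close> forward,
  \<open>1\<close> to turn and \<open>length y + 1\<close> back, hence
  \<open>2 * length y + 3\<close>. The last step finds the first input exhausted.\<close>

lemma mult_loop:
  "dsteps mult_core (0, [tape_of u x, string_tape y, tape_of w []]) (length x * (2 * length y + 3) + 1)
     (3, [tape_of (u @ x) [], string_tape y, tape_of (w @ replicate (length x * length y) True) []])"
proof (induction x arbitrary: u w)
  case Nil
  have "write_move (scanned (string_tape y), No_Move) (string_tape y) = string_tape y" by (rule write_move_idle)
  then show ?case by (simp add: moves_mult)
next
  case (Cons a x)
  let ?m = "replicate (length y) True"
  have 1: "dsteps mult_core (0, [tape_of u (a # x), string_tape y, tape_of w []]) 1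
      (1, [tape_of (u @ [a]) x, tape_of [] y, tape_of w []])"
    by (rule dsteps_1) (auto simp: moves_mult string_tape_tape_of[symmetric])
  have 2: "dsteps mult_core (1, [tape_of (u @ [a]) x, tape_of [] y, tape_of w []]) (length y)
      (1, [tape_of (u @ [a]) x, tape_of y [], tape_of (w @ ?m) []])"
    using mult_forward[of "tape_of (u @ [a]) x" "[]" y w] by simp
  have 3: "dsteps mult_core (1, [tape_of (u @ [a]) x, tape_of y [], tape_of (w @ ?m) []]) 1
      (2, [tape_of (u @ [a]) x, (fst (string_tape (y @ [])), int (length y) - 1), tape_of (w @ ?m) []])"
  proof (rule dsteps_1)
    have "write_move (0, Left_Move) (tape_of y []) = (fst (string_tape (y @ [])), int (length y) - 1)"
      by (auto simp: tape_of_def string_tape_def fun_eq_iff)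
    then show "apply_action (2, [(scanned (tape_of (u @ [a]) x), No_Move), (0, Left_Move), (0, No_Move)])
        (1, [tape_of (u @ [a]) x, tape_of y [], tape_of (w @ ?m) []]) =
      (2, [tape_of (u @ [a]) x, (fst (string_tape (y @ [])), int (length y) - 1), tape_of (w @ ?m) []])"
      by simp
  qed (simp add: moves_mult)
  note 4 = mult_backward[of "tape_of (u @ [a]) x" y "[]" "w @ ?m"]
  note 5 = Cons.IH[of "u @ [a]" "w @ ?m"]
  have "dsteps mult_core (0, [tape_of u (a # x), string_tape y, tape_of w []])
      (1 + (length y + (1 + (Suc (length y) + (length x * (2 * length y + 3) + 1)))))
     (3, [tape_of ((u @ [a]) @ x) [], string_tape y, tape_of ((w @ ?m) @ replicate (length x * length y) True) []])"
    by (rule dsteps_add[OF 1 dsteps_add[OF 2 dsteps_add[OF 3 dsteps_add[OF 4]]]]) (use 5 in simp)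
  moreover have "1 + (length y + (1 + (Suc (length y) + (length x * (2 * length y + 3) + 1)))) =
      length (a # x) * (2 * length y + 3) + 1" by simp
  ultimately have "dsteps mult_core (0, [tape_of u (a # x), string_tape y, tape_of w []]) (length (a # x) * (2 * length y + 3) + 1)
     (3, [tape_of ((u @ [a]) @ x) [], string_tape y, tape_of ((w @ ?m) @ replicate (length x * length y) True) []])"
    by metis
  moreover have "replicate (length (a # x) * length y) True = ?m @ replicate (length x * length y) True"
    by (simp add: replicate_add)
  ultimately show ?case by (simp only: append_assoc append_Cons append_Nil)
qed

text \<open>The second tape is back in place after every round, so rewinding the product suffices;
  the first tape is given up as scratch.\<close>

definition unary_mult :: tm where
  "unary_mult = seq idle mult_core (lift (rewind False) 3 3 [2])"

lemma prog_unary_mult: "prog 3 3 unary_mult"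
  unfolding unary_mult_def
  by (intro prog_seq prog_mult prog_lift[OF prog_rewind] placement_single good_link_idle) auto

lemma yields_unary_mult:
  "\<exists>q t. yields unary_mult [string_tape x, string_tape y, string_tape []] (length x * (3 * length y + 3) + 4) q
     [t, string_tape y, string_tape (replicate (length x * length y) True)]"
proof -
  let ?o = "replicate (length x * length y) True"
  have 1: "yields mult_core [string_tape x, string_tape y, string_tape []] (length x * (2 * length y + 3) + 1) 3
      [tape_of x [], string_tape y, tape_of ?o []]"
    using mult_loop[of "[]" x y "[]"]
    by (intro yields_dsteps) (auto simp: halted_def moves_mult string_tape_tape_of simp del: dsteps.simps)
  have 2: "yields (lift (rewind False) 3 3 [2]) [tape_of x [], string_tape y, tape_of ?o []]
      (length ?o + 2) 2 [tape_of x [], string_tape y, string_tape ?o]"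
    using yields_rewind_at[of 2 "[tape_of x [], string_tape y, tape_of ?o []]" ?o 3 False]
    by simp
  have "yields unary_mult [string_tape x, string_tape y, string_tape []]
     (length x * (2 * length y + 3) + 1 + (length ?o + 2) + 1) (num_states mult_core + 2)
     [tape_of x [], string_tape y, string_tape ?o]"
    unfolding unary_mult_def by (rule prog_yields_seq_idle[OF prog_mult _ _ 1 2]) auto
  then show ?thesis by (intro exI) (erule yields_mono, simp add: algebra_simps)
qed

subsection \<open>Computable functions of several arguments\<close>

lemma poly_mono_nat: "x \<le> y \<Longrightarrow> poly (p :: nat poly) x \<le> poly p y"
  by (induction p) (auto intro!: add_mono mult_mono)

lemma support_string_tape: "{i. fst (string_tape w) i \<noteq> 0} = int ` {..<length w}"
  by (auto simp: string_tape_def image_iff intro!: bexI[of _ "nat _"])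

text \<open>A step changes a single cell of tape \<open>j\<close>, so the number of nonblank cells
  grows by at most one.\<close>

lemma run_support:
  assumes "wf_tm M" "okc M c" "run M c cs = Some c'" "j < num_tapes M" "finite {i. fst (snd c ! j) i \<noteq> 0}"
  shows "finite {i. fst (snd c' ! j) i \<noteq> 0} \<and>
    card {i. fst (snd c' ! j) i \<noteq> 0} \<le> card {i. fst (snd c ! j) i \<noteq> 0} + length cs"
  using assms(2,3,5)
proof (induction cs arbitrary: c)
  case (Cons k cs)
  let ?a = "moves M c ! k"
  let ?c = "apply_action ?a c"
  have k: "k < length (moves M c)" and r: "run M ?c cs = Some c'"
    using Cons.prems(2) by (auto split: if_splits)
  have mem: "?a \<in> set (moves M c)" using k by simp
  have ok: "okc M ?c" by (rule okc_apply_action[OF assms(1) Cons.prems(1) mem])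
  have len: "length (snd ?a) = num_tapes M" by (rule wf_tm_moves[OF assms(1) Cons.prems(1) mem])
  obtain s d where w: "snd ?a ! j = (s, d)" by fastforce
  obtain f h where t: "snd c ! j = (f, h)" by fastforce
  have j: "j < length (snd c)" using Cons.prems(1) assms(4) by (simp add: okc_def)
  have "snd ?c ! j = (f(h := s), move d h)"
    using len assms(4) j w t by (simp add: apply_action_def')
  then have sub: "{i. fst (snd ?c ! j) i \<noteq> 0} \<subseteq> insert h {i. fst (snd c ! j) i \<noteq> 0}"
    using t by auto
  then have fin: "finite {i. fst (snd ?c ! j) i \<noteq> 0}"
    using Cons.prems(3) finite_subset by blast
  have "card {i. fst (snd ?c ! j) i \<noteq> 0} \<le> card (insert h {i. fst (snd c ! j) i \<noteq> 0})"
    using sub Cons.prems(3) by (intro card_mono) auto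
  also have "\<dots> \<le> Suc (card {i. fst (snd c ! j) i \<noteq> 0})"
    by (rule card_insert_le_m1) auto
  finally show ?case using Cons.IH[OF ok r fin] by auto
qed simp

definition legal :: "nat \<Rightarrow> nat \<Rightarrow> tape list \<Rightarrow> bool" where
  "legal K S ts \<longleftrightarrow> length ts = K \<and> (\<forall>t \<in> set ts. \<forall>i. fst t i < S)"

lemma prog_okc: "prog K S M \<Longrightarrow> legal K S ts \<Longrightarrow> okc M (0, ts)"
  by (auto simp: prog_def legal_def okc_def wf_tm_def)

lemma legal_tapes_of: "length xs \<le> K \<Longrightarrow> 3 \<le> S \<Longrightarrow> legal K S (tapes_of K xs)"
  unfolding legal_def by (auto intro: less_le_trans[OF tapes_of_less])

lemma yields_outcome:
  assumes "yields M ts t q ts'"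
  obtains k where "k \<le> t" "run M (0, ts) (replicate k 0) = Some (q, ts')" "halted M (q, ts')"
proof -
  obtain k where k: "outcomes M ts = {(replicate k 0, q, ts')}" "time_le M ts t"
    using assms by (auto simp: yields_def)
  then have "(replicate k 0, q, ts') \<in> outcomes M ts" by simp
  then have r: "run M (0, ts) (replicate k 0) = Some (q, ts')" "halted M (q, ts')"
    by (auto simp: outcomes_def)
  then have "length (replicate k (0::nat)) \<le> t"
    using k(2) unfolding time_le_def by blast
  then show ?thesis using that[of k] r by simp
qed

lemma yields_unique:
  assumes "yields M ts t q ts'" "run M (0, ts) cs = Some c" "halted M c"
  shows "c = (q, ts')"
proof -
  have "(cs, c) \<in> outcomes M ts" using assms(2,3) by (cases c) (simp add: outcomes_def)
  then show ?thesis using assms(1) by (auto simp: yields_def)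
qed

lemma yields_legal:
  assumes "prog K S M" "legal K S ts" "yields M ts t q ts'"
  shows "legal K S ts'"
proof -
  obtain k where "run M (0, ts) (replicate k 0) = Some (q, ts')" by (rule yields_outcome[OF assms(3)])
  moreover have "wf_tm M" using assms(1) by (simp add: prog_def)
  ultimately have "okc M (q, ts')" using okc_run prog_okc[OF assms(1,2)] by blast
  then show ?thesis using assms(1) by (auto simp: okc_def prog_def legal_def)
qed

text \<open>The length of a word on a tape is its number of nonblank cells, which the running time
  limits. This makes intermediate results polynomially long when functions are composed.\<close>

lemma yields_output_length:
  assumes "prog K S M" "legal K S ts" "yields M ts t q ts'" "j < K"
    "ts ! j = string_tape x" "ts' ! j = string_tape y"
  shows "length y \<le> length x + t"
proof -
  obtain k where k: "k \<le> t" "run M (0, ts) (replicate k 0) = Some (q, ts')" by (rule yields_outcome[OF assms(3)])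
  have card: "card {i. fst (string_tape w) i \<noteq> 0} = length w" for w
    unfolding support_string_tape by (simp add: card_image)
  have "finite {i. fst (string_tape x) i \<noteq> 0}"
    unfolding support_string_tape by simp
  moreover have "wf_tm M" "num_tapes M = K" using assms(1) by (auto simp: prog_def)
  ultimately have "card {i. fst (ts' ! j) i \<noteq> 0} \<le> card {i. fst (ts ! j) i \<noteq> 0} + k"
    using run_support[OF _ prog_okc[OF assms(1,2)] k(2), of j] assms(4,5) by simp
  then show ?thesis using k(1) assms(5,6) card by simp
qed

lemma yields_seq':
  assumes "prog K S M1" "legal K S ts" "yields M1 ts t1 q1 ts1" "yields M2 (link h q1 ts1) t2 q2 ts2"
  shows "\<exists>q. yields (seq h M1 M2) ts (t1 + t2 + 1) q ts2"
  using prog_yields_seq[where h = h, OF assms(1) _ _ assms(3,4)] assms(2) unfolding legal_def by blast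

lemmas yields_seq_idle = yields_seq'[where h = idle, unfolded link_idle]

lemma yields_lift':
  assumes "prog k S' M" "placement pos k K" "length ts = K" "sel pos ts = tapes_of k xs" "length xs \<le> k"
    "yields M (tapes_of k xs) t q us"
  shows "yields (lift M K S pos) ts t q (upd pos ts us)"
proof (rule prog_yields_lift[OF assms(1-3)])
  have "3 \<le> S'" using assms(1) by (auto simp: prog_def wf_tm_def)
  then show "fst u i < S'" if "u \<in> set (sel pos ts)" for u i
    using that assms(4) by (auto intro: less_le_trans[OF tapes_of_less])
qed (use assms in auto)

lemma prog_syms: "prog K S M \<Longrightarrow> 3 \<le> S"
  by (auto simp: prog_def wf_tm_def)

text \<open>The arguments must still be intact at the end, so that several functions of the same
  arguments can be computed one after the other. Nothing is promised about the tapes behind the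
  result, which is why every stage gets its own.\<close>

definition implements :: "nat \<Rightarrow> nat \<Rightarrow> tm \<Rightarrow> nat poly \<Rightarrow> nat \<Rightarrow> (bstring list \<Rightarrow> bstring) \<Rightarrow> bool" where
  "implements K S M p n g \<longleftrightarrow> prog K S M \<and> n < K \<and>
     (\<forall>xs. length xs = n \<longrightarrow> (\<exists>q ts. yields M (tapes_of K xs) (poly p (sum_list (map length xs))) q ts \<and>
        (\<forall>i < n. ts ! i = string_tape (xs ! i)) \<and> ts ! n = string_tape (g xs)))"

definition computable :: "nat \<Rightarrow> (bstring list \<Rightarrow> bstring) \<Rightarrow> bool" where
  "computable n g \<longleftrightarrow> (\<exists>K S M p. implements K S M p n g)"

lemma implementsD:
  assumes "implements K S M p n g"
  shows "prog K S M" "n < K" "3 \<le> S"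
    and "length xs = n \<Longrightarrow> \<exists>q ts. yields M (tapes_of K xs) (poly p (sum_list (map length xs))) q ts \<and>
      (\<forall>i < n. ts ! i = string_tape (xs ! i)) \<and> ts ! n = string_tape (g xs)"
  using assms prog_syms unfolding implements_def by blast+

text \<open>Building blocks promise less than \<open>implements\<close>: the operands may be
  destroyed, the result may replace the first one (\<open>j = 0\<close>), and only operands
  satisfying \<open>P\<close> have to be handled, as partial functions require.\<close>

definition operation :: "(bstring \<Rightarrow> bstring \<Rightarrow> bool) \<Rightarrow> nat \<Rightarrow> (bstring \<Rightarrow> bstring \<Rightarrow> bstring) \<Rightarrow> bool" where
  "operation P j H \<longleftrightarrow> (\<exists>K S M p. prog K S M \<and> 3 \<le> K \<and>
     (\<forall>a b. P a b \<longrightarrow> (\<exists>q ts. yields M (tapes_of K [a, b]) (poly p (length a + length b)) q ts \<and>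
        ts ! j = string_tape (H a b))))"

lemma computable_cong:
  "computable n g \<Longrightarrow> (\<And>xs. length xs = n \<Longrightarrow> g xs = g' xs) \<Longrightarrow> computable n g'"
  unfolding computable_def implements_def by metis

text \<open>The offset \<open>d\<close> skips work tapes already given to other machines, so that
  successive blocks are disjoint.\<close>

lemma placement_append:
  assumes "distinct ps" "set ps \<subseteq> {..<m}" "length ps + j = k" "m + d + j \<le> K"
  shows "placement (ps @ [m + d..<m + d + j]) k K"
proof -
  have "set ps \<inter> {m + d..<m + d + j} = {}" using assms(2) by fastforce
  moreover have "set ps \<subseteq> {..<K}" using assms(2,4) by fastforce
  moreover have "{m + d..<m + d + j} \<subseteq> {..<K}" using assms(4) by auto
  ultimately show ?thesis
    using assms(1,3) unfolding placement_def by (simp add: Int_commute)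
qed

lemma nth_upd:
  assumes "placement pos k (length ts)" "length us = k"
  shows "i < k \<Longrightarrow> upd pos ts us ! (pos ! i) = us ! i"
    and "j < length ts \<Longrightarrow> j \<notin> set pos \<Longrightarrow> upd pos ts us ! j = ts ! j"
  using assms placement_nth[OF assms(1)] nth_upd_in[of pos us i ts] nth_upd_out[of j ts pos us]
  by (auto simp: placement_def)

text \<open>Only the selected tapes have to look like a fresh start of \<open>M\<close>; all others
  may hold anything and are left alone. Stages can thus be chained without describing the scratch
  tapes of earlier ones.\<close>

lemma yields_placed:
  assumes M: "prog k S' M" and pos: "placement pos k K" and S: "S' \<le> S" and ts: "legal K S ts"
    and y: "yields M (tapes_of k xs) t q us" and xs: "length xs \<le> k"
    and sel: "\<And>i. i < k \<Longrightarrow> ts ! (pos ! i) = string_tape (if i < length xs then xs ! i else [])"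
  shows "\<exists>ts'. yields (lift M K S pos) ts t q ts' \<and> legal K S ts' \<and>
    (\<forall>i < k. ts' ! (pos ! i) = us ! i) \<and> (\<forall>j < K. j \<notin> set pos \<longrightarrow> ts' ! j = ts ! j)"
proof -
  have lts: "length ts = K" using ts by (simp add: legal_def)
  have lpos: "length pos = k" using pos by (simp add: placement_def)
  have "3 \<le> S'" using M by (auto simp: prog_def wf_tm_def)
  then have lus: "length us = k"
    using yields_legal[OF M legal_tapes_of y] xs by (simp add: legal_def)
  have "sel pos ts = tapes_of k xs"
    by (rule nth_equalityI) (use xs sel lpos in \<open>auto simp: sel_def nth_tapes_of\<close>)
  then have Y: "yields (lift M K S pos) ts t q (upd pos ts us)"
    using yields_lift'[OF M pos lts _ xs y] by blast
  moreover have "legal K S (upd pos ts us)" by (rule yields_legal[OF prog_lift[OF M pos S] ts Y])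
  ultimately show ?thesis using nth_upd[of pos k ts us, unfolded lts, OF pos lus] by blast
qed

text \<open>As the machine for \<open>g\<close> preserves the arguments, the one for
  \<open>h\<close> can still read them, and both values end on tapes of their own. Their lengths are
  bounded by running times, so the time spent on \<open>H\<close> is a composition of
  polynomials.\<close>

lemma computable_operation:
  assumes op: "operation P j H" and j: "j = 0 \<or> j = 2"
    and g: "computable n g" and h: "computable n h"
    and P: "\<And>xs. length xs = n \<Longrightarrow> P (g xs) (h xs)"
  shows "computable n (\<lambda>xs. H (g xs) (h xs))"
proof -
  obtain Ko So Mo po where o: "prog Ko So Mo" "3 \<le> Ko"
    and yo: "\<And>a b. P a b \<Longrightarrow> \<exists>q ts. yields Mo (tapes_of Ko [a, b]) (poly po (length a + length b)) q ts \<and>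
        ts ! j = string_tape (H a b)"
    using op unfolding operation_def by blast
  obtain Kg Sg Mg pg where "implements Kg Sg Mg pg n g" using g unfolding computable_def by blast
  note g = implementsD[OF this]
  obtain Kh Sh Mh ph where "implements Kh Sh Mh ph n h" using h unfolding computable_def by blast
  note h = implementsD[OF this]
  define S where "S = max So (max Sg Sh)"
  have S: "So \<le> S" "Sg \<le> S" "Sh \<le> S" "3 \<le> S" using g(3) by (auto simp: S_def)
  define jg jh jo where "jg = Kg - (n + 1)" and "jh = Kh - (n + 1)" and "jo = Ko - 3"
  define K where "K = n + 3 + jg + jh + jo"
  \<comment> \<open>The first three tapes of \<open>Mo\<close> are to lie on \<open>n\<close>,
    \<open>n + 1\<close> and \<open>n + 2\<close>, arranged so that tape \<open>j\<close> of
    \<open>Mo\<close>, where the result appears, is tape \<open>n\<close> of the whole.\<close>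
  obtain pa pb pc where pabc: "pa \<noteq> pb" "pa \<noteq> pc" "pb \<noteq> pc" "n \<le> pa" "n \<le> pb" "n \<le> pc"
    "pa < n + 3" "pb < n + 3" "pc < n + 3" and pj: "[pa, pb, pc] ! j = n"
  proof (cases "j = 0")
    case True
    then show ?thesis using that[of n "n + 1" "n + 2"] by simp
  next
    case False
    then show ?thesis using that[of "n + 1" "n + 2" n] j by simp
  qed
  define posg where "posg = ([0..<n] @ [pa]) @ [n + 3 + 0..<n + 3 + 0 + jg]"
  define posh where "posh = ([0..<n] @ [pb]) @ [n + 3 + jg..<n + 3 + jg + jh]"
  define poso where "poso = [pa, pb, pc] @ [n + 3 + (jg + jh)..<n + 3 + (jg + jh) + jo]"
  have plg: "placement posg Kg K" unfolding posg_def
    by (rule placement_append) (use pabc g(2) in \<open>auto simp: jg_def K_def\<close>)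
  have plh: "placement posh Kh K" unfolding posh_def
    by (rule placement_append) (use pabc h(2) in \<open>auto simp: jh_def K_def\<close>)
  have plo: "placement poso Ko K" unfolding poso_def
    by (rule placement_append) (use pabc o(2) in \<open>auto simp: jo_def K_def\<close>)
  let ?Lg = "lift Mg K S posg" let ?Lh = "lift Mh K S posh" let ?Lo = "lift Mo K S poso"
  have Lg: "prog K S ?Lg" by (rule prog_lift[OF g(1) plg S(2)])
  have Lh: "prog K S ?Lh" by (rule prog_lift[OF h(1) plh S(3)])
  have Lo: "prog K S ?Lo" by (rule prog_lift[OF o(1) plo S(1)])
  let ?M = "seq idle ?Lg (seq idle ?Lh ?Lo)"
  \<comment> \<open>\<open>po\<close> is applied to a bound on the lengths of both operands;
    \<open>2\<close> counts the linking steps.\<close>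
  let ?p = "pg + ph + pcompose po (pg + ph) + [:2:]"
  have M: "prog K S ?M" by (intro prog_seq Lg Lh Lo good_link_idle)
  have nK: "n < K" by (simp add: K_def)
  have posg: "posg ! i = (if i < n then i else if i = n then pa else i + 2)" if "i < Kg" for i
    using that by (auto simp: posg_def nth_append nth_Cons' jg_def)
  have posh: "posh ! i = (if i < n then i else if i = n then pb else i + 2 + jg)" if "i < Kh" for i
    using that by (auto simp: posh_def nth_append nth_Cons' jh_def)
  have poso: "poso ! i = (if i = 0 then pa else if i = 1 then pb else if i = 2 then pc else i + n + jg + jh)"
    if "i < Ko" for i
    using that by (auto simp: poso_def nth_append nth_Cons' jo_def)
  have "\<exists>q ts. yields ?M (tapes_of K xs) (poly ?p (sum_list (map length xs))) q ts \<and>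
        (\<forall>i < n. ts ! i = string_tape (xs ! i)) \<and> ts ! n = string_tape (H (g xs) (h xs))"
    if xs: "length xs = n" for xs
  proof -
    let ?N = "sum_list (map length xs)"
    let ?ts0 = "tapes_of K xs"
    have ts0: "?ts0 ! i = string_tape (if i < n then xs ! i else [])" if "i < K" for i
      using that xs by (simp add: nth_tapes_of)
    have leg0: "legal K S ?ts0" using xs nK S by (intro legal_tapes_of) auto
    obtain qg us where ug: "yields Mg (tapes_of Kg xs) (poly pg ?N) qg us"
      "\<forall>i < n. us ! i = string_tape (xs ! i)" "us ! n = string_tape (g xs)"
      using g(4)[OF xs] by blast
    have "?ts0 ! (posg ! i) = string_tape (if i < length xs then xs ! i else [])" if "i < Kg" for i
      using that placement_nth[OF plg that] pabc(4) xs by (simp add: ts0 posg)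
    from yields_placed[OF g(1) plg S(2) leg0 ug(1) _ this]
    obtain ts1 where Yg: "yields ?Lg ?ts0 (poly pg ?N) qg ts1" and leg1: "legal K S ts1"
      and n1: "\<forall>i < Kg. ts1 ! (posg ! i) = us ! i" "\<forall>j < K. j \<notin> set posg \<longrightarrow> ts1 ! j = ?ts0 ! j"
      using xs g(2) by auto
    have ts1_x: "ts1 ! i = string_tape (xs ! i)" if "i < n" for i
      using n1(1)[rule_format, of i] ug(2) that g(2) posg[of i] by simp
    have ts1_a: "ts1 ! pa = string_tape (g xs)"
      using n1(1)[rule_format, of n] ug(3) g(2) posg[of n] by simp
    have ts1_blank: "ts1 ! i = string_tape []" if "i < K" "n \<le> i" "i \<noteq> pa" "i < n + 3 \<or> n + 3 + jg \<le> i" for i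
    proof -
      have "i \<notin> set posg" using that by (auto simp: posg_def)
      then show ?thesis using n1(2) that ts0[of i] by simp
    qed
    obtain qh vs where uh: "yields Mh (tapes_of Kh xs) (poly ph ?N) qh vs"
      "\<forall>i < n. vs ! i = string_tape (xs ! i)" "vs ! n = string_tape (h xs)"
      using h(4)[OF xs] by blast
    have "ts1 ! (posh ! i) = string_tape (if i < length xs then xs ! i else [])" if "i < Kh" for i
    proof (cases "i < n")
      case True
      then show ?thesis using posh[OF that] ts1_x xs by simp
    next
      case False
      then show ?thesis
        using posh[OF that] placement_nth[OF plh that] pabc xs ts1_blank[of "posh ! i"] by auto
    qed
    from yields_placed[OF h(1) plh S(3) leg1 uh(1) _ this]
    obtain ts2 where Yh: "yields ?Lh ts1 (poly ph ?N) qh ts2" and leg2: "legal K S ts2"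
      and n2: "\<forall>i < Kh. ts2 ! (posh ! i) = vs ! i" "\<forall>j < K. j \<notin> set posh \<longrightarrow> ts2 ! j = ts1 ! j"
      using xs h(2) by auto
    have ts2_x: "ts2 ! i = string_tape (xs ! i)" if "i < n" for i
      using n2(1)[rule_format, of i] uh(2) that h(2) posh[of i] by simp
    have ts2_b: "ts2 ! pb = string_tape (h xs)"
      using n2(1)[rule_format, of n] uh(3) h(2) posh[of n] by simp
    have ts2_same: "ts2 ! i = ts1 ! i" if "i < K" "n \<le> i" "i \<noteq> pb" "i < n + 3 \<or> n + 3 + (jg + jh) \<le> i" for i
    proof -
      have "i \<notin> set posh" using that by (auto simp: posh_def)
      then show ?thesis using n2(2) that by simp
    qed
    have ts2_a: "ts2 ! pa = string_tape (g xs)"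
      using ts2_same[of pa] ts1_a pabc by (simp add: K_def)
    have ts2_blank: "ts2 ! i = string_tape []" if "i < K" "i = pc \<or> n + 3 + (jg + jh) \<le> i" for i
      using ts2_same[of i] ts1_blank[of i] that pabc by auto
    obtain qo ws where uo: "yields Mo (tapes_of Ko [g xs, h xs]) (poly po (length (g xs) + length (h xs))) qo ws"
      "ws ! j = string_tape (H (g xs) (h xs))"
      using yo[OF P[OF xs]] by blast
    have "ts2 ! (poso ! i) = string_tape (if i < length [g xs, h xs] then [g xs, h xs] ! i else [])" if "i < Ko" for i
    proof (cases "i < 2")
      case True
      then have "i = 0 \<or> i = 1" by auto
      then show ?thesis using poso[OF that] ts2_a ts2_b by auto
    next
      case False
      then show ?thesis using poso[OF that] placement_nth[OF plo that] ts2_blank[of "poso ! i"] by auto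
    qed
    from yields_placed[OF o(1) plo S(1) leg2 uo(1) _ this]
    obtain ts3 where Yo: "yields ?Lo ts2 (poly po (length (g xs) + length (h xs))) qo ts3"
      and n3: "\<forall>i < Ko. ts3 ! (poso ! i) = ws ! i" "\<forall>j < K. j \<notin> set poso \<longrightarrow> ts3 ! j = ts2 ! j"
      using o(2) by auto
    have ts3_x: "ts3 ! i = string_tape (xs ! i)" if "i < n" for i
    proof -
      have "i \<notin> set poso" using that pabc by (auto simp: poso_def)
      then show ?thesis using n3(2) ts2_x that nK by simp
    qed
    have "poso ! j = n" using pj j by (auto simp: poso_def)
    then have ts3_n: "ts3 ! n = string_tape (H (g xs) (h xs))"
      using n3(1)[rule_format, of j] uo(2) o(2) j by auto
    \<comment> \<open>The output tape is blank at the start, so the value is no longer than the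
      running time.\<close>
    have lg: "length (g xs) \<le> poly pg ?N"
      using yields_output_length[OF g(1) legal_tapes_of ug(1) g(2), of "[]" "g xs"] g(2,3) xs ug(3)
      by (auto simp: nth_tapes_of)
    have lh: "length (h xs) \<le> poly ph ?N"
      using yields_output_length[OF h(1) legal_tapes_of uh(1) h(2), of "[]" "h xs"] h(2,3) xs uh(3)
      by (auto simp: nth_tapes_of)
    obtain q1 where Y1: "yields (seq idle ?Lh ?Lo) ts1 (poly ph ?N + poly po (length (g xs) + length (h xs)) + 1) q1 ts3"
      using yields_seq_idle[OF Lh leg1 Yh Yo] by blast
    obtain q2 where Y2: "yields ?M ?ts0 (poly pg ?N + (poly ph ?N + poly po (length (g xs) + length (h xs)) + 1) + 1) q2 ts3"
      using yields_seq_idle[OF Lg leg0 Yg Y1] by blast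
    have "poly po (length (g xs) + length (h xs)) \<le> poly po (poly pg ?N + poly ph ?N)"
      using lg lh by (intro poly_mono_nat) simp
    then have "yields ?M ?ts0 (poly ?p ?N) q2 ts3"
      by (intro yields_mono[OF Y2]) (simp add: poly_pcompose)
    then show ?thesis using ts3_x ts3_n by blast
  qed
  then show ?thesis unfolding computable_def implements_def using M nK by blast
qed

lemma operation_transduce:
  assumes "\<forall>s a b. s < n \<longrightarrow> fst (st s a b) < n" "0 < n"
  shows "operation (\<lambda>_ _. True) 2 (transduce st fin 0)"
proof -
  have t: "tapes_of 3 [a, b] = [string_tape a, string_tape b, string_tape []]" for a b
    by (simp add: tapes_of_def)
  have "\<exists>q ts. yields (transducer False n st fin) (tapes_of 3 [a, b]) (poly [:12, 4:] (length a + length b)) q ts \<and>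
        ts ! 2 = string_tape (transduce st fin 0 a b)" for a b
  proof -
    obtain q where "yields (transducer False n st fin) [string_tape a, string_tape b, string_tape []]
      (4 * (length a + length b) + 12) q [string_tape a, string_tape b, string_tape (transduce st fin 0 a b)]"
      using yields_transducer[OF assms, of False fin a b] by auto
    then show ?thesis unfolding t
      by (intro exI[of _ q] exI[of _ "[string_tape a, string_tape b, string_tape (transduce st fin 0 a b)]"])
        (simp add: algebra_simps)
  qed
  then show ?thesis unfolding operation_def using prog_transducer[OF assms(1), of False fin] by blast
qed

lemma operation_mult: "operation (\<lambda>_ _. True) 2 (\<lambda>a b. replicate (length a * length b) True)"
proof -
  have t: "tapes_of 3 [a, b] = [string_tape a, string_tape b, string_tape []]" for a b
    by (simp add: tapes_of_def)
  have "\<exists>q ts. yields unary_mult (tapes_of 3 [a, b]) (poly [:4, 3, 3:] (length a + length b)) q ts \<and>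
        ts ! 2 = string_tape (replicate (length a * length b) True)" for a b
  proof -
    obtain q t where y: "yields unary_mult [string_tape a, string_tape b, string_tape []] (length a * (3 * length b + 3) + 4) q
     [t, string_tape b, string_tape (replicate (length a * length b) True)]"
      using yields_unary_mult by blast
    have "length a * (3 * length b + 3) \<le> (length a + length b) * (3 * (length a + length b) + 3)"
      by (intro mult_mono) auto
    also have "\<dots> + 4 = poly [:4, 3, 3:] (length a + length b)" by (simp add: algebra_simps)
    finally have "length a * (3 * length b + 3) + 4 \<le> poly [:4, 3, 3:] (length a + length b)" by simp
    note yields_mono[OF y this]
    then show ?thesis unfolding t
      by (intro exI[of _ q] exI[of _ "[t, string_tape b, string_tape (replicate (length a * length b) True)]"])
        simp
  qed
  then show ?thesis unfolding operation_def using prog_unary_mult by blast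
qed

section \<open>Projections, and the machines behind the complexity classes as building
  blocks\<close>

abbreviation copy_st :: transitions where "copy_st \<equiv> \<lambda>s a b. (0, a)"

lemma transduce_copy: "transduce copy_st (\<lambda>_. None) 0 x [] = x"
  by (induction x) auto

text \<open>Even a projection has to copy: the argument must stay where it is, and the result
  belongs on tape \<open>n\<close>. Tape \<open>n + 1\<close> serves as the empty second input of
  the transducer.\<close>

lemma computable_nth:
  assumes "i < n"
  shows "computable n (\<lambda>xs. xs ! i)"
proof -
  let ?T = "transducer False 1 copy_st (\<lambda>_. None)"
  let ?pos = "[i, n + 1, n]"
  have T: "prog 3 3 ?T" by (rule prog_transducer) auto
  have pl: "placement ?pos 3 (n + 2)" using assms by (auto simp: placement_def)
  let ?M = "lift ?T (n + 2) 3 ?pos"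
  have "\<exists>q ts. yields ?M (tapes_of (n + 2) xs) (poly [:12, 4:] (sum_list (map length xs))) q ts \<and>
        (\<forall>i < n. ts ! i = string_tape (xs ! i)) \<and> ts ! n = string_tape (xs ! i)"
    if xs: "length xs = n" for xs
  proof -
    let ?ts = "tapes_of (n + 2) xs" and ?us = "[string_tape (xs ! i), string_tape [], string_tape (xs ! i)]"
    have t: "tapes_of 3 [xs ! i] = [string_tape (xs ! i), string_tape [], string_tape []]"
      by (simp add: tapes_of_def eval_nat_numeral)
    obtain q where y: "yields ?T (tapes_of 3 [xs ! i]) (4 * length (xs ! i) + 12) q ?us"
      using yields_transducer[of 1 copy_st False "\<lambda>_. None" "xs ! i" "[]"] t by (auto simp: transduce_copy)
    have leg: "legal (n + 2) 3 ?ts" using xs by (intro legal_tapes_of) auto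
    have "?ts ! (?pos ! l) = string_tape (if l < length [xs ! i] then [xs ! i] ! l else [])" if "l < 3" for l
      using that assms xs by (auto simp: nth_tapes_of less_Suc_eq numeral_3_eq_3)
    from yields_placed[OF T pl order_refl leg y _ this]
    obtain ts where Y: "yields ?M ?ts (4 * length (xs ! i) + 12) q ts"
      and n: "\<forall>l < 3. ts ! (?pos ! l) = ?us ! l" "\<forall>l < n + 2. l \<notin> set ?pos \<longrightarrow> ts ! l = ?ts ! l"
      by auto
    have "length (xs ! i) \<le> sum_list (map length xs)"
      using assms xs by (intro member_le_sum_list) auto
    then have Y': "yields ?M ?ts (poly [:12, 4:] (sum_list (map length xs))) q ts"
      by (intro yields_mono[OF Y]) simp
    have "ts ! k = string_tape (xs ! k)" if "k < n" for k
      using n(1)[rule_format, of 0] n(2)[rule_format, of k] that xs by (cases "k = i") (auto simp: nth_tapes_of)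
    moreover have "ts ! n = string_tape (xs ! i)"
      using n(1)[rule_format, of 2] by simp
    ultimately show ?thesis using Y' by blast
  qed
  moreover have "prog (n + 2) 3 ?M" by (rule prog_lift[OF T pl]) simp
  moreover have "n < n + 2" by simp
  ultimately show ?thesis unfolding computable_def implements_def by blast
qed

lemma yields_NPM_deterministic:
  assumes "NPM M" "deterministic M"
  obtains p :: "nat poly" where
    "\<And>x. \<exists>q ts. yields M (tapes_of (num_tapes M) [x]) (poly p (length x)) q ts"
proof -
  have wf: "wf_tm M" using assms(1) by (simp add: NPM_def)
  obtain p :: "nat poly" where p: "\<forall>x cs. run M (init_config M x) cs \<noteq> None \<longrightarrow> length cs \<le> poly p (length x)"
    using assms(1) by (auto simp: NPM_def)
  have "\<exists>q ts. yields M (tapes_of (num_tapes M) [x]) (poly p (length x)) q ts" for x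
  proof (rule yields_deterministic[OF wf assms(2)])
    show "okc M (0, tapes_of (num_tapes M) [x])"
      using okc_tapes_of[OF wf, of "[x]"] wf by (simp add: wf_tm_def)
    show "time_le M (tapes_of (num_tapes M) [x]) (poly p (length x))"
      using p unfolding time_le_def init_config_tapes_of by blast
  qed
  then show ?thesis by (rule that)
qed

lemma acc_nonempty_iff_outcome:
  "acc M x \<noteq> {} \<longleftrightarrow> (\<exists>(cs, q, ts) \<in> outcomes M (tapes_of (num_tapes M) [x]). q \<in> accepting M)"
  unfolding acc_def acc_choices_def outcomes_def init_config_tapes_of by auto

lemma lang_yields:
  assumes "yields M (tapes_of (num_tapes M) [x]) t q ts"
  shows "x \<in> lang M \<longleftrightarrow> q \<in> accepting M"
proof -
  obtain k where "outcomes M (tapes_of (num_tapes M) [x]) = {(replicate k 0, q, ts)}"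
    using assms by (auto simp: yields_def)
  then show ?thesis by (simp add: lang_def acc_nonempty_iff_outcome)
qed

text \<open>Tape \<open>0\<close> stays in place, while tapes \<open>1\<close> and \<open>2\<close>
  are left free for the ignored second operand and for a verdict.\<close>

definition spread :: "nat \<Rightarrow> nat list" where
  "spread k = map (\<lambda>i. if i = 0 then 0 else i + 2) [0..<k]"

lemma length_spread [simp]: "length (spread k) = k"
  by (simp add: spread_def)

lemma placement_spread: "placement (spread k) k (k + 2)"
  by (auto simp: spread_def placement_def distinct_map inj_on_def)

lemma nth_spread [simp]: "i < k \<Longrightarrow> spread k ! i = (if i = 0 then 0 else i + 2)"
  by (simp add: spread_def)

lemma two_notin_spread: "2 \<notin> set (spread k)"
  by (auto simp: spread_def)

lemma yields_spread:
  assumes M: "prog k S M" and k: "1 \<le> k" and y: "yields M (tapes_of k [a]) t q us"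
  shows "\<exists>ts. yields (lift M (k + 2) S (spread k)) (tapes_of (k + 2) [a, b]) t q ts \<and>
    legal (k + 2) S ts \<and> ts ! 0 = us ! 0 \<and> ts ! 2 = string_tape []"
proof -
  have leg: "legal (k + 2) S (tapes_of (k + 2) [a, b])"
    using prog_syms[OF M] by (intro legal_tapes_of) auto
  have "tapes_of (k + 2) [a, b] ! (spread k ! i) = string_tape (if i < length [a] then [a] ! i else [])" if "i < k" for i
    using that by (auto simp: nth_tapes_of)
  from yields_placed[OF M placement_spread order_refl leg y _ this]
  obtain ts where ts: "yields (lift M (k + 2) S (spread k)) (tapes_of (k + 2) [a, b]) t q ts" "legal (k + 2) S ts"
    and n: "\<forall>i < k. ts ! (spread k ! i) = us ! i"
      "\<forall>j < k + 2. j \<notin> set (spread k) \<longrightarrow> ts ! j = tapes_of (k + 2) [a, b] ! j"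
    using k by auto
  have "ts ! 0 = us ! 0" using n(1)[rule_format, of 0] k by simp
  moreover have "ts ! 2 = string_tape []" using n(2) k two_notin_spread by (simp add: nth_tapes_of)
  ultimately show ?thesis using ts by blast
qed

text \<open>The machine leaves the value on its first tape, hence \<open>j = 0\<close>. What it
  leaves there is specified only for arguments in the domain, hence the condition.\<close>

lemma operation_partial:
  assumes "ptime_computable f"
  shows "operation (\<lambda>a _. a \<in> dom f) 0 (\<lambda>a _. the (f a))"
proof -
  obtain M where M: "NPM M" "deterministic M" and
    out: "\<forall>x y. f x = Some y \<longrightarrow> (\<exists>cs c. run M (init_config M x) cs = Some c \<and> halted M c \<and> hd (snd c) = string_tape y)"
    using assms unfolding ptime_computable_def by (elim exE conjE)
  let ?k = "num_tapes M"
  have wf: "wf_tm M" using M by (simp add: NPM_def)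
  then have k: "1 \<le> ?k" "3 \<le> num_syms M" by (auto simp: wf_tm_def)
  have pr: "prog ?k (num_syms M) M" using wf M by (simp add: prog_def)
  obtain p :: "nat poly" where p: "\<And>x. \<exists>q ts. yields M (tapes_of ?k [x]) (poly p (length x)) q ts"
    using yields_NPM_deterministic[OF M] by blast
  note pl = placement_spread[of ?k]
  let ?M = "lift M (?k + 2) (num_syms M) (spread ?k)"
  have "\<exists>q ts. yields ?M (tapes_of (?k + 2) [a, b]) (poly p (length a + length b)) q ts \<and> ts ! 0 = string_tape (the (f a))"
    if a: "a \<in> dom f" for a b
  proof -
    obtain q us where us: "yields M (tapes_of ?k [a]) (poly p (length a)) q us" using p by blast
    obtain y where y: "f a = Some y" using a by blast
    obtain cs c where c: "run M (init_config M a) cs = Some c" "halted M c" "hd (snd c) = string_tape y"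
      using out[rule_format, OF y] by (elim exE conjE)
    have "c = (q, us)" using yields_unique[OF us _ c(2)] c(1) by (simp add: init_config_tapes_of)
    then have hd: "hd us = string_tape y" using c by simp
    obtain ts where Y: "yields ?M (tapes_of (?k + 2) [a, b]) (poly p (length a)) q ts" "ts ! 0 = us ! 0"
      using yields_spread[OF pr k(1) us, of b] by blast
    have lus: "length us = ?k"
      using yields_legal[OF pr legal_tapes_of us] k by (simp add: legal_def)
    have "yields ?M (tapes_of (?k + 2) [a, b]) (poly p (length a + length b)) q ts"
      by (rule yields_mono[OF Y(1)]) (simp add: poly_mono_nat)
    moreover note Y(2)
    moreover have "us ! 0 = hd us" using lus k by (cases us) auto
    ultimately have "yields ?M (tapes_of (?k + 2) [a, b]) (poly p (length a + length b)) q ts \<and> ts ! 0 = string_tape (the (f a))"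
      using hd y by simp
    then show ?thesis by blast
  qed
  moreover have "prog (?k + 2) (num_syms M) ?M" by (rule prog_lift[OF pr pl]) simp
  moreover have "3 \<le> ?k + 2" using k by simp
  ultimately show ?thesis unfolding operation_def by blast
qed

text \<open>Acceptance is a property of the final state. The link still sees that state and turns it
  into a letter on tape \<open>d\<close>.\<close>

definition flag :: "nat set \<Rightarrow> nat \<Rightarrow> nat \<Rightarrow> nat list \<Rightarrow> (nat \<times> dir) list" where
  "flag A d q rs = (idle q rs)[d := (bit_sym (q \<in> A), No_Move)]"

text \<open>Takes over after a link whose writing is all that is wanted.\<close>

definition stop :: "nat \<Rightarrow> nat \<Rightarrow> tm" where
  "stop K S = \<lparr>num_tapes = K, num_states = 1, num_syms = S, delta = \<lambda>_ _. [], accepting = {}\<rparr>"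

lemma prog_stop: "1 \<le> K \<Longrightarrow> 3 \<le> S \<Longrightarrow> prog K S (stop K S)"
  by (simp add: prog_def wf_tm_def deterministic_def stop_def)

lemma yields_stop: "yields (stop K S) ts 0 0 ts"
  by (rule yields_dsteps) (auto simp: halted_def moves_def stop_def)

lemma good_link_flag:
  assumes "3 \<le> S"
  shows "good_link K S (flag A d)"
  unfolding good_link_def
proof (intro allI impI conjI)
  fix q :: nat and rs :: "nat list"
  assume rs: "length rs = K \<and> set rs \<subseteq> {..<S}"
  have "bit_sym b < S" for b using assms by (simp add: less_le_trans[of _ 3])
  moreover have "set (flag A d q rs) \<subseteq> insert (bit_sym (q \<in> A), No_Move) (set (idle q rs))"
    unfolding flag_def by (rule set_update_subset_insert)
  then have "fst ` set (flag A d q rs) \<subseteq> fst ` insert (bit_sym (q \<in> A), No_Move) (set (idle q rs))"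
    by (rule image_mono)
  moreover have "fst ` insert (bit_sym (q \<in> A), No_Move) (set (idle q rs)) = insert (bit_sym (q \<in> A)) (set rs)"
    by (simp add: idle_def image_image)
  ultimately show "fst ` set (flag A d q rs) \<subseteq> {..<S}" using rs by auto
qed (simp add: flag_def idle_def)

lemma write_move_flag: "write_move (bit_sym b, No_Move) (string_tape []) = string_tape [b]"
  by (auto simp: string_tape_def fun_eq_iff)

lemma link_flag:
  assumes "d < length ts" "ts ! d = string_tape []"
  shows "link (flag A d) q ts = ts[d := string_tape [q \<in> A]]"
proof (rule nth_equalityI)
  fix i assume "i < length (link (flag A d) q ts)"
  then show "link (flag A d) q ts ! i = ts[d := string_tape [q \<in> A]] ! i"
    using assms by (cases "i = d") (auto simp: flag_def idle_def write_move_flag)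
qed (simp add: flag_def idle_def)

lemma operation_decide:
  assumes "L \<in> PTIME"
  shows "operation (\<lambda>_ _. True) 2 (\<lambda>a _. [a \<in> L])"
proof -
  obtain M where M: "NPM M" "deterministic M" and L: "L = lang M"
    using assms unfolding PTIME_def by blast
  let ?k = "num_tapes M" let ?S = "num_syms M"
  have wf: "wf_tm M" using M by (simp add: NPM_def)
  then have k: "1 \<le> ?k" "3 \<le> num_syms M" by (auto simp: wf_tm_def)
  have pr: "prog ?k ?S M" using wf M by (simp add: prog_def)
  obtain p :: "nat poly" where p: "\<And>x. \<exists>q ts. yields M (tapes_of ?k [x]) (poly p (length x)) q ts"
    using yields_NPM_deterministic[OF M] by blast
  note pl = placement_spread[of ?k]
  let ?L = "lift M (?k + 2) ?S (spread ?k)"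
  let ?M = "seq (flag (accepting M) 2) ?L (stop (?k + 2) ?S)"
  have prL: "prog (?k + 2) ?S ?L" by (rule prog_lift[OF pr pl]) simp
  have "\<exists>q ts. yields ?M (tapes_of (?k + 2) [a, b]) (poly (p + 1) (length a + length b)) q ts \<and> ts ! 2 = string_tape [a \<in> L]"
    for a b
  proof -
    obtain q us where us: "yields M (tapes_of ?k [a]) (poly p (length a)) q us" using p by blast
    have q: "a \<in> L \<longleftrightarrow> q \<in> accepting M" using lang_yields[OF us] L by simp
    have leg: "legal (?k + 2) ?S (tapes_of (?k + 2) [a, b])"
      using k by (intro legal_tapes_of) auto
    obtain ts where Y: "yields ?L (tapes_of (?k + 2) [a, b]) (poly p (length a)) q ts"
      and leg': "legal (?k + 2) ?S ts" and ts: "ts ! 2 = string_tape []"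
      using yields_spread[OF pr k(1) us, of b] by blast
    have lts: "length ts = ?k + 2" using leg' by (simp add: legal_def)
    have "link (flag (accepting M) 2) q ts = ts[2 := string_tape [a \<in> L]]"
      using link_flag[of 2 ts "accepting M" q] k q lts ts by simp
    then have Y2: "yields (stop (?k + 2) ?S) (link (flag (accepting M) 2) q ts) 0 0 (ts[2 := string_tape [a \<in> L]])"
      using yields_stop by simp
    obtain q' where Y3: "yields ?M (tapes_of (?k + 2) [a, b]) (poly p (length a) + 0 + 1) q' (ts[2 := string_tape [a \<in> L]])"
      using yields_seq'[where h = "flag (accepting M) 2", OF prL leg Y Y2] by blast
    have "poly p (length a) \<le> poly p (length a + length b)" by (simp add: poly_mono_nat)
    then have "yields ?M (tapes_of (?k + 2) [a, b]) (poly (p + 1) (length a + length b)) q' (ts[2 := string_tape [a \<in> L]])"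
      by (intro yields_mono[OF Y3]) simp
    moreover have "ts[2 := string_tape [a \<in> L]] ! 2 = string_tape [a \<in> L]" using k lts by simp
    ultimately show ?thesis by blast
  qed
  moreover have "prog (?k + 2) ?S ?M"
    using k by (intro prog_seq prL prog_stop good_link_flag) auto
  moreover have "3 \<le> ?k + 2" using k by simp
  ultimately show ?thesis unfolding operation_def by blast
qed

subsection \<open>Checking computation paths\<close>

lemma replicate_True_eq_iff:
  "replicate i True @ False # u = replicate j True @ False # v \<longleftrightarrow> i = j \<and> u = v"
proof (induction i arbitrary: j)
  case 0
  then show ?case by (cases j) auto
next
  case (Suc i)
  then show ?case by (cases j) auto
qed

lemma encode_choices_simps [simp]:
  "encode_choices [] = []"
  "encode_choices (i # cs) = replicate i True @ False # encode_choices cs"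
  by (simp_all add: encode_choices_def)

definition accepts_from :: "tm \<Rightarrow> config \<Rightarrow> nat list \<Rightarrow> bool" where
  "accepts_from N c cs \<longleftrightarrow> (\<exists>c'. run N c cs = Some c' \<and> halted N c' \<and> fst c' \<in> accepting N)"

lemma acc_iff: "w \<in> acc N x \<longleftrightarrow> (\<exists>cs. w = encode_choices cs \<and> accepts_from N (init_config N x) cs)"
  by (auto simp: acc_def acc_choices_def accepts_from_def)

text \<open>\<open>j\<close> counts the bits of the current unary choice that have been read already.\<close>

fun path_ok :: "tm \<Rightarrow> config \<Rightarrow> nat \<Rightarrow> bstring \<Rightarrow> bool" where
  "path_ok N c j [] \<longleftrightarrow> j = 0 \<and> halted N c \<and> fst c \<in> accepting N"
| "path_ok N c j (True # p) \<longleftrightarrow> j < length (moves N c) \<and> path_ok N c (Suc j) p"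
| "path_ok N c j (False # p) \<longleftrightarrow> j < length (moves N c) \<and> path_ok N (apply_action (moves N c ! j) c) 0 p"

text \<open>\<open>replicate j True\<close> restores the part of the current choice that has been
  consumed, so that the induction over the remaining bits can pass through the middle of a
  choice.\<close>

lemma path_ok_iff:
  "path_ok N c j p \<longleftrightarrow> (\<exists>cs. replicate j True @ p = encode_choices cs \<and> accepts_from N c cs)"
proof (induction N c j p rule: path_ok.induct)
  case (1 N c j)
  have "replicate j True = encode_choices cs \<longleftrightarrow> j = 0 \<and> cs = []" for cs
  proof (cases cs)
    case (Cons i ds)
    have "replicate j True \<noteq> encode_choices cs"
    proof
      assume "replicate j True = encode_choices cs"
      moreover have "False \<in> set (encode_choices cs)" unfolding Cons encode_choices_simps by simp
      ultimately have "False \<in> set (replicate j True)" by (simp only:)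
      then show False by simp
    qed
    moreover have "cs \<noteq> []" using Cons by simp
    ultimately show ?thesis by blast
  next
    case Nil
    then show ?thesis by simp
  qed
  then have "(\<exists>cs. replicate j True @ [] = encode_choices cs \<and> accepts_from N c cs) \<longleftrightarrow> j = 0 \<and> accepts_from N c []"
    by simp
  then show ?case by (simp add: accepts_from_def)
next
  case (2 N c j p)
  \<comment> \<open>After \<open>j\<close> ones, a further one announces a choice above
    \<open>j\<close>, so rejecting at once when there is no move number \<open>j\<close> loses
    nothing. This test also keeps the counter bounded.\<close>
  have J: "j < length (moves N c)" if "replicate j True @ True # p = encode_choices cs" "accepts_from N c cs" for cs
  proof (cases cs)
    case Nil
    then show ?thesis using that(1) by simp
  next
    case (Cons i ds)
    have "j < i"
    proof (rule ccontr)
      assume "\<not> j < i"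
      then have "j = i + (j - i)" by simp
      then obtain d where d: "j = i + d" ..
      have "replicate i True @ (replicate d True @ True # p) = replicate i True @ False # encode_choices ds"
        using that(1) Cons d by (simp add: replicate_add)
      then have "replicate d True @ True # p = False # encode_choices ds" by simp
      then show False by (cases d) auto
    qed
    moreover have "i < length (moves N c)" using that(2) Cons by (auto simp: accepts_from_def split: if_splits)
    ultimately show ?thesis by simp
  qed
  have e: "replicate (Suc j) True @ p = replicate j True @ True # p"
    by (simp add: replicate_app_Cons_same)
  show ?case
  proof (cases "j < length (moves N c)")
    case True
    then show ?thesis unfolding path_ok.simps 2[unfolded e] by simp
  next
    case False
    then have "\<not> (\<exists>cs. replicate j True @ True # p = encode_choices cs \<and> accepts_from N c cs)"
      using J by blast
    then show ?thesis using False by simp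
  qed
next
  case (3 N c j p)
  have "(\<exists>cs. replicate j True @ False # p = encode_choices cs \<and> accepts_from N c cs) \<longleftrightarrow>
    (\<exists>ds. p = encode_choices ds \<and> accepts_from N c (j # ds))" (is "?L = ?R")
  proof
    assume ?L
    then obtain cs where cs: "replicate j True @ False # p = encode_choices cs" "accepts_from N c cs" by blast
    then obtain i ds where i: "cs = i # ds" by (cases cs) auto
    then have "j = i \<and> p = encode_choices ds" using cs(1) replicate_True_eq_iff by simp
    then show ?R using cs i by blast
  next
    assume ?R
    then obtain ds where "p = encode_choices ds" "accepts_from N c (j # ds)" by blast
    then show ?L by (intro exI[of _ "j # ds"]) simp
  qed
  also have "?R \<longleftrightarrow> j < length (moves N c) \<and> path_ok N (apply_action (moves N c ! j) c) 0 p"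
  proof (cases "j < length (moves N c)")
    case True
    then show ?thesis using 3 by (simp add: accepts_from_def)
  next
    case False
    then show ?thesis by (simp add: accepts_from_def)
  qed
  finally show ?case by simp
qed

text \<open>State \<open>q * (B + 1) + j\<close> stands for state \<open>q\<close> of \<open>N\<close> with \<open>j\<close> bits of the current choice
  read; tape \<open>1\<close> holds the path, tape \<open>2\<close> receives the verdict.\<close>

fun sim_delta :: "tm \<Rightarrow> nat \<Rightarrow> nat \<Rightarrow> nat list \<Rightarrow> action list" where
  "sim_delta N B s (x # p # f # rest) = (
     let q = s div (B + 1); j = s mod (B + 1); as = delta N q (x # rest) in
     if s \<ge> num_states N * (B + 1) then []
     else if p = 2 \<and> j < length as then
       [(s + 1, (x, No_Move) # (p, Right_Move) # (f, No_Move) # idle 0 rest)]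
     else if p = 1 \<and> j < length as then
       [(fst (as ! j) * (B + 1), hd (snd (as ! j)) # (p, Right_Move) # (f, No_Move) # tl (snd (as ! j)))]
     else [(num_states N * (B + 1), (x, No_Move) # (p, No_Move) #
        (bit_sym (p = 0 \<and> j = 0 \<and> as = [] \<and> q \<in> accepting N), No_Move) # idle 0 rest)])"
| "sim_delta N B s _ = []"

definition sim :: "tm \<Rightarrow> nat \<Rightarrow> tm" where
  "sim N B = \<lparr>num_tapes = num_tapes N + 2, num_states = num_states N * (B + 1) + 1,
     num_syms = num_syms N, delta = sim_delta N B, accepting = {}\<rparr>"

lemma prog_sim:
  assumes "wf_tm N"
  shows "prog (num_tapes N + 2) (num_syms N) (sim N B)"
proof -
  have N: "1 \<le> num_tapes N" "1 \<le> num_states N" "3 \<le> num_syms N" using assms by (auto simp: wf_tm_def)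
  have main: "length (sim_delta N B s rs) \<le> 1 \<and> (\<forall>a \<in> set (sim_delta N B s rs). fst a < num_states N * (B + 1) + 1 \<and>
      length (snd a) = num_tapes N + 2 \<and> fst ` set (snd a) \<subseteq> {..<num_syms N})"
    if s: "s < num_states N * (B + 1) + 1" and rs: "length rs = num_tapes N + 2" "set rs \<subseteq> {..<num_syms N}" for s rs
  proof -
    obtain x p f rest where r: "rs = x # p # f # rest"
    proof -
      have "\<exists>x p f rest. rs = x # p # f # rest" using rs(1) N(1)
        by (cases rs; cases "tl rs"; cases "tl (tl rs)") auto
      then show ?thesis using that by blast
    qed
    let ?q = "s div (B + 1)" let ?j = "s mod (B + 1)" let ?as = "delta N ?q (x # rest)"
    have idle: "fst ` set (idle 0 rest) \<subseteq> {..<num_syms N}" "length (idle 0 rest) = length rest"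
      using rs r by (auto simp: idle_def)
    have b: "bit_sym b < num_syms N" for b using N(3) by (simp add: less_le_trans[of _ 3])
    show ?thesis
    \<comment> \<open>Only this branch executes an action of \<open>N\<close>; the well-formedness
      of \<open>N\<close> bounds the new state, the symbols and the number of tapes.\<close>
    proof (cases "s < num_states N * (B + 1) \<and> p = 1 \<and> ?j < length ?as")
      case True
      then have q: "?q < num_states N" by (simp add: less_mult_imp_div_less)
      have "?as ! ?j \<in> set ?as" using True by simp
      have l: "length (x # rest) = num_tapes N \<and> set (x # rest) \<subseteq> {..<num_syms N}"
        using rs r by auto
      have W: "\<forall>(q', ws)\<in>set ?as. q' < num_states N \<and> length ws = num_tapes N \<and> fst ` set ws \<subseteq> {..<num_syms N}"
        using assms[unfolded wf_tm_def, THEN conjunct2, THEN conjunct2, THEN conjunct2, rule_format, OF q l, THEN conjunct2] .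
      note a' = bspec[OF W \<open>?as ! ?j \<in> set ?as\<close>, unfolded case_prod_beta]
      note a = a'[THEN conjunct1] a'[THEN conjunct2, THEN conjunct1] a'[THEN conjunct2, THEN conjunct2]
      have e: "sim_delta N B s rs = [(fst (?as ! ?j) * (B + 1), hd (snd (?as ! ?j)) # (p, Right_Move) # (f, No_Move) # tl (snd (?as ! ?j)))]"
        using True unfolding r by (simp add: Let_def)
      obtain w ws where w: "snd (?as ! ?j) = w # ws" using a(2) N(1) by (cases "snd (?as ! ?j)") auto
      have "fst (?as ! ?j) * (B + 1) \<le> num_states N * (B + 1)"
        using a(1) by (intro mult_le_mono1) simp
      then have "fst (?as ! ?j) * (B + 1) < num_states N * (B + 1) + 1" by linarith
      moreover have "p < num_syms N" "f < num_syms N" using rs r by auto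
      ultimately show ?thesis unfolding e using a(2,3) w by (simp del: mult_Suc_right add_mult_distrib2)
    next
      case False
      show ?thesis
      proof (cases "s \<ge> num_states N * (B + 1)")
        case True
        then show ?thesis unfolding r by (simp add: Let_def)
      next
        case s: False
        then have "sim_delta N B s rs =
          (if p = 2 \<and> ?j < length ?as then
             [(s + 1, (x, No_Move) # (p, Right_Move) # (f, No_Move) # idle 0 rest)]
           else [(num_states N * (B + 1), (x, No_Move) # (p, No_Move) #
              (bit_sym (p = 0 \<and> ?j = 0 \<and> ?as = [] \<and> ?q \<in> accepting N), No_Move) # idle 0 rest)])"
          using False unfolding r by (simp add: Let_def)
        then show ?thesis using s rs r idle b by (simp add: not_le)
      qed
    qed
  qed
  have d: "distinct l" if "length l \<le> 1" for l :: "action list"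
    using that by (cases l rule: list.exhaust; cases "tl l") auto
  have "distinct (delta (sim N B) s rs) \<and> (\<forall>(q', ws) \<in> set (delta (sim N B) s rs). q' < num_states (sim N B) \<and>
      length ws = num_tapes (sim N B) \<and> fst ` set ws \<subseteq> {..<num_syms (sim N B)})"
    if "s < num_states (sim N B)" "length rs = num_tapes (sim N B) \<and> set rs \<subseteq> {..<num_syms (sim N B)}" for s rs
  proof -
    have s: "s < num_states N * (B + 1) + 1" and rs: "length rs = num_tapes N + 2" "set rs \<subseteq> {..<num_syms N}"
      using that by (simp_all add: sim_def)
    note m = main[OF s rs]
    have "delta (sim N B) s rs = sim_delta N B s rs" by (simp add: sim_def)
    moreover have "distinct (sim_delta N B s rs)" using d m by blast
    ultimately show ?thesis using m unfolding case_prod_beta by (simp add: sim_def)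
  qed
  moreover have "num_tapes (sim N B) \<ge> 1" "num_states (sim N B) \<ge> 1" "num_syms (sim N B) \<ge> 3"
    using N by (auto simp: sim_def)
  moreover have "deterministic (sim N B)"
    using main unfolding deterministic_def by (simp add: sim_def)
  moreover have "num_tapes (sim N B) = num_tapes N + 2" "num_syms (sim N B) = num_syms N" by (simp_all add: sim_def)
  ultimately show ?thesis unfolding prog_def wf_tm_def by blast
qed

lemma div_mod_state:
  "j \<le> B \<Longrightarrow> (q * (B + 1) + j) div (B + 1) = q" "j \<le> B \<Longrightarrow> (q * (B + 1) + j) mod (B + 1) = (j :: nat)"
  using div_mult_self3[of "B + 1" q j] mod_mult_self3[of q "B + 1" j] by simp_all

text \<open>Each letter of the path costs at most one step and the verdict one more, however long
  \<open>N\<close> could run. Since \<open>B\<close> bounds the branching, the counter never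
  overflows into the code of another state.\<close>

lemma dsteps_sim:
  assumes N: "wf_tm N" and B: "\<And>c. okc N c \<Longrightarrow> length (moves N c) \<le> B"
  shows "okc N (q, tx # rest) \<Longrightarrow> j \<le> B \<Longrightarrow> \<exists>t ts. t \<le> length p + 1 \<and>
    dsteps (sim N B) (q * (B + 1) + j, tx # tape_of u p # string_tape [] # rest) t (num_states N * (B + 1), ts) \<and>
    ts ! 2 = string_tape [path_ok N (q, tx # rest) j p]"
proof (induction p arbitrary: q tx rest j u)
  case Nil
  let ?c = "(q, tx # rest)" let ?H = "num_states N * (B + 1)"
  let ?s = "q * (B + 1) + j"
  have q: "q < num_states N" using Nil by (simp add: okc_def)
  note s = div_mod_state[OF Nil(2), of q]
  \<comment> \<open>As \<open>j \<le> B\<close>, the code lies in the block of \<open>q\<close>,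
    hence below the halting code.\<close>
  have "?s < q * (B + 1) + (B + 1)" using Nil(2) by simp
  also have "\<dots> = (q + 1) * (B + 1)" by simp
  also have "\<dots> \<le> ?H" using q by (intro mult_le_mono1) simp
  finally have sH: "?s < ?H" .
  have i: "map2 write_move (idle 0 (map scanned rest)) rest = rest" by simp
  let ?b = "path_ok N ?c j []"
  have b: "?b \<longleftrightarrow> j = 0 \<and> delta N q (scanned tx # map scanned rest) = [] \<and> q \<in> accepting N"
    by (simp add: halted_def moves_def)
  have "dsteps (sim N B) (?s, tx # tape_of u [] # string_tape [] # rest) 1
      (?H, tx # tape_of u [] # string_tape [?b] # rest)"
  proof (rule dsteps_1)
    show "moves (sim N B) (?s, tx # tape_of u [] # string_tape [] # rest) =
      [(?H, (scanned tx, No_Move) # (0, No_Move) # (bit_sym ?b, No_Move) # idle 0 (map scanned rest))]"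
      using sH s unfolding b by (simp add: moves_def sim_def Let_def del: mult_Suc_right add_mult_distrib2)
  qed (simp add: write_move_flag)
  moreover have "(tx # tape_of u [] # string_tape [?b] # rest) ! 2 = string_tape [?b]" by simp
  moreover have "1 \<le> length [] + (1 :: nat)" by simp
  ultimately show ?case by blast
next
  case (Cons a p)
  let ?c = "(q, tx # rest)" let ?H = "num_states N * (B + 1)"
  let ?s = "q * (B + 1) + j"
  let ?ts = "tx # tape_of u (a # p) # string_tape [] # rest"
  have q: "q < num_states N" using Cons by (simp add: okc_def)
  note s = div_mod_state[OF Cons(3), of q]
  have "?s < q * (B + 1) + (B + 1)" using Cons(3) by simp
  also have "\<dots> = (q + 1) * (B + 1)" by simp
  also have "\<dots> \<le> ?H" using q by (intro mult_le_mono1) simp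
  finally have sH: "?s < ?H" .
  have m: "moves N ?c = delta N q (scanned tx # map scanned rest)" by (simp add: moves_def)
  have st: "scanned (string_tape []) = 0" by (simp add: string_tape_tape_of)
  show ?case
  proof (cases "j < length (moves N ?c)")
    case False
    have "dsteps (sim N B) (?s, ?ts) 1 (?H, tx # tape_of u (a # p) # string_tape [False] # rest)"
    proof (rule dsteps_1)
      show "moves (sim N B) (?s, ?ts) =
        [(?H, (scanned tx, No_Move) # (bit_sym a, No_Move) # (bit_sym False, No_Move) # idle 0 (map scanned rest))]"
        using sH s False unfolding m by (simp add: moves_def sim_def Let_def del: mult_Suc_right add_mult_distrib2)
    qed (simp add: write_move_flag)
    moreover have "\<not> path_ok N ?c j (a # p)" using False by (cases a) auto
    then have "(tx # tape_of u (a # p) # string_tape [False] # rest) ! 2 = string_tape [path_ok N ?c j (a # p)]" by simp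
    moreover have "1 \<le> length (a # p) + 1" by simp
    ultimately show ?thesis by blast
  next
    case True
    show ?thesis
    proof (cases a)
      case a: True
      have "j + 1 \<le> B" using True B[OF Cons.prems(1)] by simp
      from Cons.IH[OF Cons.prems(1) this, of "u @ [a]"] obtain t ts where t: "t \<le> length p + 1"
        "dsteps (sim N B) (q * (B + 1) + (j + 1), tx # tape_of (u @ [a]) p # string_tape [] # rest) t (?H, ts)"
        "ts ! 2 = string_tape [path_ok N ?c (j + 1) p]" by blast
      have "dsteps (sim N B) (?s, ?ts) (Suc t) (?H, ts)"
      proof (rule dsteps_first[OF _ _ t(2)])
        show "moves (sim N B) (?s, ?ts) =
          [(?s + 1, (scanned tx, No_Move) # (bit_sym a, Right_Move) # (0, No_Move) # idle 0 (map scanned rest))]"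
          using sH s True a unfolding m by (simp add: moves_def sim_def Let_def st del: mult_Suc_right add_mult_distrib2)
        show "apply_action (?s + 1, (scanned tx, No_Move) # (bit_sym a, Right_Move) # (0, No_Move) # idle 0 (map scanned rest)) (?s, ?ts) =
          (q * (B + 1) + (j + 1), tx # tape_of (u @ [a]) p # string_tape [] # rest)"
          by (simp add: string_tape_tape_of)
      qed
      moreover have "path_ok N ?c j (a # p) \<longleftrightarrow> path_ok N ?c (j + 1) p" using True a by simp
      then have "ts ! 2 = string_tape [path_ok N ?c j (a # p)]" using t(3) by simp
      moreover have "Suc t \<le> length (a # p) + 1" using t(1) by simp
      ultimately show ?thesis by blast
    next
      case a: False
      let ?a = "moves N ?c ! j"
      have mem: "?a \<in> set (moves N ?c)" using True by simp
      note wa = wf_tm_moves[OF N Cons.prems(1) mem]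
      have lr: "Suc (length rest) = num_tapes N" using Cons.prems(1) by (simp add: okc_def)
      obtain w ws where w: "snd ?a = w # ws" using wa(2) lr by (cases "snd ?a") auto
      have ap: "apply_action ?a ?c = (fst ?a, write_move w tx # map2 write_move ws rest)"
        using w by (simp add: apply_action_def')
      have ok: "okc N (fst ?a, write_move w tx # map2 write_move ws rest)"
        using okc_apply_action[OF N Cons.prems(1) mem] ap by simp
      from Cons.IH[OF ok, of 0 "u @ [a]"] obtain t ts where t: "t \<le> length p + 1"
        "dsteps (sim N B) (fst ?a * (B + 1) + 0, write_move w tx # tape_of (u @ [a]) p # string_tape [] # map2 write_move ws rest) t (?H, ts)"
        "ts ! 2 = string_tape [path_ok N (fst ?a, write_move w tx # map2 write_move ws rest) 0 p]" by blast
      have "dsteps (sim N B) (?s, ?ts) (Suc t) (?H, ts)"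
      proof (rule dsteps_first[OF _ _ t(2)])
        show "moves (sim N B) (?s, ?ts) =
          [(fst ?a * (B + 1), w # (bit_sym a, Right_Move) # (0, No_Move) # ws)]"
          using sH s True a w unfolding m by (simp add: moves_def sim_def Let_def st bit_sym_def del: mult_Suc_right add_mult_distrib2)
        show "apply_action (fst ?a * (B + 1), w # (bit_sym a, Right_Move) # (0, No_Move) # ws) (?s, ?ts) =
          (fst ?a * (B + 1) + 0, write_move w tx # tape_of (u @ [a]) p # string_tape [] # map2 write_move ws rest)"
          by (simp add: string_tape_tape_of)
      qed
      moreover have "path_ok N ?c j (a # p) \<longleftrightarrow> path_ok N (fst ?a, write_move w tx # map2 write_move ws rest) 0 p"
        using True a ap by simp
      then have "ts ! 2 = string_tape [path_ok N ?c j (a # p)]" using t(3) by simp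
      moreover have "Suc t \<le> length (a # p) + 1" using t(1) by simp
      ultimately show ?thesis by blast
    qed
  qed
qed

text \<open>The moves depend only on the state and the scanned symbols, of which an
  \<open>okc\<close> configuration has finitely many combinations.\<close>

lemma moves_bounded:
  assumes "wf_tm N"
  obtains B where "\<And>c. okc N c \<Longrightarrow> length (moves N c) \<le> B"
proof -
  let ?R = "{rs. set rs \<subseteq> {..<num_syms N} \<and> length rs = num_tapes N}"
  let ?F = "(\<lambda>(q, rs). length (delta N q rs)) ` ({..<num_states N} \<times> ?R)"
  have fin: "finite ?F" by (intro finite_imageI finite_cartesian_product finite_lists_length_eq) auto
  have "length (moves N c) \<le> Max ?F" if c: "okc N c" for c
  proof (rule Max_ge[OF fin])
    have "(fst c, map scanned (snd c)) \<in> {..<num_states N} \<times> ?R"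
      using scanned_less[OF c] c by (simp add: okc_def)
    then show "length (moves N c) \<in> ?F" unfolding moves_def by (rule rev_image_eqI) simp
  qed
  then show ?thesis by (rule that)
qed

text \<open>\<open>sim\<close> has its operands where \<open>tapes_of\<close> puts them,
  \<open>x\<close> on tape \<open>0\<close> and the path on tape \<open>1\<close>; the remaining
  tapes of \<open>N\<close> lie behind the verdict on tape \<open>2\<close>.\<close>

lemma operation_path:
  assumes N: "wf_tm N"
  shows "operation (\<lambda>_ _. True) 2 (\<lambda>x p. [p \<in> acc N x])"
proof -
  obtain B where B: "\<And>c. okc N c \<Longrightarrow> length (moves N c) \<le> B" using moves_bounded[OF N] by blast
  let ?k = "num_tapes N"
  have k: "1 \<le> ?k" "1 \<le> num_states N" using N by (auto simp: wf_tm_def)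
  have "\<exists>q ts. yields (sim N B) (tapes_of (?k + 2) [x, p]) (poly [:1, 1:] (length x + length p)) q ts \<and>
     ts ! 2 = string_tape [p \<in> acc N x]" for x p
  proof -
    let ?rest = "replicate (?k - 1) (string_tape [])"
    have i: "init_config N x = (0, string_tape x # ?rest)" by (simp add: init_config_def)
    have "okc N (0, tapes_of ?k [x])" using okc_tapes_of[OF N, of "[x]"] k by simp
    then have ok: "okc N (0, string_tape x # ?rest)" by (simp add: tapes_of_def)
    from dsteps_sim[OF N B ok, of 0 p "[]"] obtain t ts where t: "t \<le> length p + 1"
      "dsteps (sim N B) (0, string_tape x # string_tape p # string_tape [] # ?rest) t (num_states N * (B + 1), ts)"
      "ts ! 2 = string_tape [path_ok N (0, string_tape x # ?rest) 0 p]"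
      unfolding string_tape_tape_of[symmetric] by auto
    have e: "string_tape x # string_tape p # string_tape [] # ?rest = tapes_of (?k + 2) [x, p]"
    proof -
      have "?k = Suc (?k - 1)" using k by simp
      then have "replicate ?k (string_tape []) = string_tape [] # ?rest" by (metis replicate_Suc)
      then show ?thesis by (simp add: tapes_of_def)
    qed
    have h: "halted (sim N B) (num_states N * (B + 1), ts)"
    proof -
      have "sim_delta N B (num_states N * (B + 1)) rs = []" for rs
        by (cases "(N, B, num_states N * (B + 1), rs)" rule: sim_delta.cases) (auto simp: Let_def)
      then show ?thesis by (simp add: halted_def moves_def sim_def)
    qed
    have "yields (sim N B) (tapes_of (?k + 2) [x, p]) t (num_states N * (B + 1)) ts"
      by (rule yields_dsteps[OF _ h]) (use t(2) e in simp)
    then have "yields (sim N B) (tapes_of (?k + 2) [x, p]) (poly [:1, 1:] (length x + length p)) (num_states N * (B + 1)) ts"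
      by (rule yields_mono) (use t(1) in simp)
    moreover have "path_ok N (0, string_tape x # ?rest) 0 p \<longleftrightarrow> p \<in> acc N x"
      by (simp add: path_ok_iff acc_iff i)
    ultimately show ?thesis using t(3) by auto
  qed
  moreover have "3 \<le> ?k + 2" using k by simp
  ultimately show ?thesis unfolding operation_def using prog_sim[OF N, of B] by blast
qed

subsection \<open>Closure properties\<close>

lemma NPM_yields:
  assumes "wf_tm M" "num_tapes M = K" "\<And>x. \<exists>q ts. yields M (tapes_of K [x]) (poly p (length x)) q ts"
  shows "NPM M"
  unfolding NPM_def
proof (intro conjI assms(1) exI allI impI)
  fix x cs assume r: "run M (init_config M x) cs \<noteq> None"
  obtain q ts where "yields M (tapes_of K [x]) (poly p (length x)) q ts" using assms(3) by blast
  then show "length cs \<le> poly p (length x)"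
    using r unfolding yields_def time_le_def init_config_tapes_of assms(2) by blast
qed

text \<open>\<open>FP\<close> asks for a machine that accepts exactly the domain, here every string.
  Making all states accepting achieves this without affecting the runs.\<close>

lemma FP_yields:
  fixes p :: "nat poly"
  assumes M: "prog K S M"
    and y: "\<And>x. \<exists>q ts. yields M (tapes_of K [x]) (poly p (length x)) q ts \<and> ts ! 0 = string_tape (f x)"
  shows "f \<in> FP"
proof -
  let ?M = "M\<lparr>accepting := UNIV\<rparr>"
  have "wf_tm M" "deterministic M" using M by (simp_all add: prog_def)
  then have wf: "wf_tm ?M" "deterministic ?M"
    unfolding wf_tm_def deterministic_def by simp_all
  have K: "num_tapes ?M = K" "1 \<le> K"
    using M by (auto simp: prog_def wf_tm_def)
  have y': "\<exists>q ts. yields ?M (tapes_of K [x]) (poly p (length x)) q ts \<and> ts ! 0 = string_tape (f x)" for x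
    using y[of x] unfolding yields_accepting_update .
  have "\<exists>q ts. yields ?M (tapes_of K [x]) (poly p (length x)) q ts" for x using y'[of x] by blast
  then have "NPM ?M" by (rule NPM_yields[OF wf(1) K(1)])
  moreover have "lang ?M = UNIV"
  proof -
    have "x \<in> lang ?M" for x
    proof -
      obtain q ts where "yields ?M (tapes_of (num_tapes ?M) [x]) (poly p (length x)) q ts"
        using y' unfolding K by blast
      from lang_yields[OF this] show ?thesis by simp
    qed
    then show ?thesis by auto
  qed
  moreover have "\<exists>cs c. run ?M (init_config ?M x) cs = Some c \<and> halted ?M c \<and> hd (snd c) = string_tape (f x)" for x
  proof -
    obtain q ts where ts: "yields ?M (tapes_of K [x]) (poly p (length x)) q ts" "ts ! 0 = string_tape (f x)"
      using y' by blast
    obtain k where k: "run ?M (0, tapes_of K [x]) (replicate k 0) = Some (q, ts)" "halted ?M (q, ts)"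
      using yields_outcome[OF ts(1)] .
    have "okc ?M (q, ts)" using okc_run[OF wf(1) _ k(1)] okc_tapes_of[OF wf(1), of "[x]"] K by simp
    then have "hd (snd (q, ts)) = string_tape (f x)"
      using ts(2) K by (cases ts) (auto simp: okc_def)
    then show ?thesis using k unfolding init_config_tapes_of K by blast
  qed
  ultimately show ?thesis
    unfolding FP_def ptime_computable_def using wf(2) by (intro CollectI exI[of _ ?M]) auto
qed

lemma PTIME_yields:
  fixes p :: "nat poly"
  assumes M: "prog K S M"
    and y: "\<And>x. \<exists>q ts. yields M (tapes_of K [x]) (poly p (length x)) q ts \<and> (q \<in> accepting M \<longleftrightarrow> x \<in> L)"
  shows "L \<in> PTIME"
proof -
  have wf: "wf_tm M" "deterministic M" and K: "num_tapes M = K"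
    using M by (auto simp: prog_def)
  have "\<exists>q ts. yields M (tapes_of K [x]) (poly p (length x)) q ts" for x using y[of x] by blast
  then have "NPM M" by (rule NPM_yields[OF wf(1) K])
  moreover have "x \<in> lang M \<longleftrightarrow> x \<in> L" for x
  proof -
    obtain q ts where t: "yields M (tapes_of (num_tapes M) [x]) (poly p (length x)) q ts" "q \<in> accepting M \<longleftrightarrow> x \<in> L"
      using y unfolding K by blast
    from lang_yields[OF t(1)] t(2) show ?thesis by simp
  qed
  then have "L = lang M" by blast
  ultimately show ?thesis
    unfolding PTIME_def using wf(2) by blast
qed

text \<open>\<open>computable\<close> keeps the argument on tape \<open>0\<close> and puts the value
  on tape \<open>1\<close>, whereas \<open>FP\<close> wants the value on tape \<open>0\<close>. So
  the input is moved to tape \<open>2\<close>, with tape \<open>0\<close> blanked, and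
  \<open>M\<close> then runs with its output tape placed on tape \<open>0\<close>.\<close>

lemma FP_I:
  assumes "computable 1 g"
  shows "(\<lambda>x. g [x]) \<in> FP"
proof -
  obtain K S M p where "implements K S M p 1 g" using assms unfolding computable_def by blast
  note M = implementsD[OF this]
  note S = M(3)
  let ?T = "transducer True 1 copy_st (\<lambda>_. None)"
  have T: "prog 3 3 ?T" by (rule prog_transducer) auto
  have pl: "placement [0, 1, 2] 3 (K + 1)" using M(2) by (auto simp: placement_def)
  define pos where "pos = map (\<lambda>i. if i = 0 then 2 else if i = 1 then 0 else i + 1) [0..<K]"
  have pl2: "placement pos K (K + 1)"
    unfolding placement_def pos_def distinct_map using M(2) by (auto simp: inj_on_def split: if_splits)
  have npos: "pos ! i = (if i = 0 then 2 else if i = 1 then 0 else i + 1)" if "i < K" for i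
    using that by (simp add: pos_def)
  let ?C = "lift ?T (K + 1) S [0, 1, 2]"
  let ?L = "lift M (K + 1) S pos"
  let ?M = "seq idle ?C ?L"
  have C: "prog (K + 1) S ?C" by (rule prog_lift[OF T pl S])
  have L: "prog (K + 1) S ?L" by (rule prog_lift[OF M(1) pl2]) simp
  have "\<exists>q ts. yields ?M (tapes_of (K + 1) [x]) (poly (p + [:13, 4:]) (length x)) q ts \<and> ts ! 0 = string_tape (g [x])" for x
  proof -
    let ?ts = "tapes_of (K + 1) [x]"
    have leg: "legal (K + 1) S ?ts" using S by (intro legal_tapes_of) auto
    have t: "tapes_of 3 [x] = [string_tape x, string_tape [], string_tape []]"
      by (simp add: tapes_of_def eval_nat_numeral)
    let ?us = "[string_tape [], string_tape [], string_tape x]"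
    obtain q where y1: "yields ?T (tapes_of 3 [x]) (4 * length x + 12) q ?us"
      using yields_transducer[of 1 copy_st True "\<lambda>_. None" x "[]"] t by (auto simp: transduce_copy)
    have "?ts ! ([0, 1, 2] ! i) = string_tape (if i < length [x] then [x] ! i else [])" if "i < 3" for i
    proof -
      have "2 < K + 1" using M(2) by simp
      from nth_tapes_of[OF this, of "[x]"] have "?ts ! 2 = string_tape []" by simp
      then show ?thesis using that M(2) by (auto simp: nth_tapes_of less_Suc_eq numeral_3_eq_3)
    qed
    from yields_placed[OF T pl S leg y1 _ this]
    obtain ts1 where Y1: "yields ?C ?ts (4 * length x + 12) q ts1" and leg1: "legal (K + 1) S ts1"
      and n1: "\<forall>i < 3. ts1 ! ([0, 1, 2] ! i) = ?us ! i" "\<forall>j < K + 1. j \<notin> set [0, 1, 2] \<longrightarrow> ts1 ! j = ?ts ! j"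
      by auto
    have ts1: "ts1 ! (pos ! i) = string_tape (if i < length [x] then [x] ! i else [])" if "i < K" for i
    proof -
      consider "i = 0" | "i = 1" | "2 \<le> i" by linarith
      then show ?thesis
      proof cases
        case 1
        then show ?thesis using n1(1)[rule_format, of 2] npos[OF that] by simp
      next
        case 2
        then show ?thesis using n1(1)[rule_format, of 0] npos[OF that] by simp
      next
        case 3
        then show ?thesis using n1(2)[rule_format, of "i + 1"] npos[OF that] that by (simp add: nth_tapes_of)
      qed
    qed
    have "\<exists>q ts. yields M (tapes_of K [x]) (poly p (length x)) q ts \<and> ts ! 1 = string_tape (g [x])"
      using M(4)[of "[x]"] by auto
    then obtain q2 vs where v: "yields M (tapes_of K [x]) (poly p (length x)) q2 vs" "vs ! 1 = string_tape (g [x])"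
      by blast
    from yields_placed[OF M(1) pl2 order_refl leg1 v(1) _ ts1]
    obtain ts2 where Y2: "yields ?L ts1 (poly p (length x)) q2 ts2" and n2: "\<forall>i < K. ts2 ! (pos ! i) = vs ! i"
      using M(2) by auto
    have "ts2 ! 0 = string_tape (g [x])"
      using n2[rule_format, of 1] npos[of 1] M(2) v(2) by simp
    moreover
    from yields_seq_idle[OF C leg Y1 Y2] obtain q3 where
      Y3: "yields ?M ?ts (4 * length x + 12 + poly p (length x) + 1) q3 ts2" by blast
    have "yields ?M ?ts (poly (p + [:13, 4:]) (length x)) q3 ts2"
      by (rule yields_mono[OF Y3]) simp
    ultimately show ?thesis by blast
  qed
  moreover have "prog (K + 1) S ?M" by (intro prog_seq C L good_link_idle)
  ultimately show ?thesis using FP_yields[of "K + 1" S ?M "p + [:13, 4:]" "\<lambda>x. g [x]"] by blast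
qed

text \<open>The reverse of \<open>flag\<close>: a verdict letter becomes a state. The symbol
  \<open>2\<close> stands for \<open>True\<close>, and only state \<open>1\<close> accepts.\<close>

fun test_delta :: "nat \<Rightarrow> nat list \<Rightarrow> action list" where
  "test_delta q [r] = (if q = 0 then [(if r = 2 then 1 else 2, [(r, No_Move)])] else [])"
| "test_delta q _ = []"

definition test :: tm where
  "test = \<lparr>num_tapes = 1, num_states = 3, num_syms = 3, delta = test_delta, accepting = {1}\<rparr>"

lemma prog_test: "prog 1 3 test"
proof -
  have l: "length rs = 1 \<longleftrightarrow> (\<exists>r. rs = [r])" for rs :: "nat list" by (cases rs) auto
  have "\<forall>q < 3. \<forall>rs. length rs = 1 \<and> set rs \<subseteq> {..<3} \<longrightarrow>
    distinct (test_delta q rs) \<and> length (test_delta q rs) \<le> 1 \<and> (\<forall>(q', ws) \<in> set (test_delta q rs).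
      q' < 3 \<and> length ws = 1 \<and> fst ` set ws \<subseteq> {..<3})"
    unfolding l by auto
  then show ?thesis
    unfolding prog_def wf_tm_def deterministic_def by (simp add: test_def)
qed

lemma yields_test: "yields test [string_tape [b]] 1 (if b then 1 else 2) [string_tape [b]]"
proof (rule yields_dsteps[OF dsteps_1])
  show "moves test (0, [string_tape [b]]) = [(if b then 1 else 2, [(bit_sym b, No_Move)])]"
    by (simp add: moves_def test_def string_tape_tape_of)
  show "halted test (if b then 1 else 2, [string_tape [b]])"
    by (simp add: halted_def moves_def test_def)
qed (simp add: string_tape_tape_of)

lemma yields_test_at:
  assumes "i < K" "length ts = K" "ts ! i = string_tape [b]"
  shows "yields (lift test K S [i]) ts 1 (if b then 1 else 2) ts"
proof -
  have s: "sel [i] ts = [string_tape [b]]" using assms by (simp add: sel_def)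
  have "yields (lift test K S [i]) ts 1 (if b then 1 else 2) (upd [i] ts [string_tape [b]])"
    by (rule prog_yields_lift[OF prog_test placement_single])
      (use s assms yields_test in auto)
  moreover have "upd [i] ts [string_tape [b]] = ts"
    by (rule upd_eqI[OF placement_single]) (use assms in auto)
  ultimately show ?thesis by simp
qed

definition decidable :: "nat \<Rightarrow> (bstring list \<Rightarrow> bool) \<Rightarrow> bool" where
  "decidable n P \<longleftrightarrow> computable n (\<lambda>xs. [P xs])"

lemma PTIME_I:
  assumes "decidable 1 (\<lambda>xs. xs ! 0 \<in> L)"
  shows "L \<in> PTIME"
proof -
  obtain K S M p where "implements K S M p 1 (\<lambda>xs. [xs ! 0 \<in> L])"
    using assms unfolding decidable_def computable_def by blast
  note M = implementsD[OF this]
  note S = M(3)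
  let ?T = "lift test K S [1]"
  let ?M = "seq idle M ?T"
  have T: "prog K S ?T" by (rule prog_lift[OF prog_test placement_single[OF M(2)] S])
  have "\<exists>q ts. yields ?M (tapes_of K [x]) (poly (p + [:2:]) (length x)) q ts \<and> (q \<in> accepting ?M \<longleftrightarrow> x \<in> L)" for x
  proof -
    have "\<exists>q ts. yields M (tapes_of K [x]) (poly p (length x)) q ts \<and> ts ! 1 = string_tape [x \<in> L]"
      using M(4)[of "[x]"] by auto
    then obtain q us where u: "yields M (tapes_of K [x]) (poly p (length x)) q us" "us ! 1 = string_tape [x \<in> L]"
      by blast
    have leg: "legal K S (tapes_of K [x])" using S M(2) by (intro legal_tapes_of) auto
    have lu: "length us = K" using yields_legal[OF M(1) leg u(1)] by (simp add: legal_def)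
    have "yields ?T (link idle q us) 1 (if x \<in> L then 1 else 2) us"
      unfolding link_idle by (rule yields_test_at[OF M(2) lu u(2)])
    then have Y: "yields ?M (tapes_of K [x]) (poly p (length x) + 1 + 1) (num_states M + (if x \<in> L then 1 else 2)) us"
      using leg M(1) u(1) by (intro prog_yields_seq) (auto simp: legal_def)
    have "yields ?M (tapes_of K [x]) (poly (p + [:2:]) (length x)) (num_states M + (if x \<in> L then 1 else 2)) us"
      by (rule yields_mono[OF Y]) simp
    moreover have "num_states M + (if x \<in> L then 1 else 2) \<in> accepting ?M \<longleftrightarrow> x \<in> L"
      by (auto simp: test_def)
    ultimately show ?thesis by blast
  qed
  moreover have "prog K S ?M" by (intro prog_seq M T good_link_idle)
  ultimately show ?thesis using PTIME_yields[of K S ?M "p + [:2:]" L] by blast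
qed

section \<open>A toolkit of computable functions and decidable predicates\<close>

lemma computable_partial:
  assumes "ptime_computable f" "computable n g" "\<And>xs. length xs = n \<Longrightarrow> g xs \<in> dom f"
  shows "computable n (\<lambda>xs. the (f (g xs)))"
  by (rule computable_operation[OF operation_partial[OF assms(1)] _ assms(2) assms(2)]) (use assms(3) in auto)

lemma computable_FP:
  assumes "f \<in> FP" "computable n g"
  shows "computable n (\<lambda>xs. f (g xs))"
  using computable_partial[of "\<lambda>x. Some (f x)" n g] assms by (auto simp: FP_def)

lemma decidable_PTIME:
  assumes "L \<in> PTIME" "computable n g"
  shows "decidable n (\<lambda>xs. g xs \<in> L)"
  unfolding decidable_def
  by (rule computable_operation[OF operation_decide[OF assms(1)] _ assms(2) assms(2)]) auto

lemma decidable_acc: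
  assumes "wf_tm N" "computable n g" "computable n h"
  shows "decidable n (\<lambda>xs. h xs \<in> acc N (g xs))"
  unfolding decidable_def
  by (rule computable_operation[OF operation_path[OF assms(1)] _ assms(2,3)]) auto

lemma computable_transduce:
  assumes "\<forall>s a b. s < m \<longrightarrow> fst (st s a b) < m" "0 < m" "computable n g" "computable n h"
  shows "computable n (\<lambda>xs. transduce st fin 0 (g xs) (h xs))"
  by (rule computable_operation[OF operation_transduce[OF assms(1,2)] _ assms(3,4)]) auto

lemma computable_mult:
  assumes "computable n g" "computable n h"
  shows "computable n (\<lambda>xs. replicate (length (g xs) * length (h xs)) True)"
  by (rule computable_operation[OF operation_mult _ assms]) auto

text \<open>Obtained from a transducer that reads an argument and writes nothing, so there must be
  an argument to read.\<close>

lemma computable_Nil: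
  assumes "0 < n"
  shows "computable n (\<lambda>_. [])"
proof -
  have "transduce (\<lambda>_ _ _. (0, None)) (\<lambda>_. None) s x y = []" for s x y
    by (induction "\<lambda>(_ :: nat) (_ :: bool option) (_ :: bool option). (0 :: nat, None :: bool option)"
        "\<lambda>_ :: nat. None :: bool option" s x y rule: transduce.induct) auto
  then show ?thesis
    using computable_transduce[of 1 "\<lambda>_ _ _. (0, None)" n "\<lambda>xs. xs ! 0" "\<lambda>xs. xs ! 0" "\<lambda>_. None"]
      computable_nth[OF assms] by simp
qed

lemma computable_transduce1:
  assumes "\<forall>s a b. s < m \<longrightarrow> fst (st s a b) < m" "0 < m" "computable n g" "0 < n"
  shows "computable n (\<lambda>xs. transduce st fin 0 (g xs) [])"
  by (rule computable_transduce[OF assms(1-3) computable_Nil[OF assms(4)]])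

text \<open>The pending bit is kept in the state: \<open>0\<close> for \<open>b\<close> itself, then \<open>1\<close> or \<open>2\<close> for the last
  bit read.\<close>

definition cons_st :: "bool \<Rightarrow> transitions" where
  "cons_st b s a a' = (case a of None \<Rightarrow> (0, None)
     | Some c \<Rightarrow> (if c then 2 else 1, Some (if s = 0 then b else s = 2)))"

lemma transduce_cons:
  "transduce (cons_st b) (\<lambda>s. Some (if s = 0 then b else s = 2)) s x [] = (if s = 0 then b else s = 2) # x"
  by (induction x arbitrary: s) (auto simp: cons_st_def)

lemma computable_Cons:
  assumes "computable n g" "0 < n"
  shows "computable n (\<lambda>xs. b # g xs)"
  using computable_transduce1[of 3 "cons_st b" n g "\<lambda>s. Some (if s = 0 then b else s = 2)"] assms
  unfolding transduce_cons by (simp add: cons_st_def split: option.split)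

lemma computable_const: "0 < n \<Longrightarrow> computable n (\<lambda>_. w)"
  by (induction w) (auto intro: computable_Nil computable_Cons)

lemma computable_tl:
  assumes "computable n g" "0 < n"
  shows "computable n (\<lambda>xs. tl (g xs))"
proof -
  let ?st = "\<lambda>s a b. (1, if s = 0 then None else a) :: nat \<times> bool option"
  have 1: "transduce ?st (\<lambda>_. None) 1 x [] = x" for x by (induction x) auto
  have "transduce ?st (\<lambda>_. None) 0 x [] = tl x" for x using 1 by (cases x) auto
  then show ?thesis using computable_transduce1[of 2 ?st n g "\<lambda>_. None"] assms by simp
qed

text \<open>State \<open>1\<close> records a mismatch. Unequal lengths are noticed as well, since a
  letter then meets \<open>None\<close>.\<close>

lemma decidable_eq:
  assumes "computable n g" "computable n h"
  shows "decidable n (\<lambda>xs. g xs = h xs)"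
proof -
  let ?st = "\<lambda>(s :: nat) (a :: bool option) b. (if a = b then s else 1, None :: bool option)"
  let ?fin = "\<lambda>s :: nat. Some (s = 0)"
  have "transduce ?st ?fin s x y = [s = 0 \<and> x = y]" for s x y
    by (induction ?st ?fin s x y rule: transduce.induct) auto
  then show ?thesis unfolding decidable_def
    using computable_transduce[of 2 ?st n g h ?fin] assms by simp
qed

text \<open>Verdicts are one-letter strings, so the first step of a transducer sees both of them and
  can evaluate \<open>\<beta>\<close>.\<close>

lemma decidable_binop:
  assumes "decidable n P" "decidable n Q"
  shows "decidable n (\<lambda>xs. \<beta> (P xs) (Q xs))"
proof -
  let ?st = "\<lambda>s a b. (if \<beta> (a = Some True) (b = Some True) then 1 else 2, None) :: nat \<times> bool option"
  let ?fin = "\<lambda>s. Some (s = 1)"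
  have "transduce ?st ?fin 0 [p] [q] = [\<beta> p q]" for p q by simp
  then show ?thesis
    using computable_transduce[of 3 ?st n "\<lambda>xs. [P xs]" "\<lambda>xs. [Q xs]" ?fin] assms
    unfolding decidable_def by simp
qed

lemma decidable_not: "decidable n P \<Longrightarrow> decidable n (\<lambda>xs. \<not> P xs)"
  using decidable_binop[of n P P "\<lambda>p q. \<not> p"] by simp

lemma decidable_and: "decidable n P \<Longrightarrow> decidable n Q \<Longrightarrow> decidable n (\<lambda>xs. P xs \<and> Q xs)"
  by (rule decidable_binop)

lemma decidable_or: "decidable n P \<Longrightarrow> decidable n Q \<Longrightarrow> decidable n (\<lambda>xs. P xs \<or> Q xs)"
  by (rule decidable_binop)

text \<open>The verdict is read together with the first letter of \<open>g xs\<close>, early enough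
  to decide about that letter: state \<open>1\<close> copies, state \<open>2\<close>
  suppresses.\<close>

lemma computable_guard:
  assumes "decidable n P" "computable n g"
  shows "computable n (\<lambda>xs. if P xs then g xs else [])"
proof -
  let ?st = "\<lambda>s a b. (if s = 1 \<or> s = 0 \<and> a = Some True then (1, b) else (2, None)) :: nat \<times> bool option"
  have 1: "transduce ?st (\<lambda>_. None) 1 [] y = y" for y by (induction y) auto
  have 2: "transduce ?st (\<lambda>_. None) 2 [] y = []" for y by (induction y) auto
  have "transduce ?st (\<lambda>_. None) 0 [p] y = (if p then y else [])" for p y
    using 1 2 by (cases y) (auto simp: numeral_2_eq_2)
  then show ?thesis
    using computable_transduce[of 3 ?st n "\<lambda>xs. [P xs]" g "\<lambda>_. None"] assms
    unfolding decidable_def by simp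
qed

text \<open>The alternative not taken is emptied by a guard, and the transducer passes on whichever
  string is left.\<close>

lemma computable_if:
  assumes "decidable n P" "computable n g" "computable n h"
  shows "computable n (\<lambda>xs. if P xs then g xs else h xs)"
proof -
  let ?st = "\<lambda>s a b. (0, if a = None then b else a) :: nat \<times> bool option"
  have 1: "transduce ?st (\<lambda>_. None) 0 x [] = x" for x by (induction x) auto
  have 2: "transduce ?st (\<lambda>_. None) 0 [] y = y" for y by (induction y) auto
  have "computable n (\<lambda>xs. transduce ?st (\<lambda>_. None) 0 (if P xs then g xs else []) (if \<not> P xs then h xs else []))"
    by (rule computable_transduce[of 1]) (use assms in \<open>auto intro: computable_guard decidable_not\<close>)
  then show ?thesis
    by (rule computable_cong) (use 1 2 in auto)
qed

text \<open>Horner's scheme in unary. Such a string is the clock that limits the length of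
  guesses.\<close>

lemma computable_length_poly: "\<exists>g. computable 1 g \<and> (\<forall>x. length (g [x]) = poly p (length x))"
proof (induction p)
  case 0
  show ?case using computable_Nil[of 1] by (intro exI[of _ "\<lambda>_. []"]) simp
next
  case (pCons a p)
  then obtain g where g: "computable 1 g" "\<forall>x. length (g [x]) = poly p (length x)" by blast
  have m: "computable 1 (\<lambda>xs. replicate (length (xs ! 0) * length (g xs)) True)"
    by (rule computable_mult[OF computable_nth g(1)], rule zero_less_one)
  have "computable 1 (\<lambda>xs. replicate a True @ replicate (length (xs ! 0) * length (g xs)) True)"
    by (induction a) (use m in \<open>auto intro: computable_Cons\<close>)
  then show ?case using g(2) by (intro exI) auto
qed

subsection \<open>Guess and verify\<close>

lemma run_halted: "halted M c \<Longrightarrow> run M c cs = Some d \<longleftrightarrow> cs = [] \<and> d = c"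
  by (cases cs) (auto simp: halted_def)

lemma run_halted_iff: "halted M c \<Longrightarrow> run M c cs = Some d \<and> halted M d \<longleftrightarrow> cs = [] \<and> d = c"
  using run_halted[of M c cs d] by blast

text \<open>The first tape is the clock: every guessed bit uses up one of its cells. Stopping is
  listed first in both cases, so it always is choice \<open>0\<close>.\<close>

fun guess_delta :: "nat \<Rightarrow> nat list \<Rightarrow> action list" where
  "guess_delta q [b, w] =
     (if q = 0 then
        if b = 0 then [(1, [(b, No_Move), (w, No_Move)])]
        else [(1, [(b, No_Move), (w, No_Move)]), (0, [(b, Right_Move), (1, Right_Move)]),
          (0, [(b, Right_Move), (2, Right_Move)])]
      else [])"
| "guess_delta q _ = []"

definition guess :: tm where
  "guess = \<lparr>num_tapes = 2, num_states = 2, num_syms = 3, delta = guess_delta, accepting = {}\<rparr>"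

lemma guess_simps [simp]: "num_tapes guess = 2" "num_states guess = 2" "num_syms guess = 3"
  by (simp_all add: guess_def)

lemma wf_tm_guess: "wf_tm guess"
proof -
  have l: "length rs = 2 \<longleftrightarrow> (\<exists>a b. rs = [a, b])" for rs :: "nat list"
    by (auto simp: numeral_2_eq_2 length_Suc_conv)
  have "\<forall>q < 2. \<forall>rs. length rs = 2 \<and> set rs \<subseteq> {..<3} \<longrightarrow>
    distinct (guess_delta q rs) \<and> (\<forall>(q', ws) \<in> set (guess_delta q rs).
      q' < 2 \<and> length ws = 2 \<and> fst ` set ws \<subseteq> {..<3})"
    unfolding l by (auto split: if_splits)
  then show ?thesis
    unfolding wf_tm_def by (simp add: guess_def)
qed

lemma moves_guess: "moves guess (s, [ta, tb]) = guess_delta s [scanned ta, scanned tb]"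
  by (simp add: moves_def guess_def)

lemma halted_guess: "halted guess (1, [ta, tb])"
  by (simp add: halted_def moves_guess)

lemmas halted_guess' [simp] = halted_guess[unfolded One_nat_def]

lemma write_move_sym:
  "write_move (1, Right_Move) (tape_of u []) = tape_of (u @ [False]) []"
  "write_move (2, Right_Move) (tape_of u []) = tape_of (u @ [True]) []"
  using write_move_append[of False u] write_move_append[of True u] by (simp_all add: bit_sym_def)

lemmas write_move_sym' = write_move_sym[unfolded One_nat_def]

text \<open>Choice \<open>0\<close> ends the guess, so that deterministic steps and the end of the guess are the
  choices \<open>0\<close> and the guessed bits are the only other choices of an accepting path.\<close>

definition guess_choice :: "bool \<Rightarrow> nat" where
  "guess_choice b = (if b then 2 else 1)"

text \<open>The halting paths correspond to the strings \<open>z\<close> that fit into the clock;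
  shorter ones arise by stopping before it has run out. Each \<open>z\<close> has one path, which
  spells it.\<close>

lemma run_guess_iff:
  "run guess (0, [tape_of u v, tape_of w []]) cs = Some c \<and> halted guess c \<longleftrightarrow>
   (\<exists>z. length z \<le> length v \<and> cs = map guess_choice z @ [0] \<and>
      c = (1, [tape_of (u @ take (length z) v) (drop (length z) v), tape_of (w @ z) []]))"
proof (induction v arbitrary: u w cs)
  case Nil
  let ?c = "(0, [tape_of u [], tape_of w []])"
  have m: "moves guess ?c = [(1, [(0, No_Move), (0, No_Move)])]" by (simp add: moves_guess)
  have nh: "\<not> halted guess ?c" by (simp add: halted_def m)
  show ?case
  proof (cases cs)
    case Nil
    then show ?thesis using nh by auto
  next
    case (Cons i ds)
    have "run guess ?c cs = (if i = 0 then run guess (1, [tape_of u [], tape_of w []]) ds else None)"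
      using Cons m by simp
    then have "run guess ?c cs = Some c \<and> halted guess c \<longleftrightarrow> i = 0 \<and> ds = [] \<and> c = (1, [tape_of u [], tape_of w []])"
      using run_halted_iff[OF halted_guess, of _ _ ds c] by (cases "i = 0") simp_all
    moreover have "(\<exists>z. length z \<le> length [] \<and> cs = map guess_choice z @ [0] \<and>
      c = (1, [tape_of (u @ take (length z) []) (drop (length z) []), tape_of (w @ z) []])) \<longleftrightarrow>
      cs = [0] \<and> c = (1, [tape_of u [], tape_of w []])" by simp
    ultimately show ?thesis unfolding Cons by simp
  qed
next
  case (Cons a v)
  let ?c = "(0, [tape_of u (a # v), tape_of w []])"
  have m: "moves guess ?c = [(1, [(bit_sym a, No_Move), (0, No_Move)]), (0, [(bit_sym a, Right_Move), (1, Right_Move)]),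
          (0, [(bit_sym a, Right_Move), (2, Right_Move)])]" by (simp add: moves_guess)
  have nh: "\<not> halted guess ?c" by (simp add: halted_def m)
  show ?case
  proof (cases cs)
    case Nil
    then show ?thesis using nh by auto
  next
    case c: (Cons i ds)
    consider "i = 0" | b where "i = guess_choice b" | "i \<ge> 3"
    proof -
      have "i = 0 \<or> i = guess_choice False \<or> i = guess_choice True \<or> i \<ge> 3"
        by (auto simp: guess_choice_def)
      then show ?thesis using that by blast
    qed
    then show ?thesis
    proof cases
      case 1
      have r: "run guess ?c cs = run guess (1, [tape_of u (a # v), tape_of w []]) ds"
        using c 1 m by simp
      have "(\<exists>z. length z \<le> length (a # v) \<and> cs = map guess_choice z @ [0] \<and> P z) \<longleftrightarrow> ds = [] \<and> P []" for P
      proof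
        assume "\<exists>z. length z \<le> length (a # v) \<and> cs = map guess_choice z @ [0] \<and> P z"
        then obtain z where z: "cs = map guess_choice z @ [0]" "P z" by blast
        have "z = []"
        proof (cases z)
          case (Cons b z')
          then have "guess_choice b = 0" using z(1) c 1 by simp
          then show ?thesis by (simp add: guess_choice_def split: if_splits)
        qed
        then show "ds = [] \<and> P []" using z c by simp
      next
        assume "ds = [] \<and> P []"
        then show "\<exists>z. length z \<le> length (a # v) \<and> cs = map guess_choice z @ [0] \<and> P z"
          using c 1 by (intro exI[of _ "[]"]) simp
      qed
      from this[of "\<lambda>z. c = (1, [tape_of (u @ take (length z) (a # v)) (drop (length z) (a # v)), tape_of (w @ z) []])"]
      show ?thesis
        unfolding r run_halted_iff[OF halted_guess] by simp
    next
      case (2 b)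
      have r: "run guess ?c cs = run guess (0, [tape_of (u @ [a]) v, tape_of (w @ [b]) []]) ds"
      proof -
        let ?a = "(0, [(bit_sym a, Right_Move), (guess_choice b, Right_Move)])"
        have "i < length (moves guess ?c)" "moves guess ?c ! i = ?a"
          unfolding m 2 by (simp_all add: guess_choice_def)
        moreover have "apply_action ?a ?c = (0, [tape_of (u @ [a]) v, tape_of (w @ [b]) []])"
          by (simp add: guess_choice_def write_move_sym')
        ultimately show ?thesis unfolding c by simp
      qed
      have "(\<exists>z. length z \<le> length (a # v) \<and> cs = map guess_choice z @ [0] \<and> P z) \<longleftrightarrow>
        (\<exists>z. length z \<le> length v \<and> ds = map guess_choice z @ [0] \<and> P (b # z))" (is "?L \<longleftrightarrow> ?R") for P
      proof
        assume ?L
        then obtain z where z: "length z \<le> length (a # v)" "cs = map guess_choice z @ [0]" "P z" by blast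
        obtain b' z' where z': "z = b' # z'"
        proof (cases z)
          case Nil
          then have "guess_choice b = 0" using z(2) c 2 by simp
          then show ?thesis by (simp add: guess_choice_def split: if_splits)
        qed
        have "guess_choice b' = guess_choice b" using z(2) z' c 2 by simp
        then have "b' = b" by (simp add: guess_choice_def split: if_splits)
        then show ?R using z z' c by (intro exI[of _ z']) simp
      next
        assume ?R
        then obtain z where "length z \<le> length v" "ds = map guess_choice z @ [0]" "P (b # z)" by blast
        then show ?L using c 2 by (intro exI[of _ "b # z"]) simp
      qed
      note e = this[of "\<lambda>z. c = (1, [tape_of (u @ take (length z) (a # v)) (drop (length z) (a # v)), tape_of (w @ z) []])"]
      show ?thesis unfolding r Cons.IH e by simp
    next
      case 3
      have r: "run guess ?c cs = None"
        using c 3 m by simp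
      have "cs \<noteq> map guess_choice z @ [0]" for z
        using c 3 by (cases z) (auto simp: guess_choice_def)
      then show ?thesis unfolding r by simp
    qed
  qed
qed

text \<open>State \<open>0\<close> consumes a cell of the clock per step until it stops; in any
  other state there are no moves.\<close>

lemma run_guess_time:
  "run guess (q, [tape_of u v, tape_of w []]) cs \<noteq> None \<Longrightarrow> length cs \<le> (if q = 0 then length v + 1 else 0)"
proof (induction cs arbitrary: q u v w)
  case (Cons i cs)
  have q: "q = 0" using Cons.prems by (rule_tac ccontr) (simp add: moves_guess)
  show ?case
  proof (cases v)
    case Nil
    then show ?thesis using Cons.prems Cons.IH[of 1 u "[]" w] q by (simp add: moves_guess split: if_splits)
  next
    case v: (Cons a v')
    have "i = 0 \<or> i = 1 \<or> i = 2" using Cons.prems q v by (auto simp: moves_guess split: if_splits)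
    then show ?thesis
      using Cons.prems Cons.IH[of 1 u v w] Cons.IH[of 0 "u @ [a]" v' "w @ [False]"] Cons.IH[of 0 "u @ [a]" v' "w @ [True]"] q v
      by (elim disjE) (simp_all add: moves_guess write_move_sym')
  qed
qed simp

section \<open>Decoding the guessed string from an encoded path\<close>

definition guessed_st :: transitions where
  "guessed_st s a b = (case a of None \<Rightarrow> (0, None)
     | Some c \<Rightarrow> if c then (min (s + 1) 3, None)
         else (0, if s = 1 then Some False else if s = 2 then Some True else None))"

definition guessed :: "bstring \<Rightarrow> bstring" where
  "guessed w = transduce guessed_st (\<lambda>_. None) 0 w []"

definition choice_bits :: "nat \<Rightarrow> bstring" where
  "choice_bits i = (if i = 1 then [False] else if i = 2 then [True] else [])"

text \<open>The state counts the ones of the current unary choice. It saturates at \<open>3\<close>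
  because only the choices \<open>1\<close> and \<open>2\<close> carry a bit, so four states suffice
  for arbitrarily large choices.\<close>

lemma transduce_guessed:
  "s \<le> 3 \<Longrightarrow> transduce guessed_st (\<lambda>_. None) s (replicate i True @ False # r) [] =
     choice_bits (min (s + i) 3) @ transduce guessed_st (\<lambda>_. None) 0 r []"
proof (induction i arbitrary: s)
  case 0
  then show ?case by (auto simp: guessed_st_def choice_bits_def)
next
  case (Suc i)
  have st: "guessed_st s (Some True) None = (min (s + 1) 3, None)" by (simp add: guessed_st_def)
  have "min (s + 1) 3 \<le> 3" by simp
  from Suc.IH[OF this] have "transduce guessed_st (\<lambda>_. None) s (replicate (Suc i) True @ False # r) [] =
     choice_bits (min (min (s + 1) 3 + i) 3) @ transduce guessed_st (\<lambda>_. None) 0 r []"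
    by (simp only: replicate_Suc append_Cons transduce.simps st) simp
  moreover have "min (min (s + 1) 3 + i) 3 = min (s + Suc i) 3" by simp
  ultimately show ?case by simp
qed

lemma guessed_encode: "guessed (encode_choices cs) = concat (map choice_bits cs)"
proof (induction cs)
  case Nil
  then show ?case by (simp add: guessed_def)
next
  case (Cons i cs)
  have "choice_bits (min i 3) = choice_bits i" by (auto simp: choice_bits_def min_def)
  then show ?case using Cons transduce_guessed[of 0 i "encode_choices cs"] by (simp add: guessed_def)
qed

lemma guessed_FP: "guessed \<in> FP"
proof -
  have "computable 1 (\<lambda>xs. transduce guessed_st (\<lambda>_. None) 0 (xs ! 0) [])"
    by (rule computable_transduce1[of 4]) (auto simp: guessed_st_def split: option.split intro: computable_nth)
  from FP_I[OF this] show ?thesis unfolding guessed_def[abs_def] by simp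
qed

text \<open>All choices around the guess are \<open>0\<close> and decode to nothing, so the decoding
  is independent of the lengths of the deterministic stages.\<close>

lemma guessed_guess:
  "guessed (encode_choices (replicate k 0 @ 0 # (map guess_choice z @ [0]) @ 0 # replicate l 0)) = z"
proof -
  have "concat (map choice_bits (map guess_choice z)) = z"
    by (induction z) (auto simp: guess_choice_def choice_bits_def)
  then show ?thesis unfolding guessed_encode by (simp add: choice_bits_def)
qed

lemma image_Setcompr: "h ` {F z | z. P z} = {h (F z) | z. P z}"
  by blast

text \<open>The bridge from relations to paths. A clock of length \<open>poly p (length x)\<close>
  is computed, a string is guessed against it, rewound and verified, and the verdict is turned into
  a state. Guessing is the only source of nondeterminism, so accepting paths correspond to
  witnesses: a bound on the witnesses bounds the paths, and each accepting path decodes to a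
  witness.\<close>

lemma guess_verify:
  fixes R :: "bstring \<Rightarrow> bstring \<Rightarrow> bool" and p r :: "nat poly"
  assumes R: "decidable 2 (\<lambda>xs. R (xs ! 0) (xs ! 1))"
    and short: "\<And>x w. R x w \<Longrightarrow> length w \<le> poly p (length x)"
    and few: "\<And>x. finite {w. R x w} \<and> card {w. R x w} \<le> poly r (length x)"
  shows "\<exists>N. FewP_machine N \<and> lang N = {x. \<exists>w. R x w} \<and>
    (\<forall>x \<pi>. \<pi> \<in> acc N x \<longrightarrow> R x (guessed \<pi>))"
proof -
  obtain g where g: "computable 1 g" "\<forall>x. length (g [x]) = poly p (length x)"
    using computable_length_poly by blast
  obtain Kb Sb Mb pb where "implements Kb Sb Mb pb 1 g" using g(1) unfolding computable_def by blast
  note b = implementsD[OF this]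
  obtain Kr Sr Mr pr where "implements Kr Sr Mr pr 2 (\<lambda>xs. [R (xs ! 0) (xs ! 1)])"
    using R unfolding decidable_def computable_def by blast
  note r = implementsD[OF this]
  define S where "S = max Sb Sr"
  have S: "3 \<le> S" "Sb \<le> S" "Sr \<le> S"
    using b(3) by (auto simp: S_def)
  \<comment> \<open>Tape \<open>0\<close> is the input, \<open>1\<close> the clock, \<open>2\<close>
    the guess and \<open>F\<close> the verdict. The \<open>jb\<close> tapes between \<open>2\<close>
    and \<open>F\<close> are scratch for the clock, the \<open>jr\<close> tapes behind
    \<open>F\<close> for the verifier.\<close>
  define jb jr where "jb = Kb - 2" and "jr = Kr - 3"
  define F K where "F = 3 + jb" and "K = 4 + jb + jr"
  define posb where "posb = [0, 1] @ [3 + 0..<3 + 0 + jb]"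
  define posr where "posr = [0, 2, F] @ [4 + jb + 0..<4 + jb + 0 + jr]"
  have plb: "placement posb Kb K" unfolding posb_def
    by (rule placement_append) (use b(2) in \<open>auto simp: jb_def K_def\<close>)
  have plr: "placement posr Kr K" unfolding posr_def
    by (rule placement_append) (use r(2) in \<open>auto simp: jr_def K_def F_def\<close>)
  have plg: "placement [1, 2] 2 K" by (simp add: placement_def K_def)
  have FK: "F < K" by (simp add: F_def K_def)
  have K2: "2 < K" by (simp add: K_def)
  let ?B = "lift Mb K S posb" let ?G = "lift guess K S [1, 2]" let ?W = "lift (rewind False) K S [2]"
  let ?V = "lift Mr K S posr" let ?T = "lift test K S [F]"
  have B: "prog K S ?B" by (rule prog_lift[OF b(1) plb S(2)])
  have W: "prog K S ?W" by (rule prog_lift[OF prog_rewind placement_single[OF K2] S(1)])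
  have V: "prog K S ?V" by (rule prog_lift[OF r(1) plr S(3)])
  have T: "prog K S ?T" by (rule prog_lift[OF prog_test placement_single[OF FK] S(1)])
  have G: "wf_tm ?G" by (rule wf_tm_lift[OF wf_tm_guess]) (use plg S in auto)
  define D where "D = seq idle ?W (seq idle ?V ?T)"
  have D: "prog K S D" unfolding D_def by (intro prog_seq W V T good_link_idle)
  define GD where "GD = seq idle ?G D"
  have GD: "wf_tm GD" unfolding GD_def
    by (rule wf_tm_seq) (use G D in \<open>auto simp: seq_ok_def prog_def\<close>)
  define N where "N = seq idle ?B GD"
  have wfN: "wf_tm N" unfolding N_def
    by (rule wf_tm_seq) (use B GD in \<open>auto simp: seq_ok_def prog_def GD_def\<close>)
  have KN: "num_tapes N = K" by (simp add: N_def)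
  have accN: "accepting N = (\<lambda>q. num_states Mb + (2 + q)) ` accepting D"
    by (auto simp: N_def GD_def image_iff)
  \<comment> \<open>The verifier reads the input and a guess of at most
    \<open>poly p (length x)\<close> letters. The constants in \<open>t\<close> pay for ending the
    guess, rewinding it, the final test and the links.\<close>
  define P where "P = pcompose pr ([:0, 1:] + p)"
  define t where "t = pb + (p + 1 + (p + 2 + (P + 2) + 1) + 1) + 1"
  \<comment> \<open>\<open>\<kappa>\<close> takes \<open>z\<close> as argument since the
    verification time may vary with the guess; \<open>k\<close> does not, since the clock is
    complete before the guess begins.\<close>
  have main: "time_le N (tapes_of K [x]) (poly t (length x)) \<and>
      (\<exists>k \<kappa>. {cs. \<exists>q ts. (cs, q, ts) \<in> outcomes N (tapes_of K [x]) \<and> q \<in> accepting N} =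
         (\<lambda>z. replicate k 0 @ 0 # (map guess_choice z @ [0]) @ 0 # replicate (\<kappa> z) 0) ` {z. R x z})" for x
  proof -
    let ?n = "length x"
    let ?ts0 = "tapes_of K [x]"
    have ts0: "?ts0 ! i = string_tape (if i = 0 then x else [])" if "i < K" for i
      using that by (simp add: nth_tapes_of)
    have leg0: "legal K S ?ts0" using K2 S by (intro legal_tapes_of) auto
    have pb': "posb ! i = (if i = 0 then 0 else if i = 1 then 1 else i + 1)" if "i < Kb" for i
      using that by (auto simp: posb_def nth_append nth_Cons' jb_def)
    have pr': "posr ! i = (if i = 0 then 0 else if i = 1 then 2 else if i = 2 then F else i + 1 + jb)" if "i < Kr" for i
      using that by (auto simp: posr_def nth_append nth_Cons' jr_def)
    have "\<exists>q ts. yields Mb (tapes_of Kb [x]) (poly pb ?n) q ts \<and> ts ! 0 = string_tape x \<and> ts ! 1 = string_tape (g [x])"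
      using b(4)[of "[x]"] by auto
    then obtain qb us where us: "yields Mb (tapes_of Kb [x]) (poly pb ?n) qb us" "us ! 0 = string_tape x" "us ! 1 = string_tape (g [x])"
      by blast
    have "?ts0 ! (posb ! i) = string_tape (if i < length [x] then [x] ! i else [])" if "i < Kb" for i
      using that placement_nth[OF plb that] by (simp add: ts0 pb')
    from yields_placed[OF b(1) plb S(2) leg0 us(1) _ this]
    obtain ts1 where Yb: "yields ?B ?ts0 (poly pb ?n) qb ts1" and leg1: "legal K S ts1"
      and n1: "\<forall>i < Kb. ts1 ! (posb ! i) = us ! i" "\<forall>j < K. j \<notin> set posb \<longrightarrow> ts1 ! j = ?ts0 ! j"
      using b(2) by auto
    have len1: "length ts1 = K" using leg1 by (simp add: legal_def)
    have ts1_0: "ts1 ! 0 = string_tape x" using n1(1)[rule_format, of 0] pb'[of 0] b(2) us by simp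
    have ts1_1: "ts1 ! 1 = tape_of [] (g [x])" using n1(1)[rule_format, of 1] pb'[of 1] b(2) us by (simp add: string_tape_tape_of)
    have ts1_blank: "ts1 ! i = string_tape []" if "i = 2 \<or> F \<le> i" "i < K" for i
    proof -
      have "i \<notin> set posb" using that by (auto simp: posb_def F_def)
      then show ?thesis using n1(2) ts0[of i] that by (auto simp: F_def)
    qed
    have sg: "sel [1, 2] ts1 = [tape_of [] (g [x]), tape_of [] []]"
      using ts1_1 ts1_blank[of 2] K2 by (simp add: sel_def string_tape_tape_of)
    have okg: "okc guess (0, sel [1, 2] ts1)"
      unfolding sg by (simp add: okc_def)
    have plg1: "placement [1, 2] (num_tapes guess) (length ts1)" using plg len1 by simp
    define gs where "gs z = [tape_of (take (length z) (g [x])) (drop (length z) (g [x])), tape_of z []]" for z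
    define ts2 where "ts2 z = upd [1, 2] ts1 (gs z)" for z
    have outg: "outcomes ?G ts1 = {(map guess_choice z @ [0], 1, ts2 z) | z. length z \<le> poly p ?n}"
    proof -
      have "outcomes guess (sel [1, 2] ts1) =
        {(map guess_choice z @ [0], 1, gs z) | z.
           length z \<le> poly p ?n}"
        unfolding sg outcomes_def gs_def using run_guess_iff[of "[]" "g [x]" "[]"] g(2) by auto
      then show ?thesis
        unfolding outcomes_lift[OF wf_tm_guess okg plg1] ts2_def by (simp add: image_Setcompr)
    qed
    have timeg: "time_le ?G ts1 (poly p ?n + 1)"
    proof (rule time_le_lift[OF wf_tm_guess okg plg1])
      show "time_le guess (sel [1, 2] ts1) (poly p ?n + 1)"
        unfolding sg time_le_def using run_guess_time[of 0 "[]" "g [x]" "[]"] g(2) by auto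
    qed
    have okG: "okc ?G (0, ts1)" using leg1 by (auto simp: okc_def legal_def)
    define tD where "tD = poly p ?n + 2 + (poly P ?n + 2) + 1"
    have YD: "\<exists>q ts. yields D (ts2 z) tD q ts \<and> (q \<in> accepting D \<longleftrightarrow> R x z)" if z: "length z \<le> poly p ?n" for z
    proof -
      have len2: "length (ts2 z) = K" using len1 by (simp add: ts2_def)
      have "length (gs z) = 2" by (simp add: gs_def)
      note n2 = nth_upd[of "[1, 2]" 2 ts1, folded ts2_def, unfolded len1, OF plg this, folded ts2_def]
      have ts2_w: "ts2 z ! 2 = tape_of z []" using n2(1)[of 1] by (simp add: gs_def)
      have ts2_same: "ts2 z ! i = ts1 ! i" if "i < K" "i \<noteq> 1" "i \<noteq> 2" for i using n2(2)[of i] that by simp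
      have leg2: "legal K S (ts2 z)"
      proof -
        have "set (ts2 z) \<subseteq> set ts1 \<union> set (gs z)"
          unfolding ts2_def by (rule set_upd_subset)
        moreover have "fst (tape_of u v) i < S" for u v i using S(1) by (rule less_le_trans[OF tape_of_less])
        then have "\<forall>u \<in> set (gs z). \<forall>i. fst u i < S"
          by (simp add: gs_def)
        ultimately show ?thesis using leg1 len2 unfolding legal_def by blast
      qed
      let ?ts3 = "(ts2 z)[2 := string_tape z]"
      have Y3: "yields ?W (ts2 z) (length z + 2) 2 ?ts3"
        using yields_rewind_at[of 2 "ts2 z" z K False S] ts2_w len2 K2 by simp
      have leg3: "legal K S ?ts3" using yields_legal[OF W leg2 Y3] .
      have len3: "length ?ts3 = K" using len2 by simp
      have "\<exists>q ts. yields Mr (tapes_of Kr [x, z]) (poly pr (?n + length z)) q ts \<and> ts ! 2 = string_tape [R x z]"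
        using r(4)[of "[x, z]"] by auto
      then obtain qr vs where vs: "yields Mr (tapes_of Kr [x, z]) (poly pr (?n + length z)) qr vs" "vs ! 2 = string_tape [R x z]"
        by blast
      have "?ts3 ! (posr ! i) = string_tape (if i < length [x, z] then [x, z] ! i else [])" if "i < Kr" for i
      proof (cases "i < 2")
        case True
        then have "i = 0 \<or> i = 1" by auto
        then show ?thesis using pr'[OF that] ts2_same[of 0] ts1_0 len2 K2 by auto
      next
        case False
        then have "F \<le> posr ! i" using pr'[OF that] by (auto simp: F_def)
        then show ?thesis
          using False placement_nth[OF plr that] ts2_same[of "posr ! i"] ts1_blank[of "posr ! i"] len2 by (simp add: F_def)
      qed
      from yields_placed[OF r(1) plr S(3) leg3 vs(1) _ this]
      obtain ts4 where Y4: "yields ?V ?ts3 (poly pr (?n + length z)) qr ts4" and leg4: "legal K S ts4"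
        and n4: "\<forall>i < Kr. ts4 ! (posr ! i) = vs ! i"
        using r(2) by auto
      have F4: "ts4 ! F = string_tape [R x z]"
        using n4[rule_format, of 2] pr'[of 2] r(2) vs(2) by simp
      have len4: "length ts4 = K" using leg4 by (simp add: legal_def)
      note Y5 = yields_test_at[OF FK len4 F4, of S]
      have Y45: "yields (seq idle ?V ?T) ?ts3 (poly pr (?n + length z) + 1 + 1) (num_states ?V + (if R x z then 1 else 2)) ts4"
        by (rule prog_yields_seq_idle[OF V len3 _ Y4 Y5]) (use leg3 in \<open>simp add: legal_def\<close>)
      have Y: "yields D (ts2 z) (length z + 2 + (poly pr (?n + length z) + 1 + 1) + 1)
          (num_states ?W + (num_states ?V + (if R x z then 1 else 2))) ts4"
        unfolding D_def by (rule prog_yields_seq_idle[OF W len2 _ Y3 Y45]) (use leg2 in \<open>simp add: legal_def\<close>)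
      have "poly pr (?n + length z) \<le> poly P ?n"
        unfolding P_def poly_pcompose using z by (intro poly_mono_nat) simp
      then have "yields D (ts2 z) tD (num_states ?W + (num_states ?V + (if R x z then 1 else 2))) ts4"
        using z by (intro yields_mono[OF Y]) (simp add: tD_def)
      moreover have "num_states ?W + (num_states ?V + (if R x z then 1 else 2)) \<in> accepting D \<longleftrightarrow> R x z"
        by (auto simp: D_def test_def image_iff)
      ultimately show ?thesis by blast
    qed
    have timeGD: "time_le GD ts1 (poly p ?n + 1 + tD + 1)"
      unfolding GD_def
    proof (rule time_le_seq[OF G okG timeg])
      fix cs1 q1 ts' assume "(cs1, q1, ts') \<in> outcomes ?G ts1"
      then obtain z where "length z \<le> poly p ?n" "ts' = ts2 z" unfolding outg by blast
      then show "time_le D (link idle q1 ts') tD" using YD[of z] unfolding link_idle yields_def by blast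
    qed
    obtain k where k: "outcomes ?B ?ts0 = {(replicate k 0, qb, ts1)}" and timeB: "time_le ?B ?ts0 (poly pb ?n)"
      using Yb unfolding yields_def by blast
    have okB: "okc ?B (0, ?ts0)" using prog_okc[OF B leg0] .
    have wfB: "wf_tm ?B" using B by (simp add: prog_def)
    have "time_le N ?ts0 (poly pb ?n + (poly p ?n + 1 + tD + 1) + 1)"
      unfolding N_def
    proof (rule time_le_seq[OF wfB okB timeB])
      fix cs1 q1 ts' assume "(cs1, q1, ts') \<in> outcomes ?B ?ts0"
      then have "ts' = ts1" unfolding k by simp
      then show "time_le GD (link idle q1 ts') (poly p ?n + 1 + tD + 1)"
        unfolding link_idle using timeGD by simp
    qed
    moreover have "poly pb ?n + (poly p ?n + 1 + tD + 1) + 1 = poly t ?n"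
      by (simp add: t_def tD_def)
    ultimately have time: "time_le N ?ts0 (poly t ?n)" by simp
    have "\<forall>z. \<exists>l. length z \<le> poly p ?n \<longrightarrow> (\<exists>q ts. outcomes D (ts2 z) = {(replicate l 0, q, ts)} \<and> (q \<in> accepting D \<longleftrightarrow> R x z))"
      using YD unfolding yields_def by blast
    from choice[OF this] obtain \<kappa> where
      \<kappa>: "\<And>z. length z \<le> poly p ?n \<Longrightarrow> \<exists>q ts. outcomes D (ts2 z) = {(replicate (\<kappa> z) 0, q, ts)} \<and> (q \<in> accepting D \<longleftrightarrow> R x z)"
      by blast
    have outGD: "outcomes GD ts1 = {(cs1 @ 0 # cs2, num_states ?G + q2, ts2') | cs1 cs2 q1 q2 ts1' ts2'.
     (cs1, q1, ts1') \<in> outcomes ?G ts1 \<and> (cs2, q2, ts2') \<in> outcomes D ts1'}"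
      unfolding GD_def outcomes_seq[OF G okG] link_idle ..
    have outN: "outcomes N ?ts0 = {(replicate k 0 @ 0 # cs2, num_states ?B + q2, ts2') | cs2 q2 ts2'.
     (cs2, q2, ts2') \<in> outcomes GD ts1}"
      unfolding N_def outcomes_seq[OF wfB okB] link_idle k by blast
    have acc: "num_states ?B + (num_states ?G + q) \<in> accepting N \<longleftrightarrow> q \<in> accepting D" for q
      unfolding accN by auto
    have "{cs. \<exists>q ts. (cs, q, ts) \<in> outcomes N ?ts0 \<and> q \<in> accepting N} =
         (\<lambda>z. replicate k 0 @ 0 # (map guess_choice z @ [0]) @ 0 # replicate (\<kappa> z) 0) ` {z. R x z}" (is "?A = ?f ` _")
    proof (intro set_eqI iffI)
      fix cs assume "cs \<in> ?A"
      then obtain q ts where c: "(cs, q, ts) \<in> outcomes N ?ts0" "q \<in> accepting N" by blast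
      obtain cs2 q2 where c2: "cs = replicate k 0 @ 0 # cs2" "q = num_states ?B + q2" "(cs2, q2, ts) \<in> outcomes GD ts1"
        using c(1) unfolding outN by blast
      obtain cs3 cs4 q3 q4 ts3 where c3: "cs2 = cs3 @ 0 # cs4" "q2 = num_states ?G + q4"
        "(cs3, q3, ts3) \<in> outcomes ?G ts1" "(cs4, q4, ts) \<in> outcomes D ts3"
        using c2(3) unfolding outGD by blast
      obtain z where z: "length z \<le> poly p ?n" "cs3 = map guess_choice z @ [0]" "ts3 = ts2 z"
        using c3(3) unfolding outg by blast
      obtain q' ts' where o: "outcomes D (ts2 z) = {(replicate (\<kappa> z) 0, q', ts')}" "q' \<in> accepting D \<longleftrightarrow> R x z"
        using \<kappa>[OF z(1)] by blast
      have "cs4 = replicate (\<kappa> z) 0" "q4 = q'" using c3(4) o(1) z(3) by auto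
      moreover have "q4 \<in> accepting D" using c(2) unfolding c2(2) c3(2) acc .
      ultimately have "R x z" "cs = ?f z" using o(2) c2(1) c3(1) z(2) by auto
      then show "cs \<in> ?f ` {z. R x z}" by blast
    next
      fix cs assume "cs \<in> ?f ` {z. R x z}"
      then obtain z where z: "R x z" "cs = ?f z" by blast
      \<comment> \<open>Here the clock proves long enough: no witness is missed.\<close>
      have lz: "length z \<le> poly p ?n" using short[OF z(1)] .
      obtain q' ts' where o: "outcomes D (ts2 z) = {(replicate (\<kappa> z) 0, q', ts')}" "q' \<in> accepting D \<longleftrightarrow> R x z"
        using \<kappa>[OF lz] by blast
      have "(map guess_choice z @ [0], 1, ts2 z) \<in> outcomes ?G ts1" unfolding outg using lz by blast
      moreover have "(replicate (\<kappa> z) 0, q', ts') \<in> outcomes D (ts2 z)" using o(1) by simp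
      ultimately have "((map guess_choice z @ [0]) @ 0 # replicate (\<kappa> z) 0, num_states ?G + q', ts') \<in> outcomes GD ts1"
        unfolding outGD by blast
      then have "(?f z, num_states ?B + (num_states ?G + q'), ts') \<in> outcomes N ?ts0"
        unfolding outN by blast
      moreover have "num_states ?B + (num_states ?G + q') \<in> accepting N" unfolding acc using o(2) z(1) by simp
      ultimately show "cs \<in> ?A" using z(2) by blast
    qed
    then show ?thesis using time by blast
  qed
  \<comment> \<open>\<open>h\<close> sends a witness to its encoded path, and \<open>guessed\<close>
    is a left inverse of it.\<close>
  have acc: "\<exists>h. acc N x = h ` {z. R x z} \<and> (\<forall>z. guessed (h z) = z)" for x
  proof -
    obtain k \<kappa> where e: "{cs. \<exists>q ts. (cs, q, ts) \<in> outcomes N (tapes_of K [x]) \<and> q \<in> accepting N} =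
         (\<lambda>z. replicate k 0 @ 0 # (map guess_choice z @ [0]) @ 0 # replicate (\<kappa> z) 0) ` {z. R x z}"
      using main[of x] by blast
    have "acc_choices N x = {cs. \<exists>q ts. (cs, q, ts) \<in> outcomes N (tapes_of K [x]) \<and> q \<in> accepting N}"
      unfolding acc_choices_def outcomes_def init_config_tapes_of KN by auto
    then have "acc N x = (\<lambda>z. encode_choices (replicate k 0 @ 0 # (map guess_choice z @ [0]) @ 0 # replicate (\<kappa> z) 0)) ` {z. R x z}"
      unfolding acc_def e by (simp only: image_image)
    then show ?thesis
      by (intro exI[of _ "\<lambda>z. encode_choices (replicate k 0 @ 0 # (map guess_choice z @ [0]) @ 0 # replicate (\<kappa> z) 0)"]
        conjI allI guessed_guess)
  qed
  show ?thesis
  proof (intro exI conjI allI impI)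
    have "NPM N"
      unfolding NPM_def init_config_tapes_of KN
      using wfN main unfolding time_le_def by blast
    moreover have "finite (acc N x) \<and> card (acc N x) \<le> poly r (length x)" for x
    proof -
      obtain h where h: "acc N x = h ` {z. R x z}" using acc[of x] by blast
      then show ?thesis using few[of x] card_image_le[of "{z. R x z}" h] by auto
    qed
    ultimately show "FewP_machine N" unfolding FewP_machine_def by blast
    show "lang N = {x. \<exists>w. R x w}"
    proof (rule set_eqI)
      fix x
      obtain h where h: "acc N x = h ` {z. R x z}" using acc[of x] by blast
      then show "x \<in> lang N \<longleftrightarrow> x \<in> {x. \<exists>w. R x w}" by (simp add: lang_def)
    qed
    show "R x (guessed \<pi>)" if \<pi>: "\<pi> \<in> acc N x" for x \<pi>
    proof -
      obtain h where h: "acc N x = h ` {z. R x z}" "\<forall>z. guessed (h z) = z" using acc[of x] by blast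
      then show ?thesis using \<pi> by auto
    qed
  qed
qed

text \<open>A choice \<open>i\<close> is smaller than the number of moves, so its
  \<open>i + 1\<close> bits are at most \<open>B\<close>.\<close>

lemma run_choices_less:
  assumes "wf_tm N" "\<And>c. okc N c \<Longrightarrow> length (moves N c) \<le> B"
  shows "okc N c \<Longrightarrow> run N c cs \<noteq> None \<Longrightarrow> length (encode_choices cs) \<le> B * length cs"
proof (induction cs arbitrary: c)
  case (Cons i cs)
  have i: "i < length (moves N c)" and r: "run N (apply_action (moves N c ! i) c) cs \<noteq> None"
    using Cons.prems(2) by (auto split: if_splits)
  have "okc N (apply_action (moves N c ! i) c)"
    using okc_apply_action[OF assms(1) Cons.prems(1)] i by simp
  from Cons.IH[OF this r] show ?case using i assms(2)[OF Cons.prems(1)] by simp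
qed simp

text \<open>Accepting paths thereby qualify as witnesses for \<open>guess_verify\<close>, and the
  one-way function built from them becomes honest.\<close>

lemma acc_length_bounded:
  assumes "NPM N"
  obtains p :: "nat poly" where "\<And>x \<pi>. \<pi> \<in> acc N x \<Longrightarrow> length \<pi> \<le> poly p (length x)"
proof -
  have wf: "wf_tm N" using assms by (simp add: NPM_def)
  obtain B where B: "\<And>c. okc N c \<Longrightarrow> length (moves N c) \<le> B" using moves_bounded[OF wf] by blast
  obtain p :: "nat poly" where p: "\<forall>x cs. run N (init_config N x) cs \<noteq> None \<longrightarrow> length cs \<le> poly p (length x)"
    using assms by (auto simp: NPM_def)
  have "length \<pi> \<le> poly (smult B p) (length x)" if \<pi>: "\<pi> \<in> acc N x" for x \<pi>
  proof -
    obtain cs c where "\<pi> = encode_choices cs" "run N (init_config N x) cs = Some c"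
      using \<pi> unfolding acc_iff accepts_from_def by blast
    then have cs: "\<pi> = encode_choices cs" "run N (init_config N x) cs \<noteq> None" by simp_all
    have "okc N (init_config N x)"
      using okc_tapes_of[OF wf, of "[x]"] wf by (simp add: init_config_tapes_of wf_tm_def)
    from run_choices_less[OF wf B this cs(2)] have "length \<pi> \<le> B * length cs" unfolding cs(1) by simp
    also have "\<dots> \<le> B * poly p (length x)" using p cs(2) by (intro mult_le_mono2) blast
    finally show ?thesis by simp
  qed
  then show ?thesis by (rule that)
qed

section \<open>Closure of P, and inclusions between the classes\<close>

lemma finite_PTIME:
  assumes "finite L"
  shows "L \<in> PTIME"
proof (rule PTIME_I)
  show "decidable 1 (\<lambda>xs. xs ! 0 \<in> L)"
    using assms
  proof (induction L rule: finite_induct)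
    case empty
    show ?case using computable_const[of 1 "[False]"] by (simp add: decidable_def)
  next
    case (insert w L)
    have "decidable 1 (\<lambda>xs. xs ! 0 = w \<or> xs ! 0 \<in> L)"
      by (rule decidable_or[OF decidable_eq[OF computable_nth computable_const] insert.IH]) auto
    then show ?case by simp
  qed
qed

lemma UNIV_PTIME: "UNIV \<in> PTIME"
  using computable_const[of 1 "[True]"] by (intro PTIME_I) (simp add: decidable_def)

lemma Compl_PTIME:
  assumes "L \<in> PTIME"
  shows "- L \<in> PTIME"
proof (rule PTIME_I)
  have "decidable 1 (\<lambda>xs. \<not> xs ! 0 \<in> L)"
    by (intro decidable_not decidable_PTIME[OF assms] computable_nth) simp
  then show "decidable 1 (\<lambda>xs. xs ! 0 \<in> - L)" by simp
qed

text \<open>A deterministic machine has a single halting path on each input, so the constant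
  polynomial \<open>1\<close> bounds the accepting ones.\<close>

lemma PTIME_subset_FewP: "PTIME \<subseteq> FewP"
proof
  fix L assume "L \<in> PTIME"
  then obtain M where M: "NPM M" "deterministic M" "L = lang M" unfolding PTIME_def by blast
  obtain p :: "nat poly" where p: "\<And>x. \<exists>q ts. yields M (tapes_of (num_tapes M) [x]) (poly p (length x)) q ts"
    using yields_NPM_deterministic[OF M(1,2)] by blast
  have "finite (acc M x) \<and> card (acc M x) \<le> poly 1 (length x)" for x
  proof -
    obtain k q ts where "outcomes M (tapes_of (num_tapes M) [x]) = {(replicate k 0, q, ts)}"
      using p[of x] unfolding yields_def by blast
    then have "acc_choices M x \<subseteq> {replicate k 0}"
      unfolding acc_choices_def outcomes_def init_config_tapes_of by auto
    then have sub: "acc M x \<subseteq> {encode_choices (replicate k 0)}" unfolding acc_def by blast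
    then have "card (acc M x) \<le> card {encode_choices (replicate k 0)}" by (intro card_mono) auto
    then show ?thesis using finite_subset[OF sub] by simp
  qed
  then show "L \<in> FewP" unfolding FewP_def FewP_machine_def using M by blast
qed

text \<open>A selector \<open>f\<close> for some machine \<open>N\<close> of \<open>L\<close>
  decides \<open>L\<close>: test whether \<open>f x\<close> is an accepting path on
  \<open>x\<close>. Outside \<open>L\<close> there is none that it could hit by accident.\<close>

lemma Easy_subset_PTIME: "Easy_FewP \<subseteq> PTIME"
proof
  fix L assume L: "L \<in> Easy_FewP"
  show "L \<in> PTIME"
  proof (cases "finite L")
    case True
    then show ?thesis by (rule finite_PTIME)
  next
    case False
    then have "L \<in> FewP" and e: "\<forall>N. FewP_machine N \<and> lang N = L \<longrightarrow> (\<exists>f\<in>FP. \<forall>x\<in>L. f x \<in> acc N x)"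
      using L unfolding Easy_FewP_def by auto
    then obtain N where N: "FewP_machine N" "lang N = L" unfolding FewP_def by blast
    then obtain f where f: "f \<in> FP" "\<forall>x\<in>L. f x \<in> acc N x" using e by blast
    have wf: "wf_tm N" using N by (simp add: FewP_machine_def NPM_def)
    have n: "computable 1 (\<lambda>xs. xs ! 0)" by (rule computable_nth) simp
    have "x \<in> L \<longleftrightarrow> f x \<in> acc N x" for x
      using f(2) N(2) by (auto simp: lang_def)
    moreover have "decidable 1 (\<lambda>xs. f (xs ! 0) \<in> acc N (xs ! 0))"
      by (intro decidable_acc[OF wf] computable_FP[OF f(1)] n)
    ultimately show ?thesis by (intro PTIME_I) simp
  qed
qed

lemma FP_comp:
  assumes "f \<in> FP" "g \<in> FP"
  shows "(\<lambda>x. f (g x)) \<in> FP"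
proof -
  have "computable 1 (\<lambda>xs. f (g (xs ! 0)))"
    by (intro computable_FP[OF assms(1)] computable_FP[OF assms(2)] computable_nth) simp
  from FP_I[OF this] show ?thesis by simp
qed

text \<open>There are infinitely many strings, which excludes the finite case of
  \<open>Easy_FewP\<close> and makes its selectors available.\<close>

lemma Easy_UNIV_selector:
  assumes "UNIV \<in> Easy_FewP" "FewP_machine N" "lang N = UNIV"
  shows "\<exists>g\<in>FP. \<forall>x. g x \<in> acc N x"
proof -
  have "infinite (UNIV :: bstring set)" by (rule infinite_UNIV_listI)
  then show ?thesis using assms unfolding Easy_FewP_def by blast
qed

text \<open>A machine for \<open>L\<close> becomes one for all strings by accepting the complement of \<open>L\<close> on a
  single additional path.\<close>

lemma Easy_UNIV_imp_PTIME_subset: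
  assumes U: "UNIV \<in> Easy_FewP"
  shows "PTIME \<subseteq> Easy_FewP"
proof
  fix L assume L: "L \<in> PTIME"
  have "\<exists>f\<in>FP. \<forall>x\<in>L. f x \<in> acc N x" if N: "FewP_machine N" "lang N = L" for N
  proof -
    have wf: "wf_tm N" and npm: "NPM N" using N by (auto simp: FewP_machine_def NPM_def)
    obtain p :: "nat poly" where p: "\<And>x \<pi>. \<pi> \<in> acc N x \<Longrightarrow> length \<pi> \<le> poly p (length x)"
      using acc_length_bounded[OF npm] by blast
    obtain r :: "nat poly" where r: "\<forall>x. finite (acc N x) \<and> card (acc N x) \<le> poly r (length x)"
      using N unfolding FewP_machine_def by blast
    \<comment> \<open>Outside \<open>L\<close> the empty string is the only witness; inside
      \<open>L\<close> the witnesses are exactly the accepting paths of \<open>N\<close>.\<close>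
    let ?R = "\<lambda>x w. x \<notin> L \<and> w = [] \<or> w \<in> acc N x"
    have n0: "computable 2 (\<lambda>xs. xs ! 0)" and n1: "computable 2 (\<lambda>xs. xs ! 1)"
      by (simp_all add: computable_nth)
    have R: "decidable 2 (\<lambda>xs. ?R (xs ! 0) (xs ! 1))"
      by (intro decidable_or decidable_and decidable_not decidable_eq decidable_acc[OF wf]
          decidable_PTIME[OF L] computable_const n0 n1) simp
    have short: "length w \<le> poly p (length x)" if "?R x w" for x w
      using that p[of w x] by auto
    have few: "finite {w. ?R x w} \<and> card {w. ?R x w} \<le> poly (r + 1) (length x)" for x
    proof -
      have sub: "{w. ?R x w} \<subseteq> insert [] (acc N x)" by auto
      have fin: "finite (insert [] (acc N x))" using r by simp
      have "card {w. ?R x w} \<le> card (insert [] (acc N x))" by (rule card_mono[OF fin sub])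
      also have "\<dots> \<le> Suc (card (acc N x))" by (rule card_insert_le_m1) auto
      also have "\<dots> \<le> poly (r + 1) (length x)" using r by simp
      finally show ?thesis using finite_subset[OF sub fin] by simp
    qed
    have "\<exists>N'. FewP_machine N' \<and> lang N' = {x. \<exists>w. ?R x w} \<and> (\<forall>x \<pi>. \<pi> \<in> acc N' x \<longrightarrow> ?R x (guessed \<pi>))"
      by (rule guess_verify[where R = ?R, OF R _ few]) (rule short)
    then obtain N' where N': "FewP_machine N'" "lang N' = {x. \<exists>w. ?R x w}"
      and dec: "\<forall>x \<pi>. \<pi> \<in> acc N' x \<longrightarrow> ?R x (guessed \<pi>)"
      by (elim exE conjE)
    have "\<exists>w. ?R x w" for x using N(2) by (cases "x \<in> L") (auto simp: lang_def)
    then have "lang N' = UNIV" unfolding N'(2) by blast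
    then obtain g where g: "g \<in> FP" "\<forall>x. g x \<in> acc N' x"
      using Easy_UNIV_selector[OF U N'(1)] by blast
    \<comment> \<open>The witness decoded from a path of \<open>N'\<close> is itself an encoded path
      of \<open>N\<close>.\<close>
    have "\<forall>x\<in>L. guessed (g x) \<in> acc N x" using dec g(2) by blast
    then show ?thesis by (rule bexI[OF _ FP_comp[OF guessed_FP g(1)]])
  qed
  then show "L \<in> Easy_FewP" using L PTIME_subset_FewP unfolding Easy_FewP_def by blast
qed

lemma ptime_computable_dom: "ptime_computable f \<Longrightarrow> dom f \<in> PTIME"
  unfolding ptime_computable_def PTIME_def by blast

lemma id_FP: "(\<lambda>x. x) \<in> FP"
  using FP_I[OF computable_nth[of 0 1]] by simp

lemma one_way_imp_UNIV_notin_Easy: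
  assumes f: "poly_one_one_way f" and ran: "ran f \<in> PTIME"
  shows "UNIV \<notin> Easy_FewP"
proof
  assume U: "UNIV \<in> Easy_FewP"
  obtain p :: "nat poly" where p: "\<forall>x y. f x = Some y \<longrightarrow> length x \<le> poly p (length y)"
    using f unfolding poly_one_one_way_def honest_def by blast
  obtain r :: "nat poly" where r: "\<forall>y \<in> ran f. finite {x. f x = Some y} \<and> card {x. f x = Some y} \<le> poly r (length y)"
    using f unfolding poly_one_one_way_def poly_one_def by blast
  have pt: "ptime_computable f" and ninv: "\<not> FP_invertible f"
    using f unfolding poly_one_one_way_def by auto
  \<comment> \<open>A function with empty range is vacuously invertible, here by the identity, so a
    one-way function has some \<open>x0\<close> in its domain.\<close>
  have "dom f \<noteq> {}"
  proof
    assume "dom f = {}"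
    then have "ran f = {}" by (auto simp: ran_def)
    then have "FP_invertible f" using id_FP unfolding FP_invertible_def by blast
    with ninv show False ..
  qed
  then obtain x0 where x0: "x0 \<in> dom f" by blast
  let ?R = "\<lambda>y x. y \<notin> ran f \<and> x = [] \<or> f x = Some y"
  have n0: "computable 2 (\<lambda>xs. xs ! 0)" and n1: "computable 2 (\<lambda>xs. xs ! 1)"
    by (simp_all add: computable_nth)
  \<comment> \<open>The machine for \<open>f\<close> is trusted only on the domain, yet both sides
    of a conjunction are always computed. Elsewhere \<open>x0\<close> stands in, and the domain test
    discards the result.\<close>
  let ?z = "\<lambda>x. if x \<in> dom f then x else x0"
  have z: "computable 2 (\<lambda>xs. the (f (?z (xs ! 1))))"
    by (rule computable_partial[OF pt computable_if[OF decidable_PTIME[OF ptime_computable_dom[OF pt] n1] n1 computable_const]])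
      (use x0 in auto)
  have *: "decidable 2 (\<lambda>xs. xs ! 0 \<notin> ran f \<and> xs ! 1 = [] \<or> xs ! 1 \<in> dom f \<and> the (f (?z (xs ! 1))) = xs ! 0)"
    by (intro decidable_or decidable_and decidable_not decidable_eq z
          decidable_PTIME[OF ran] decidable_PTIME[OF ptime_computable_dom[OF pt]] computable_const n0 n1) simp
  have "x \<in> dom f \<and> the (f (?z x)) = y \<longleftrightarrow> f x = Some y" for x y by auto
  note R = *[unfolded this]
  have short: "length x \<le> poly p (length y)" if "?R y x" for x y
    using that p by auto
  have few: "finite {x. ?R y x} \<and> card {x. ?R y x} \<le> poly (r + 1) (length y)" for y
  proof (cases "y \<in> ran f")
    case True
    then have "{x. ?R y x} = {x. f x = Some y}" by blast
    then show ?thesis using r True by (simp add: le_SucI)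
  next
    case False
    then have "{x. ?R y x} = {[]}" by (auto simp: ran_def)
    then show ?thesis by simp
  qed
  have "\<exists>N. FewP_machine N \<and> lang N = {y. \<exists>x. ?R y x} \<and> (\<forall>y \<pi>. \<pi> \<in> acc N y \<longrightarrow> ?R y (guessed \<pi>))"
    by (rule guess_verify[where R = ?R, OF R _ few]) (rule short)
  then obtain N where N: "FewP_machine N" "lang N = {y. \<exists>x. ?R y x}"
    and dec: "\<forall>y \<pi>. \<pi> \<in> acc N y \<longrightarrow> ?R y (guessed \<pi>)"
    by (elim exE conjE)
  have "\<exists>x. ?R y x" for y by (auto simp: ran_def)
  then have "lang N = UNIV" unfolding N(2) by blast
  then obtain g where g: "g \<in> FP" "\<forall>y. g y \<in> acc N y"
    using Easy_UNIV_selector[OF U N(1)] by blast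
  have "\<forall>y \<in> ran f. f (guessed (g y)) = Some y" using dec g(2) by blast
  then have "FP_invertible f"
    unfolding FP_invertible_def by (rule bexI[OF _ FP_comp[OF guessed_FP g(1)]])
  with ninv show False ..
qed

subsection \<open>A one-way function from a machine without easy paths\<close>

text \<open>Self-delimiting in the first component: each letter of \<open>x\<close> is preceded by
  \<open>True\<close>, and \<open>False\<close> announces \<open>p\<close>. One left-to-right scan
  can therefore extract either part.\<close>

fun pair :: "bstring \<Rightarrow> bstring \<Rightarrow> bstring" where
  "pair [] p = False # p"
| "pair (b # x) p = True # b # pair x p"

text \<open>State \<open>0\<close> expects a marker, state \<open>1\<close> a bit of \<open>x\<close>, and in state \<open>2\<close> the rest is \<open>p\<close>.\<close>

definition pair_next :: "nat \<Rightarrow> bool option \<Rightarrow> nat" where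
  "pair_next s a = (if s = 0 \<and> a = Some True then 1 else if s = 1 then 0 else 2)"

definition fst_st :: transitions where
  "fst_st s a b = (pair_next s a, if s = 1 then a else None)"

definition snd_st :: transitions where
  "snd_st s a b = (pair_next s a, if s = 2 then a else None)"

definition pair_fst :: "bstring \<Rightarrow> bstring" where
  "pair_fst w = transduce fst_st (\<lambda>_. None) 0 w []"

definition pair_snd :: "bstring \<Rightarrow> bstring" where
  "pair_snd w = transduce snd_st (\<lambda>_. None) 0 w []"

lemma pair_fst_pair [simp]: "pair_fst (pair x p) = x"
proof -
  have "transduce fst_st (\<lambda>_. None) 2 p [] = []" for p
    by (induction p) (auto simp: fst_st_def pair_next_def)
  then have "transduce fst_st (\<lambda>_. None) 0 (pair x p) [] = x"
    by (induction x) (auto simp: fst_st_def pair_next_def)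
  then show ?thesis by (simp add: pair_fst_def)
qed

lemma pair_snd_pair [simp]: "pair_snd (pair x p) = p"
proof -
  have "transduce snd_st (\<lambda>_. None) 2 p [] = p" for p
    by (induction p) (auto simp: snd_st_def pair_next_def)
  then have "transduce snd_st (\<lambda>_. None) 0 (pair x p) [] = p"
    by (induction x) (auto simp: snd_st_def pair_next_def)
  then show ?thesis by (simp add: pair_snd_def)
qed

lemma length_pair: "length (pair x p) = 2 * length x + length p + 1"
  by (induction x) auto

fun is_pair :: "bstring \<Rightarrow> bool" where
  "is_pair [] \<longleftrightarrow> False"
| "is_pair (False # p) \<longleftrightarrow> True"
| "is_pair [True] \<longleftrightarrow> False"
| "is_pair (True # b # w) \<longleftrightarrow> is_pair w"

lemma is_pair_iff: "is_pair w \<longleftrightarrow> (\<exists>x p. w = pair x p)"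
proof (induction w rule: is_pair.induct)
  case 1
  have "[] \<noteq> pair x p" for x p by (cases x) auto
  then show ?case by simp
next
  case (2 p)
  have "False # p = pair [] p" by simp
  then show ?case by (metis is_pair.simps(2))
next
  case 3
  have "[True] \<noteq> pair x p" for x p by (cases x) auto
  then show ?case by simp
next
  case (4 b w)
  have "True # b # w = pair x p \<longleftrightarrow> (\<exists>x'. x = b # x' \<and> w = pair x' p)" for x p by (cases x) auto
  then show ?case using 4 by auto
qed

lemma computable_pair_fst:
  assumes "computable n g" "0 < n"
  shows "computable n (\<lambda>xs. pair_fst (g xs))"
  unfolding pair_fst_def
  by (rule computable_transduce1[of 3 _ n g]) (use assms in \<open>auto simp: fst_st_def pair_next_def\<close>)

lemma computable_pair_snd:
  assumes "computable n g" "0 < n"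
  shows "computable n (\<lambda>xs. pair_snd (g xs))"
  unfolding pair_snd_def
  by (rule computable_transduce1[of 3 _ n g]) (use assms in \<open>auto simp: snd_st_def pair_next_def\<close>)

text \<open>State \<open>2\<close> is entered by reading the separator, and a string is a pair as
  soon as it contains one in marker position.\<close>

lemma decidable_is_pair:
  assumes "computable n g" "0 < n"
  shows "decidable n (\<lambda>xs. is_pair (g xs))"
proof -
  let ?st = "\<lambda>s a (b :: bool option). (pair_next s a, None :: bool option)"
  let ?fin = "\<lambda>s :: nat. Some (s = 2)"
  have 2: "transduce ?st ?fin 2 w [] = [True]" for w
    by (induction w) (auto simp: pair_next_def)
  have "transduce ?st ?fin 0 w [] = [is_pair w]" for w
    by (induction w rule: is_pair.induct) (simp_all add: pair_next_def 2[unfolded pair_next_def])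
  moreover have "computable n (\<lambda>xs. transduce ?st ?fin 0 (g xs) [])"
    by (rule computable_transduce1[of 3 _ n g]) (use assms in \<open>auto simp: pair_next_def\<close>)
  ultimately show ?thesis unfolding decidable_def by simp
qed

lemma UNIV_notin_Easy_imp_total_one_way:
  assumes "UNIV \<notin> Easy_FewP"
  shows "\<exists>f. is_total f \<and> is_surjective f \<and> poly_one_one_way f"
proof -
  have "(UNIV :: bstring set) \<in> FewP" using UNIV_PTIME PTIME_subset_FewP by blast
  then obtain N where N: "FewP_machine N" "lang N = UNIV"
    and hard: "\<not> (\<exists>f\<in>FP. \<forall>x. f x \<in> acc N x)"
    using assms unfolding Easy_FewP_def by auto
  have wf: "wf_tm N" and npm: "NPM N" using N by (auto simp: FewP_machine_def NPM_def)
  obtain p :: "nat poly" where p: "\<And>x \<pi>. \<pi> \<in> acc N x \<Longrightarrow> length \<pi> \<le> poly p (length x)"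
    using acc_length_bounded[OF npm] by blast
  obtain r :: "nat poly" where r: "\<forall>x. finite (acc N x) \<and> card (acc N x) \<le> poly r (length x)"
    using N unfolding FewP_machine_def by blast
  \<comment> \<open>\<open>pair_fst\<close> and \<open>pair_snd\<close> return something on every
    string, so \<open>is_pair\<close> keeps malformed strings from becoming further preimages of
    values \<open>False # x\<close>.\<close>
  define valid where "valid v \<longleftrightarrow> is_pair v \<and> pair_snd v \<in> acc N (pair_fst v)" for v
  \<comment> \<open>The empty string, which has no leading bit, is fixed. All strings but the valid
    encodings keep their length, so honesty is at stake only for values that begin with
    \<open>False\<close>.\<close>
  define F where "F w = (if w = [] then [] else if w = False # tl w \<and> valid (tl w)
    then False # pair_fst (tl w) else True # tl w)" for w
  have n: "computable 1 (\<lambda>xs. xs ! 0)" by (rule computable_nth) simp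
  have "decidable 1 (\<lambda>xs. valid (tl (xs ! 0)))"
    unfolding valid_def
    by (intro decidable_and decidable_is_pair decidable_acc[OF wf] computable_pair_fst computable_pair_snd computable_tl n) simp_all
  then have "computable 1 (\<lambda>xs. F (xs ! 0))"
    unfolding F_def
    by (intro computable_if decidable_eq decidable_and computable_const computable_Cons computable_pair_fst computable_tl n) simp_all
  from FP_I[OF this] have F: "F \<in> FP" by simp
  have F_pair: "F (False # pair x \<pi>) = False # x" if "\<pi> \<in> acc N x" for x \<pi>
    using that by (auto simp: F_def valid_def is_pair_iff)
  have F_True: "F (True # v) = True # v" for v by (simp add: F_def)
  \<comment> \<open>Values that begin with \<open>False\<close> arise from valid pairs only; hence
    an inverse cannot avoid exposing accepting paths.\<close>
  have inv_False: "\<exists>\<pi> \<in> acc N x. w = False # pair x \<pi>" if "F w = False # x" for w x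
  proof -
    have w: "w = False # tl w" "valid (tl w)" "x = pair_fst (tl w)"
      using that by (auto simp: F_def split: if_splits)
    then obtain x' \<pi> where v: "tl w = pair x' \<pi>" by (auto simp: valid_def is_pair_iff)
    then have "x' = x" using w(3) by simp
    moreover have "\<pi> \<in> acc N x'" using w(2) v by (simp add: valid_def)
    ultimately show ?thesis using w(1) v by auto
  qed
  let ?f = "\<lambda>w. Some (F w)"
  have surj: "\<exists>w. F w = y" for y
  proof -
    consider "y = []" | v where "y = True # v" | x where "y = False # x"
      by (cases y rule: list.exhaust; cases "hd y") auto
    then show ?thesis
    proof cases
      case 1
      then show ?thesis by (intro exI[of _ "[]"]) (simp add: F_def)
    next
      case 2
      then show ?thesis using F_True by blast
    next
      case (3 x)
      \<comment> \<open>Surjectivity rests on \<open>lang N = UNIV\<close>: some accepting path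
        exists for every \<open>x\<close>.\<close>
      have "acc N x \<noteq> {}" using N(2) by (auto simp: lang_def)
      then show ?thesis using F_pair 3 by blast
    qed
  qed
  have ran: "ran ?f = UNIV" using surj by (auto simp: ran_def)
  have "honest ?f"
    unfolding honest_def
  proof (intro exI allI impI)
    fix w y assume "?f w = Some y"
    then have y: "F w = y" by simp
    \<comment> \<open>\<open>pair x \<pi>\<close> has \<open>2 * length x + length \<pi> + 1\<close>
      letters, and the leading bit is one more.\<close>
    show "length w \<le> poly (p + [:2, 2:]) (length y)"
    proof (cases "\<exists>x. y = False # x")
      case True
      then obtain x where x: "y = False # x" by blast
      obtain \<pi> where "\<pi> \<in> acc N x" "w = False # pair x \<pi>" using inv_False[of w x] y x by blast
      then have "length w \<le> 2 * length x + poly p (length x) + 2" using p[of \<pi> x] by (simp add: length_pair)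
      moreover have "poly p (length x) \<le> poly p (length y)" using x by (intro poly_mono_nat) simp
      ultimately show ?thesis using x by simp
    next
      case False
      then have "length w = length y" using y by (auto simp: F_def split: if_splits)
      then show ?thesis by simp
    qed
  qed
  moreover have "poly_one ?f"
    unfolding poly_one_def
  proof (intro exI ballI)
    fix y
    \<comment> \<open>This set contains the preimages for every shape of \<open>y\<close> at once;
      its three elements besides the pairs give the constant \<open>3\<close>.\<close>
    let ?A = "insert [] (insert (True # tl y) (insert (False # tl y) ((\<lambda>\<pi>. False # pair (tl y) \<pi>) ` acc N (tl y))))"
    have sub: "{w. ?f w = Some y} \<subseteq> ?A"
    proof
      fix w assume "w \<in> {w. ?f w = Some y}"
      then have w: "F w = y" by simp
      show "w \<in> ?A"
      proof (cases "\<exists>x. y = False # x")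
        case True
        then show ?thesis using inv_False[of w "tl y"] w by auto
      next
        case False
        then have "w = [] \<or> tl w = tl y" using w by (auto simp: F_def split: if_splits)
        then show ?thesis by (cases w; cases "hd w") auto
      qed
    qed
    have fin: "finite (acc N (tl y))" and c: "card (acc N (tl y)) \<le> poly r (length (tl y))"
      using r by blast+
    have finA: "finite ?A" using fin by simp
    have "card ?A \<le> Suc (Suc (Suc (card ((\<lambda>\<pi>. False # pair (tl y) \<pi>) ` acc N (tl y)))))"
      by (intro order_trans[OF card_insert_le_m1[rotated] ] card_insert_le_m1 order_refl) simp_all
    also have "\<dots> \<le> Suc (Suc (Suc (card (acc N (tl y)))))" using card_image_le[OF fin] by simp
    also have "\<dots> \<le> poly (r + [:3:]) (length y)"
      using c poly_mono_nat[of "length (tl y)" "length y" r] by simp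
    finally show "finite {x. ?f x = Some y} \<and> card {x. ?f x = Some y} \<le> poly (r + [:3:]) (length y)"
      using card_mono[OF finA sub] finite_subset[OF sub finA] by simp
  qed
  moreover have "ptime_computable ?f" using F by (simp add: FP_def)
  moreover have "\<not> FP_invertible ?f"
  proof
    assume "FP_invertible ?f"
    then obtain g where g: "g \<in> FP" "\<forall>y. F (g y) = y" unfolding FP_invertible_def ran by auto
    \<comment> \<open>Every preimage of \<open>False # x\<close> carries an accepting path on
      \<open>x\<close> behind its leading bit, and extracting it is a polynomial-time
      computation.\<close>
    have "pair_snd (tl (g (False # x))) \<in> acc N x" for x
    proof -
      have "F (g (False # x)) = False # x" using g(2) by blast
      from inv_False[OF this] obtain \<pi> where "\<pi> \<in> acc N x" "g (False # x) = False # pair x \<pi>" by blast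
      then show ?thesis by simp
    qed
    moreover have "computable 1 (\<lambda>xs. pair_snd (tl (g (False # xs ! 0))))"
      by (intro computable_pair_snd computable_tl computable_FP[OF g(1)] computable_Cons n) simp_all
    from FP_I[OF this] have "(\<lambda>x. pair_snd (tl (g (False # x)))) \<in> FP" by simp
    ultimately have "\<exists>f\<in>FP. \<forall>x. f x \<in> acc N x"
      by (intro bexI[where x = "\<lambda>x. pair_snd (tl (g (False # x)))"]) auto
    with hard show False ..
  qed
  moreover have "is_total ?f" "is_surjective ?f"
    using ran by (auto simp: is_total_def is_surjective_def)
  ultimately show ?thesis unfolding poly_one_one_way_def by blast
qed

theorem theorem2:
  shows "all_equivalent
    [\<exists>f. is_surjective f \<and> poly_one_one_way f,
     \<exists>f. is_total f \<and> is_surjective f \<and> poly_one_one_way f,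
     \<exists>f. is_total f \<and> poly_one_one_way f \<and> ran f \<in> PTIME,
     \<exists>f. poly_one_one_way f \<and> ran f \<in> PTIME,
     Easy_FewP \<noteq> PTIME,
     UNIV \<notin> Easy_FewP,
     \<not> (\<forall>L \<in> Easy_FewP. - L \<in> Easy_FewP)]"
  (is "all_equivalent [?S1, ?S2, ?S3, ?S4, ?S5, ?S6, ?S7]")
proof -
  \<comment> \<open>The sixth statement serves as the hub: each of the others is shown equivalent to
    it, directly or along a cycle.\<close>
  have 21: "?S2 \<Longrightarrow> ?S1" by blast
  have 14: "?S1 \<Longrightarrow> ?S4" using UNIV_PTIME unfolding is_surjective_def by metis
  have 23: "?S2 \<Longrightarrow> ?S3" using UNIV_PTIME unfolding is_surjective_def by metis
  have 34: "?S3 \<Longrightarrow> ?S4" by blast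
  have 46: "?S4 \<Longrightarrow> ?S6" using one_way_imp_UNIV_notin_Easy by blast
  have 62: "?S6 \<Longrightarrow> ?S2" by (rule UNIV_notin_Easy_imp_total_one_way)
  have 65: "?S6 \<Longrightarrow> ?S5" using UNIV_PTIME by blast
  have eq: "Easy_FewP = PTIME" if "\<not> ?S6"
    using Easy_UNIV_imp_PTIME_subset Easy_subset_PTIME that by blast
  then have 56: "?S5 \<Longrightarrow> ?S6" by blast
  have 67: "?S7" if ?S6
  proof
    assume "\<forall>L \<in> Easy_FewP. - L \<in> Easy_FewP"
    \<comment> \<open>Finite languages are easy by definition, so closure under complement would
      make the set of all strings easy.\<close>
    moreover have "{} \<in> Easy_FewP" by (simp add: Easy_FewP_def)
    ultimately have "- {} \<in> Easy_FewP" by blast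
    then show False using that by simp
  qed
  \<comment> \<open>If \<open>UNIV\<close> is easy, the class coincides with \<open>PTIME\<close>,
    which is closed under complement.\<close>
  have 76: "?S7 \<Longrightarrow> ?S6" using eq Compl_PTIME by metis
  have "?S1 = ?S6" "?S2 = ?S6" "?S3 = ?S6" "?S4 = ?S6" "?S5 = ?S6" "?S7 = ?S6"
    using 21 14 23 34 46 62 65 56 67 76 by argo+
  then show ?thesis unfolding all_equivalent_def by simp
qed

end
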